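(* Let $\mathcal H_1,\mathcal H_0,\mathcal H_{-1}$ be Hilbert spaces and let $T=(T_1,\ldots,T_n)$ be a commuting row contraction on $\mathcal H_1\oplus\mathcal H_0\oplus\mathcal H_{-1}$ such that, with respect to this decomposition, $$T_i=\begin{bmatrix}S_i&*&*\\0&N_i&*\\0&0&C_i\end{bmatrix}\qquad(i=1,\ldots,n).$$ Then $S$ on $\mathcal H_1$, $N$ on $\mathcal H_0$ and $C$ on $\mathcal H_{-1}$ are commuting row contractions, and there exist Hilbert spaces $\mathcal E_1,\mathcal E_2,\mathcal E$ and unitary operators $U_1\in\mathcal B(\mathcal D_{N^*}\oplus\mathcal E,\mathcal D_C\oplus\mathcal E_1)$ and $U_2\in\mathcal B(\mathcal D_{S^*}\oplus\mathcal E_2,\mathcal D_N\oplus\mathcal E)$ such that $\theta_T$ coincides with $$\begin{bmatrix}\theta_C&0\\0&I_{H^2_n\otimes\mathcal E_1}\end{bmatrix}(I_{H^2_n}\otimes U_1)\begin{bmatrix}\theta_N&0\\0&I_{H^2_n\otimes\mathcal E}\end{bmatrix}(I_{H^2_n}\otimes U_2)\begin{bmatrix}\theta_S&0\\0&I_{H^2_n\otimes\mathcal E_2}\end{bmatrix}.$$ In addition, if $S$ is a Drury–Arveson shift and $C$ is a spherical co-isometry, then there exist a Hilbert space $\mathcal E$, a co-isometry $G_1\in\mathcal B(H^2_n\otimes(\mathcal D_{N^*}\oplus\mathcal E),H^2_n\otimes\mathcal D_{T^*})$ and a partial isometry $G_2\in\mathcal B(H^2_n\otimes\mathcal D_T,H^2_n\otimes(\mathcal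 D_N\oplus\mathcal E))$ such that $$\theta_T=G_1\begin{bmatrix}\theta_N&0\\0&I_{H^2_n\otimes\mathcal E}\end{bmatrix}G_2.$$
   Context: For $\alpha\in\mathbb Z_+^n$ ($\mathbb Z_+=\{0,1,2,\ldots\}$), $|\alpha|=\sum_i\alpha_i$ and $\gamma_\alpha=|\alpha|!/\alpha!$. $\mathbb B^n$ is the open unit ball of $\mathbb C^n$. $H^2_n$ is the Drury–Arveson space, i.e. power series $\sum_\alpha a_\alpha z^\alpha$ on $\mathbb B^n$ with $\sum_\alpha|a_\alpha|^2/\gamma_\alpha<\infty$ (reproducing kernel $(1-\sum_iz_i\bar w_i)^{-1}$); $H^2_n(\mathcal E)\cong H^2_n\otimes\mathcal E$ is its $\mathcal E$-valued version, and $M_{z_i}$ is multiplication by $z_i$. A commuting tuple is a Drury–Arveson shift if it is unitarily equivalent to $(M_{z_1},\ldots,M_{z_n})$ on $H^2_n(\mathcal W)$ for some Hilbert space $\mathcal W$. A tuple $C$ is a spherical co-isometry if $\sum_iC_iC_i^*=I$. A commuting row contraction on $\mathcal H$ is an $n$-tuple $T=(T_1,\ldots,T_n)$ of pairwise commuting bounded operators with $\sum_iT_iT_i^*\le I$; $T$ also denotes the row operator $\mathcal H^n\to\mathcal H$. Defect operators: $D_T=(I-T^*T)^{1/2}$ on $\mathcal H^n$, $D_{T^*}=(I-TT^* )^{1/2}$ on $\mathcal H$; $\mathcal D_T=\overline{\mathrm{ran}}\,D_T$, $\mathcal D_{T^*}=\overline{\mathrm{ran}}\,D_{T^*}$. The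 characteristic function of $T$ is $\theta_T:\mathbb B^n\to\mathcal B(\mathcal D_T,\mathcal D_{T^*})$, $$\theta_T(z)=\Big(-T+D_{T^*}\big(I_{\mathcal H}-\sum_{i=1}^nz_iT_i^*\big)^{-1}ZD_T\Big)\Big|_{\mathcal D_T},\qquad Z=(z_1I_{\mathcal H},\ldots,z_nI_{\mathcal H}).$$ It is a multiplier from $H^2_n(\mathcal D_T)$ to $H^2_n(\mathcal D_{T^*})$ and is identified throughout with the bounded multiplication operator $f\mapsto\theta_Tf$ from $H^2_n\otimes\mathcal D_T$ to $H^2_n\otimes\mathcal D_{T^*}$. Operators $M\in\mathcal B(H^2_n\otimes\mathcal E,H^2_n\otimes\mathcal E_* )$ and $M'\in\mathcal B(H^2_n\otimes\mathcal E',H^2_n\otimes\mathcal E'_* )$ coincide if there are unitaries $W:\mathcal E\to\mathcal E'$, $W_*:\mathcal E_*\to\mathcal E_*'$ with $(I\otimes W_* )M=M'(I\otimes W)$. *)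

theory Defs
  imports "HOL-Analysis.Analysis"
begin

section \<open>Complex Hilbert spaces\<close>

text \<open>The complex inner product is linear in its first argument; its real part is the
  library's real inner product, so norm and topology are the ones of \<^class>\<open>real_inner\<close>.\<close>

class chilbert_space = real_inner + complete_space +
  fixes scaleC :: "complex \<Rightarrow> 'a \<Rightarrow> 'a" (infixr "*\<^sub>C" 75)
    and cinner :: "'a \<Rightarrow> 'a \<Rightarrow> complex"
  assumes scaleC_add_right: "c *\<^sub>C (x + y) = c *\<^sub>C x + c *\<^sub>C y"
    and scaleC_add_left: "(c + d) *\<^sub>C x = c *\<^sub>C x + d *\<^sub>C x"
    and scaleC_scaleC: "c *\<^sub>C (d *\<^sub>C x) = (c * d) *\<^sub>C x"
    and scaleC_of_real: "complex_of_real r *\<^sub>C x = r *\<^sub>R x"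
    and cinner_commute: "cinner x y = cnj (cinner y x)"
    and cinner_add_left: "cinner (x + y) z = cinner x z + cinner y z"
    and cinner_scaleC_left: "cinner (c *\<^sub>C x) y = c * cinner x y"
    and Re_cinner: "Re (cinner x y) = inner x y"

subclass (in chilbert_space) banach ..

lemma cinner_self: "cinner x x = complex_of_real ((norm x)\<^sup>2)"
proof -
  have "Im (cinner x x) = 0"
    using arg_cong[OF cinner_commute[of x x], of Im] by simp
  then show ?thesis
    by (simp add: complex_eq_iff Re_cinner power2_norm_eq_inner)
qed

lemma norm_scaleC: "norm (c *\<^sub>C x) = cmod c * norm (x :: 'a::chilbert_space)"
proof -
  have "cinner (c *\<^sub>C x) (c *\<^sub>C x) = c * cnj c * cinner x x"
    using arg_cong[OF cinner_commute[of x "c *\<^sub>C x"], of "(*) c"] cinner_commute[of x x]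
    by (simp add: cinner_scaleC_left mult.assoc)
  then have "complex_of_real ((norm (c *\<^sub>C x))\<^sup>2) = complex_of_real ((cmod c * norm x)\<^sup>2)"
    unfolding cinner_self complex_norm_square[symmetric] by (simp add: power_mult_distrib)
  then have "(norm (c *\<^sub>C x))\<^sup>2 = (cmod c * norm x)\<^sup>2"
    using of_real_eq_iff by blast
  then show ?thesis
    by (rule power2_eq_imp_eq) auto
qed

lemma cmod_cinner_le: "cmod (cinner x y) \<le> norm x * norm (y :: 'a::chilbert_space)"
proof (cases "cinner x y = 0")
  case False
  define u where "u = cnj (cinner x y) / complex_of_real (cmod (cinner x y))"
  have u: "cmod u = 1"
    using False by (simp add: u_def norm_divide)
  have "cinner (u *\<^sub>C x) y = complex_of_real (cmod (cinner x y))"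
    using False complex_norm_square[of "cinner x y"]
    by (simp add: u_def cinner_scaleC_left divide_simps power2_eq_square mult.commute)
  then have "cmod (cinner x y) = inner (u *\<^sub>C x) y"
    using Re_cinner[of "u *\<^sub>C x" y] by simp
  also have "\<dots> \<le> norm (u *\<^sub>C x) * norm y"
    by (rule norm_cauchy_schwarz)
  finally show ?thesis
    by (simp add: norm_scaleC u)
qed auto

instantiation prod :: (chilbert_space, chilbert_space) chilbert_space
begin
definition "c *\<^sub>C x = (c *\<^sub>C fst x, c *\<^sub>C snd x)"
definition "cinner x y = cinner (fst x) (fst y) + cinner (snd x) (snd y)"
instance
proof
  fix x y :: "'a \<times> 'b"
  show "cinner x y = cnj (cinner y x)"
    unfolding cinner_prod_def
    using cinner_commute[of "fst x" "fst y"] cinner_commute[of "snd x" "snd y"] by simp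
qed (auto simp: scaleC_prod_def cinner_prod_def scaleC_add_right scaleC_add_left scaleC_scaleC
       scaleC_of_real cinner_add_left cinner_scaleC_left Re_cinner inner_prod_def algebra_simps
       prod_eq_iff)
end

instantiation vec :: (chilbert_space, finite) chilbert_space
begin
definition "c *\<^sub>C x = (\<chi> i. c *\<^sub>C (x $ i))"
definition "cinner x y = (\<Sum>i\<in>UNIV. cinner (x $ i) (y $ i))"
instance
proof
  fix x y :: "('a, 'b) vec"
  show "cinner x y = cnj (cinner y x)"
    unfolding cinner_vec_def cnj_sum by (rule sum.cong[OF refl]) (rule cinner_commute)
qed (auto simp: scaleC_vec_def cinner_vec_def scaleC_add_right scaleC_add_left scaleC_scaleC
       scaleC_of_real cinner_add_left cinner_scaleC_left Re_cinner inner_vec_def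
       vec_eq_iff sum.distrib sum_distrib_left)
end


section \<open>Operators between closed subspaces\<close>

text \<open>Hilbert spaces that are not a whole type are closed complex subspaces of one. An operator
  from \<open>E\<close> to \<open>F\<close> is a function on the ambient types that is only looked at on \<open>E\<close>.\<close>

definition closed_csubspace :: "'a::chilbert_space set \<Rightarrow> bool" where
  "closed_csubspace E \<longleftrightarrow>
     closed E \<and> 0 \<in> E \<and> (\<forall>x\<in>E. \<forall>y\<in>E. x + y \<in> E) \<and> (\<forall>c. \<forall>x\<in>E. c *\<^sub>C x \<in> E)"

definition bounded_op ::
  "'a::chilbert_space set \<Rightarrow> 'b::chilbert_space set \<Rightarrow> ('a \<Rightarrow> 'b) \<Rightarrow> bool" where
  "bounded_op E F A \<longleftrightarrow>
     (\<forall>x\<in>E. A x \<in> F) \<and>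
     (\<forall>x\<in>E. \<forall>y\<in>E. A (x + y) = A x + A y) \<and>
     (\<forall>c. \<forall>x\<in>E. A (c *\<^sub>C x) = c *\<^sub>C A x) \<and>
     (\<exists>K. \<forall>x\<in>E. norm (A x) \<le> K * norm x)"

definition adj_on ::
  "'a::chilbert_space set \<Rightarrow> 'b::chilbert_space set \<Rightarrow> ('a \<Rightarrow> 'b) \<Rightarrow> 'b \<Rightarrow> 'a" where
  "adj_on E F A y = (THE x. x \<in> E \<and> (\<forall>u\<in>E. cinner (A u) y = cinner u x))"

abbreviation adj :: "('a::chilbert_space \<Rightarrow> 'b::chilbert_space) \<Rightarrow> 'b \<Rightarrow> 'a" where
  "adj \<equiv> adj_on UNIV UNIV"

definition unitary_op ::
  "'a::chilbert_space set \<Rightarrow> 'b::chilbert_space set \<Rightarrow> ('a \<Rightarrow> 'b) \<Rightarrow> bool" where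
  "unitary_op E F U \<longleftrightarrow>
     bounded_op E F U \<and> (\<forall>x\<in>E. adj_on E F U (U x) = x) \<and> (\<forall>y\<in>F. U (adj_on E F U y) = y)"

definition coisometry_op ::
  "'a::chilbert_space set \<Rightarrow> 'b::chilbert_space set \<Rightarrow> ('a \<Rightarrow> 'b) \<Rightarrow> bool" where
  "coisometry_op E F G \<longleftrightarrow> bounded_op E F G \<and> (\<forall>y\<in>F. G (adj_on E F G y) = y)"

definition partial_isometry_op ::
  "'a::chilbert_space set \<Rightarrow> 'b::chilbert_space set \<Rightarrow> ('a \<Rightarrow> 'b) \<Rightarrow> bool" where
  "partial_isometry_op E F G \<longleftrightarrow>
     bounded_op E F G \<and>
     (\<forall>x\<in>E. (\<forall>k\<in>E. G k = 0 \<longrightarrow> cinner x k = 0) \<longrightarrow> norm (G x) = norm x)"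

definition positive_op :: "('a::chilbert_space \<Rightarrow> 'a) \<Rightarrow> bool" where
  "positive_op A \<longleftrightarrow> bounded_op UNIV UNIV A \<and> (\<forall>x. cinner (A x) x \<in> \<real>\<^sub>\<ge>\<^sub>0)"

definition sqrt_op :: "('a::chilbert_space \<Rightarrow> 'a) \<Rightarrow> 'a \<Rightarrow> 'a" where
  "sqrt_op A = (THE B. positive_op B \<and> B \<circ> B = A)"


section \<open>Row contractions, defect operators, characteristic function\<close>

text \<open>The index type \<open>'n\<close> stands for \<open>{1,\<dots>,n}\<close>, so \<open>'h ^ 'n\<close> is the \<open>n\<close>-fold direct sum.\<close>

definition row :: "('n::finite \<Rightarrow> 'h::chilbert_space \<Rightarrow> 'h) \<Rightarrow> 'h ^ 'n \<Rightarrow> 'h" where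
  "row T x = (\<Sum>i\<in>UNIV. T i (x $ i))"

definition commuting_row_contraction :: "('n::finite \<Rightarrow> 'h::chilbert_space \<Rightarrow> 'h) \<Rightarrow> bool" where
  "commuting_row_contraction T \<longleftrightarrow>
     (\<forall>i. bounded_op UNIV UNIV (T i)) \<and>
     (\<forall>i j. T i \<circ> T j = T j \<circ> T i) \<and>
     positive_op (\<lambda>h. h - (\<Sum>i\<in>UNIV. T i (adj (T i) h)))"

definition spherical_coisometry :: "('n::finite \<Rightarrow> 'h::chilbert_space \<Rightarrow> 'h) \<Rightarrow> bool" where
  "spherical_coisometry T \<longleftrightarrow> (\<forall>h. (\<Sum>i\<in>UNIV. T i (adj (T i) h)) = h)"

definition defect :: "('n::finite \<Rightarrow> 'h::chilbert_space \<Rightarrow> 'h) \<Rightarrow> 'h ^ 'n \<Rightarrow> 'h ^ 'n" where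
  "defect T = sqrt_op (\<lambda>x. x - adj (row T) (row T x))"

definition defect_star :: "('n::finite \<Rightarrow> 'h::chilbert_space \<Rightarrow> 'h) \<Rightarrow> 'h \<Rightarrow> 'h" where
  "defect_star T = sqrt_op (\<lambda>h. h - row T (adj (row T) h))"

definition defect_space :: "('n::finite \<Rightarrow> 'h::chilbert_space \<Rightarrow> 'h) \<Rightarrow> ('h ^ 'n) set" where
  "defect_space T = closure (range (defect T))"

definition defect_star_space :: "('n::finite \<Rightarrow> 'h::chilbert_space \<Rightarrow> 'h) \<Rightarrow> 'h set" where
  "defect_star_space T = closure (range (defect_star T))"

definition char_fun ::
  "('n::finite \<Rightarrow> 'h::chilbert_space \<Rightarrow> 'h) \<Rightarrow> complex ^ 'n \<Rightarrow> 'h ^ 'n \<Rightarrow> 'h" where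
  "char_fun T z x =
     - row T x +
     defect_star T
       (inv (\<lambda>h. h - (\<Sum>i\<in>UNIV. (z $ i) *\<^sub>C adj (T i) h))
         (row (\<lambda>i h. (z $ i) *\<^sub>C h) (defect T x)))"

definition upper_triangular3 ::
  "('a::chilbert_space \<times> 'b::chilbert_space \<times> 'c::chilbert_space \<Rightarrow> 'a \<times> 'b \<times> 'c) \<Rightarrow>
   ('a \<Rightarrow> 'a) \<Rightarrow> ('b \<Rightarrow> 'b) \<Rightarrow> ('c \<Rightarrow> 'c) \<Rightarrow> bool" where
  "upper_triangular3 T S N C \<longleftrightarrow>
     bounded_op UNIV UNIV S \<and> bounded_op UNIV UNIV N \<and> bounded_op UNIV UNIV C \<and>
     (\<exists>X Y Z. bounded_op UNIV UNIV X \<and> bounded_op UNIV UNIV Y \<and> bounded_op UNIV UNIV Z \<and>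
        (\<forall>h\<^sub>1 h\<^sub>0 h\<^sub>2. T (h\<^sub>1, h\<^sub>0, h\<^sub>2) = (S h\<^sub>1 + X h\<^sub>0 + Y h\<^sub>2, N h\<^sub>0 + Z h\<^sub>2, C h\<^sub>2)))"


section \<open>The vector-valued Drury-Arveson space\<close>

definition multinom :: "('n::finite \<Rightarrow> nat) \<Rightarrow> real" where
  "multinom \<alpha> = fact (\<Sum>i\<in>UNIV. \<alpha> i) / (\<Prod>i\<in>UNIV. fact (\<alpha> i))"

lemma multinom_pos: "multinom \<alpha> > 0"
  by (auto simp: multinom_def intro!: divide_pos_pos prod_pos)

text \<open>Elements are represented by their families of Taylor coefficients.\<close>

typedef (overloaded) ('n::finite, 'a::chilbert_space) h2 =
  "{a :: ('n \<Rightarrow> nat) \<Rightarrow> 'a. (\<lambda>\<alpha>. (norm (a \<alpha>))\<^sup>2 / multinom \<alpha>) summable_on UNIV}"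
  morphisms coeff Abs_h2
  by (rule exI[of _ "\<lambda>_. 0"]) simp

lemma coeff_summable: "(\<lambda>\<alpha>. (norm (coeff f \<alpha>))\<^sup>2 / multinom \<alpha>) summable_on UNIV"
  using coeff[of f] by simp

lemma coeff_Abs_h2:
  "(\<lambda>\<alpha>. (norm (a \<alpha>))\<^sup>2 / multinom \<alpha>) summable_on UNIV \<Longrightarrow> coeff (Abs_h2 a) = a"
  by (simp add: Abs_h2_inverse)

lemma h2_eqI: "(\<And>\<alpha>. coeff f \<alpha> = coeff g \<alpha>) \<Longrightarrow> f = g"
  by (metis coeff_inject ext)

lemma norm_add_sq_le: "(norm (x + y))\<^sup>2 \<le> 2 * (norm x)\<^sup>2 + 2 * (norm (y::'a::real_normed_vector))\<^sup>2"
proof -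
  have "(norm (x + y))\<^sup>2 \<le> (norm x + norm y)\<^sup>2"
    by (simp add: norm_triangle_ineq power_mono)
  also have "\<dots> \<le> 2 * (norm x)\<^sup>2 + 2 * (norm y)\<^sup>2"
    using zero_le_power2[of "norm x - norm y"] by (simp add: power2_eq_square algebra_simps)
  finally show ?thesis .
qed

lemma summable_coeff_add:
  "(\<lambda>\<alpha>. (norm (coeff f \<alpha> + coeff g \<alpha>))\<^sup>2 / multinom \<alpha>) summable_on UNIV"
proof (rule summable_on_comparison_test)
  show "(\<lambda>\<alpha>. 2 * ((norm (coeff f \<alpha>))\<^sup>2 / multinom \<alpha>) + 2 * ((norm (coeff g \<alpha>))\<^sup>2 / multinom \<alpha>))
      summable_on UNIV"
    by (intro summable_on_add summable_on_cmult_right coeff_summable)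
  show "(norm (coeff f \<alpha> + coeff g \<alpha>))\<^sup>2 / multinom \<alpha> \<le>
      2 * ((norm (coeff f \<alpha>))\<^sup>2 / multinom \<alpha>) + 2 * ((norm (coeff g \<alpha>))\<^sup>2 / multinom \<alpha>)" for \<alpha>
    using divide_right_mono[OF norm_add_sq_le[of "coeff f \<alpha>" "coeff g \<alpha>"], of "multinom \<alpha>"]
      multinom_pos[of \<alpha>] by (simp add: add_divide_distrib)
qed (simp add: less_imp_le multinom_pos)

lemma summable_coeff_scaleC:
  "(\<lambda>\<alpha>. (norm (c *\<^sub>C coeff f \<alpha>))\<^sup>2 / multinom \<alpha>) summable_on UNIV"
  using summable_on_cmult_right[OF coeff_summable, of "(cmod c)\<^sup>2" f]
  by (simp add: norm_scaleC power_mult_distrib)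

lemma summable_cinner:
  "(\<lambda>\<alpha>. cinner (coeff f \<alpha>) (coeff g \<alpha>) / complex_of_real (multinom \<alpha>)) summable_on UNIV"
proof (rule abs_summable_summable, rule summable_on_comparison_test)
  show "(\<lambda>\<alpha>. (norm (coeff f \<alpha>))\<^sup>2 / multinom \<alpha> + (norm (coeff g \<alpha>))\<^sup>2 / multinom \<alpha>)
      summable_on UNIV"
    by (intro summable_on_add coeff_summable)
  fix \<alpha> :: "'a \<Rightarrow> nat"
  have "norm (coeff f \<alpha>) * norm (coeff g \<alpha>) \<le> (norm (coeff f \<alpha>))\<^sup>2 + (norm (coeff g \<alpha>))\<^sup>2"
  proof -
    have "0 \<le> norm (coeff f \<alpha>) * norm (coeff g \<alpha>)" by simp
    then show ?thesis
      using sum_squares_bound[of "norm (coeff f \<alpha>)" "norm (coeff g \<alpha>)"] by linarith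
  qed
  then have "cmod (cinner (coeff f \<alpha>) (coeff g \<alpha>)) \<le> (norm (coeff f \<alpha>))\<^sup>2 + (norm (coeff g \<alpha>))\<^sup>2"
    using cmod_cinner_le[of "coeff f \<alpha>" "coeff g \<alpha>"] by linarith
  then show "norm (cinner (coeff f \<alpha>) (coeff g \<alpha>) / complex_of_real (multinom \<alpha>)) \<le>
      (norm (coeff f \<alpha>))\<^sup>2 / multinom \<alpha> + (norm (coeff g \<alpha>))\<^sup>2 / multinom \<alpha>"
    using multinom_pos[of \<alpha>] by (simp add: norm_divide divide_right_mono flip: add_divide_distrib)
qed auto

instantiation h2 :: (finite, chilbert_space) real_vector
begin
definition "0 = Abs_h2 (\<lambda>_. 0)"
definition "f + g = Abs_h2 (\<lambda>\<alpha>. coeff f \<alpha> + coeff g \<alpha>)"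
definition "- f = Abs_h2 (\<lambda>\<alpha>. - coeff f \<alpha>)"
definition "f - g = Abs_h2 (\<lambda>\<alpha>. coeff f \<alpha> - coeff g \<alpha>)"
definition "r *\<^sub>R f = Abs_h2 (\<lambda>\<alpha>. r *\<^sub>R coeff f \<alpha>)"

lemma coeff_zero: "coeff (0 :: ('a, 'b) h2) \<alpha> = 0"
  by (simp add: zero_h2_def coeff_Abs_h2)

lemma coeff_add: "coeff (f + g :: ('a, 'b) h2) \<alpha> = coeff f \<alpha> + coeff g \<alpha>"
  by (simp add: plus_h2_def coeff_Abs_h2 summable_coeff_add)

lemma coeff_uminus: "coeff (- f :: ('a, 'b) h2) \<alpha> = - coeff f \<alpha>"
  by (simp add: uminus_h2_def coeff_Abs_h2 coeff_summable)

lemma coeff_diff: "coeff (f - g :: ('a, 'b) h2) \<alpha> = coeff f \<alpha> - coeff g \<alpha>"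
  using summable_coeff_add[of f "- g"]
  by (simp add: minus_h2_def coeff_Abs_h2 coeff_uminus)

lemma coeff_scaleR: "coeff (r *\<^sub>R f :: ('a, 'b) h2) \<alpha> = r *\<^sub>R coeff f \<alpha>"
  using summable_coeff_scaleC[of "complex_of_real r" f]
  by (simp add: scaleR_h2_def coeff_Abs_h2 scaleC_of_real)

lemmas coeff_simps = coeff_zero coeff_add coeff_uminus coeff_diff coeff_scaleR

instance
  by standard (auto intro!: h2_eqI simp: coeff_simps algebra_simps)

end

instantiation h2 :: (finite, chilbert_space) real_inner
begin

definition "inner f g = (\<Sum>\<^sub>\<infinity>\<alpha>. inner (coeff f \<alpha>) (coeff g \<alpha>) / multinom \<alpha>)"
definition "norm f = sqrt (\<Sum>\<^sub>\<infinity>\<alpha>. (norm (coeff f \<alpha>))\<^sup>2 / multinom \<alpha>)"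
definition "dist (f :: ('a, 'b) h2) g = norm (f - g)"
definition "sgn (f :: ('a, 'b) h2) = f /\<^sub>R norm f"
definition "uniformity = (INF e\<in>{0<..}. principal {(f :: ('a, 'b) h2, g). dist f g < e})"
definition "open U = (\<forall>f\<in>U. eventually (\<lambda>(f', g). f' = f \<longrightarrow> g \<in> U) (uniformity :: (('a, 'b) h2 \<times> ('a, 'b) h2) filter))"

lemma summable_inner:
  "(\<lambda>\<alpha>. inner (coeff f \<alpha>) (coeff (g :: ('a, 'b) h2) \<alpha>) / multinom \<alpha>) summable_on UNIV"
  using summable_on_Re[OF summable_cinner[of f g]] by (simp add: Re_cinner)

instance
proof
  fix f g h :: "('a, 'b) h2" and r s :: real
  show "dist f g = norm (f - g)" by (rule dist_h2_def)
  show "sgn f = f /\<^sub>R norm f" by (rule sgn_h2_def)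
  show "uniformity = (INF e\<in>{0<..}. principal {(f :: ('a, 'b) h2, g). dist f g < e})"
    by (rule uniformity_h2_def)
  show "open U = (\<forall>f\<in>U. eventually (\<lambda>(f', g). f' = f \<longrightarrow> g \<in> U) uniformity)"
    for U :: "('a, 'b) h2 set"
    by (rule open_h2_def)
  show "inner f g = inner g f"
    by (simp add: inner_h2_def inner_commute)
  show "inner (f + g) h = inner f h + inner g h"
    using infsum_add[OF summable_inner[of f h] summable_inner[of g h]]
    by (simp add: inner_h2_def coeff_simps inner_add_left add_divide_distrib)
  show "inner (r *\<^sub>R f) g = r * inner f g"
    using infsum_cmult_right'[of r "\<lambda>\<alpha>. inner (coeff f \<alpha>) (coeff g \<alpha>) / multinom \<alpha>" UNIV]
    by (simp add: inner_h2_def coeff_simps)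
  show "0 \<le> inner f f"
    unfolding inner_h2_def by (rule infsum_nonneg) (simp add: less_imp_le multinom_pos)
  show "inner f f = 0 \<longleftrightarrow> f = 0"
  proof
    assume *: "inner f f = 0"
    show "f = 0"
    proof (rule h2_eqI)
      fix \<alpha>
      have "inner (coeff f \<alpha>) (coeff f \<alpha>) / multinom \<alpha> = 0"
        by (rule nonneg_infsum_le_0D[where A = UNIV and f = "\<lambda>\<alpha>. inner (coeff f \<alpha>) (coeff f \<alpha>) / multinom \<alpha>"])
          (use * summable_inner[of f f] in \<open>simp_all add: inner_h2_def less_imp_le multinom_pos\<close>)
      then show "coeff f \<alpha> = coeff 0 \<alpha>"
        using multinom_pos[of \<alpha>] by (simp add: coeff_simps)
    qed
  qed (simp add: inner_h2_def coeff_simps)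
  show "norm f = sqrt (inner f f)"
    by (simp add: norm_h2_def inner_h2_def power2_norm_eq_inner)
qed

end

lemma norm_coeff_sum_le:
  assumes "finite F"
  shows "(\<Sum>\<alpha>\<in>F. (norm (coeff f \<alpha>))\<^sup>2 / multinom \<alpha>) \<le> (norm f)\<^sup>2"
proof -
  have nn: "0 \<le> (norm (coeff f \<alpha>))\<^sup>2 / multinom \<alpha>" for \<alpha>
    using multinom_pos[of \<alpha>] by simp
  have "(\<Sum>\<alpha>\<in>F. (norm (coeff f \<alpha>))\<^sup>2 / multinom \<alpha>) \<le>
      (\<Sum>\<^sub>\<infinity>\<alpha>. (norm (coeff f \<alpha>))\<^sup>2 / multinom \<alpha>)"
    by (rule finite_sum_le_infsum) (use assms nn coeff_summable in auto)
  also have "\<dots> = (norm f)\<^sup>2"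
    unfolding norm_h2_def by (subst real_sqrt_pow2) (auto intro!: infsum_nonneg nn)
  finally show ?thesis .
qed

lemma norm_coeff_le: "norm (coeff f \<alpha>) \<le> sqrt (multinom \<alpha>) * norm f"
proof -
  have "(norm (coeff f \<alpha>))\<^sup>2 \<le> (sqrt (multinom \<alpha>) * norm f)\<^sup>2"
    using norm_coeff_sum_le[of "{\<alpha>}" f] multinom_pos[of \<alpha>]
    by (simp add: power_mult_distrib less_imp_le divide_le_eq mult.commute)
  then show ?thesis
    by (rule power2_le_imp_le) (simp add: less_imp_le multinom_pos)
qed

instantiation h2 :: (finite, chilbert_space) chilbert_space
begin

definition "c *\<^sub>C f = Abs_h2 (\<lambda>\<alpha>. c *\<^sub>C coeff f \<alpha>)"
definition "cinner f g = (\<Sum>\<^sub>\<infinity>\<alpha>. cinner (coeff f \<alpha>) (coeff g \<alpha>) / complex_of_real (multinom \<alpha>))"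

lemma coeff_scaleC: "coeff (c *\<^sub>C f :: ('a, 'b) h2) \<alpha> = c *\<^sub>C coeff f \<alpha>"
  by (simp add: scaleC_h2_def coeff_Abs_h2 summable_coeff_scaleC)

instance
proof
  fix f g h :: "('a, 'b) h2" and c d :: complex and r :: real
  show "cinner f g = cnj (cinner g f)"
    unfolding cinner_h2_def infsum_cnj[symmetric] complex_cnj_divide complex_cnj_complex_of_real
  proof (rule infsum_cong)
    fix \<alpha> :: "'a \<Rightarrow> nat"
    show "cinner (coeff f \<alpha>) (coeff g \<alpha>) / complex_of_real (multinom \<alpha>) =
        cnj (cinner (coeff g \<alpha>) (coeff f \<alpha>)) / complex_of_real (multinom \<alpha>)"
      using cinner_commute[of "coeff f \<alpha>" "coeff g \<alpha>"] by (rule arg_cong)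
  qed
  show "cinner (f + g) h = cinner f h + cinner g h"
    using infsum_add[OF summable_cinner[of f h] summable_cinner[of g h]]
    by (simp add: cinner_h2_def coeff_simps cinner_add_left add_divide_distrib)
  show "cinner (c *\<^sub>C f) g = c * cinner f g"
    using infsum_cmult_right'[of c "\<lambda>\<alpha>. cinner (coeff f \<alpha>) (coeff g \<alpha>) / complex_of_real (multinom \<alpha>)" UNIV]
    by (simp add: cinner_h2_def coeff_scaleC cinner_scaleC_left)
  show "Re (cinner f g) = inner f g"
    using infsum_Re[OF summable_cinner[of f g]]
    by (simp add: cinner_h2_def inner_h2_def Re_cinner)
next
  fix X :: "nat \<Rightarrow> ('a, 'b) h2"
  assume X: "Cauchy X"
  have "Cauchy (\<lambda>n. coeff (X n) \<alpha>)" for \<alpha>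
  proof (rule metric_CauchyI)
    fix e :: real
    assume e: "0 < e"
    define k where "k = sqrt (multinom \<alpha>)"
    have k: "k > 0" using multinom_pos by (simp add: k_def)
    obtain M where M: "\<And>m n. m \<ge> M \<Longrightarrow> n \<ge> M \<Longrightarrow> dist (X m) (X n) < e / k"
      using metric_CauchyD[OF X, of "e / k"] e k by auto
    have "dist (coeff (X m) \<alpha>) (coeff (X n) \<alpha>) < e" if "m \<ge> M" "n \<ge> M" for m n
      using norm_coeff_le[of "X m - X n" \<alpha>] M[OF that] k
      by (simp add: coeff_simps dist_norm field_simps flip: k_def)
    then show "\<exists>M. \<forall>m\<ge>M. \<forall>n\<ge>M. dist (coeff (X m) \<alpha>) (coeff (X n) \<alpha>) < e"
      by blast
  qed
  then have "\<exists>l. (\<lambda>n. coeff (X n) \<alpha>) \<longlonglongrightarrow> l" for \<alpha>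
    using Cauchy_convergent convergent_def by blast
  then obtain a where a: "\<And>\<alpha>. (\<lambda>n. coeff (X n) \<alpha>) \<longlonglongrightarrow> a \<alpha>"
    by metis
  have fin: "(\<Sum>\<alpha>\<in>F. (norm (a \<alpha> - coeff (X n) \<alpha>))\<^sup>2 / multinom \<alpha>) \<le> e\<^sup>2"
    if "finite F" "e > 0" "\<And>m. m \<ge> M \<Longrightarrow> norm (X m - X n) \<le> e" for F n e M
  proof (rule LIMSEQ_le_const2)
    show "(\<lambda>m. \<Sum>\<alpha>\<in>F. (norm (coeff (X m) \<alpha> - coeff (X n) \<alpha>))\<^sup>2 / multinom \<alpha>) \<longlonglongrightarrow>
        (\<Sum>\<alpha>\<in>F. (norm (a \<alpha> - coeff (X n) \<alpha>))\<^sup>2 / multinom \<alpha>)"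
      by (intro tendsto_intros a) (simp add: less_imp_neq[OF multinom_pos, symmetric])
    have "(\<Sum>\<alpha>\<in>F. (norm (coeff (X m) \<alpha> - coeff (X n) \<alpha>))\<^sup>2 / multinom \<alpha>) \<le> e\<^sup>2" if "m \<ge> M" for m
      using norm_coeff_sum_le[OF \<open>finite F\<close>, of "X m - X n"]
        power_mono[OF \<open>\<And>m. m \<ge> M \<Longrightarrow> norm (X m - X n) \<le> e\<close>[OF that], of 2]
      by (simp add: coeff_simps)
    then show "\<exists>N. \<forall>m\<ge>N. (\<Sum>\<alpha>\<in>F. (norm (coeff (X m) \<alpha> - coeff (X n) \<alpha>))\<^sup>2 / multinom \<alpha>) \<le> e\<^sup>2"
      by blast
  qed
  have summ: "(\<lambda>\<alpha>. (norm (a \<alpha> - coeff (X n) \<alpha>))\<^sup>2 / multinom \<alpha>) summable_on UNIV"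
    if "e > 0" "\<And>m. m \<ge> M \<Longrightarrow> norm (X m - X n) \<le> e" for n e M
  proof (rule nonneg_bdd_above_summable_on)
    show "0 \<le> (norm (a \<alpha> - coeff (X n) \<alpha>))\<^sup>2 / multinom \<alpha>" for \<alpha>
      using multinom_pos[of \<alpha>] by simp
    show "bdd_above (sum (\<lambda>\<alpha>. (norm (a \<alpha> - coeff (X n) \<alpha>))\<^sup>2 / multinom \<alpha>) ` {F. F \<subseteq> UNIV \<and> finite F})"
      by (rule bdd_aboveI2[where M = "e\<^sup>2"]) (use fin that in blast)
  qed
  have ev: "\<exists>M. \<forall>m\<ge>M. \<forall>n\<ge>M. norm (X m - X n) \<le> e" if "e > 0" for e
    using metric_CauchyD[OF X that] by (metis dist_norm less_imp_le)
  obtain M1 where M1: "\<And>m n. m \<ge> M1 \<Longrightarrow> n \<ge> M1 \<Longrightarrow> norm (X m - X n) \<le> 1"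
    using ev[of 1] by auto
  define D where "D = Abs_h2 (\<lambda>\<alpha>. a \<alpha> - coeff (X M1) \<alpha>)"
  have D: "coeff D \<alpha> = a \<alpha> - coeff (X M1) \<alpha>" for \<alpha>
    unfolding D_def by (subst coeff_Abs_h2[OF summ[of 1 M1]]) (auto intro: M1)
  define L where "L = D + X M1"
  have L: "coeff L \<alpha> = a \<alpha>" for \<alpha>
    by (simp add: L_def coeff_simps D)
  have "X \<longlonglongrightarrow> L"
  proof (rule metric_LIMSEQ_I)
    fix e :: real
    assume e: "0 < e"
    obtain M where M: "\<And>m n. m \<ge> M \<Longrightarrow> n \<ge> M \<Longrightarrow> norm (X m - X n) \<le> e / 2"
      using ev[of "e / 2"] e by auto
    have "dist (X n) L < e" if n: "n \<ge> M" for n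
    proof -
      have "(\<Sum>\<^sub>\<infinity>\<alpha>. (norm (a \<alpha> - coeff (X n) \<alpha>))\<^sup>2 / multinom \<alpha>) \<le> (e / 2)\<^sup>2"
      proof (rule infsum_le_finite_sums)
        show "(\<lambda>\<alpha>. (norm (a \<alpha> - coeff (X n) \<alpha>))\<^sup>2 / multinom \<alpha>) summable_on UNIV"
          by (rule summ[of "e / 2" M]) (use e M n in auto)
        show "(\<Sum>\<alpha>\<in>F. (norm (a \<alpha> - coeff (X n) \<alpha>))\<^sup>2 / multinom \<alpha>) \<le> (e / 2)\<^sup>2" if "finite F" for F
          by (rule fin[of F "e / 2" M]) (use e M n that in auto)
      qed
      then have "norm (L - X n) \<le> sqrt ((e / 2)\<^sup>2)"
        unfolding norm_h2_def coeff_diff L by (rule real_sqrt_le_mono)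
      then show ?thesis
        using e by (simp add: dist_norm norm_minus_commute)
    qed
    then show "\<exists>M. \<forall>n\<ge>M. dist (X n) L < e"
      by blast
  qed
  then show "convergent X"
    by (rule convergentI)
qed (auto intro!: h2_eqI simp: coeff_scaleC coeff_simps scaleC_add_right scaleC_add_left
       scaleC_scaleC scaleC_of_real)

end

definition h2_space :: "'a::chilbert_space set \<Rightarrow> ('n::finite, 'a) h2 set" where
  "h2_space E = {f. \<forall>\<alpha>. coeff f \<alpha> \<in> E}"

definition h2_eval :: "('n::finite, 'a::chilbert_space) h2 \<Rightarrow> complex ^ 'n \<Rightarrow> 'a" where
  "h2_eval f z = (\<Sum>\<^sub>\<infinity>\<alpha>. (\<Prod>i\<in>UNIV. (z $ i) ^ \<alpha> i) *\<^sub>C coeff f \<alpha>)"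

text \<open>Multiplication by an operator-valued function on the unit ball. Elements are determined by
  their values on the ball, so this is the product whenever the product lies in the space.\<close>

definition mult_op ::
  "(complex ^ 'n::finite \<Rightarrow> 'a::chilbert_space \<Rightarrow> 'b::chilbert_space) \<Rightarrow>
   ('n, 'a) h2 \<Rightarrow> ('n, 'b) h2" where
  "mult_op \<Phi> f = (THE g. \<forall>z\<in>ball 0 1. h2_eval g z = \<Phi> z (h2_eval f z))"

abbreviation char_op ::
  "('n::finite \<Rightarrow> 'h::chilbert_space \<Rightarrow> 'h) \<Rightarrow> ('n, 'h ^ 'n) h2 \<Rightarrow> ('n, 'h) h2" where
  "char_op T \<equiv> mult_op (char_fun T)"

abbreviation coord_mult :: "'n::finite \<Rightarrow> ('n, 'a::chilbert_space) h2 \<Rightarrow> ('n, 'a) h2" where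
  "coord_mult i \<equiv> mult_op (\<lambda>z x. (z $ i) *\<^sub>C x)"

text \<open>\<open>I \<otimes> W\<close> sends \<open>z\<^sup>\<alpha> \<otimes> x\<close> to \<open>z\<^sup>\<alpha> \<otimes> W x\<close>.\<close>

definition ampliation ::
  "('a::chilbert_space \<Rightarrow> 'b::chilbert_space) \<Rightarrow> ('n::finite, 'a) h2 \<Rightarrow> ('n, 'b) h2" where
  "ampliation W f = Abs_h2 (\<lambda>\<alpha>. W (coeff f \<alpha>))"

text \<open>The diagonal block operator with entries \<open>A\<close> and \<open>B\<close>, where \<open>H\<^sup>2 \<otimes> (E \<oplus> F)\<close> is identified with
  \<open>(H\<^sup>2 \<otimes> E) \<oplus> (H\<^sup>2 \<otimes> F)\<close>.\<close>

definition block_diag ::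
  "(('n::finite, 'a::chilbert_space) h2 \<Rightarrow> ('n, 'b::chilbert_space) h2) \<Rightarrow>
   (('n, 'c::chilbert_space) h2 \<Rightarrow> ('n, 'd::chilbert_space) h2) \<Rightarrow>
   ('n, 'a \<times> 'c) h2 \<Rightarrow> ('n, 'b \<times> 'd) h2" where
  "block_diag A B f =
     Abs_h2 (\<lambda>\<alpha>. (coeff (A (ampliation fst f)) \<alpha>, coeff (B (ampliation snd f)) \<alpha>))"

definition coincide ::
  "'a::chilbert_space set \<Rightarrow> 'b::chilbert_space set \<Rightarrow> (('n::finite, 'a) h2 \<Rightarrow> ('n, 'b) h2) \<Rightarrow>
   'c::chilbert_space set \<Rightarrow> 'd::chilbert_space set \<Rightarrow> (('n, 'c) h2 \<Rightarrow> ('n, 'd) h2) \<Rightarrow> bool" where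
  "coincide E E' M F F' M' \<longleftrightarrow>
     bounded_op (h2_space E) (h2_space E') M \<and> bounded_op (h2_space F) (h2_space F') M' \<and>
     (\<exists>W W'. unitary_op E F W \<and> unitary_op E' F' W' \<and>
        (\<forall>f\<in>h2_space E. ampliation W' (M f) = M' (ampliation W f)))"

definition drury_arveson_shift_on ::
  "'w::chilbert_space set \<Rightarrow> ('n::finite \<Rightarrow> 'h::chilbert_space \<Rightarrow> 'h) \<Rightarrow> bool" where
  "drury_arveson_shift_on \<W> S \<longleftrightarrow>
     (\<exists>U :: 'h \<Rightarrow> ('n, 'w) h2. unitary_op UNIV (h2_space \<W>) U \<and>
        (\<forall>i h. U (S i h) = coord_mult i (U h)))"

end

theory Submission
  imports Defs
begin

text \<open>The characteristic function of \<open>T\<close> is the transfer function of the unitary Halmos colligation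
  with main operator \<open>T\<^sup>*\<close> on \<open>\<H> \<oplus> \<H>\<^sup>n\<close>. Since \<open>T\<^sub>i\<^sup>*\<close> is lower triangular, this colligation splits as a
  cascade of three unitary colligations with state spaces \<open>\<H>\<^sub>1\<close>, \<open>\<H>\<^sub>0\<close>, \<open>\<H>\<^sub>-\<^sub>1\<close> and main operators
  \<open>S\<^sup>*\<close>, \<open>N\<^sup>*\<close>, \<open>C\<^sup>*\<close>, and cascading multiplies transfer functions. A unitary colligation is determined by
  its main operator up to a direct summand that does not interact with the state, so the three factors are the
  characteristic functions of \<open>S\<close>, \<open>N\<close>, \<open>C\<close> extended by identities; the unitaries between them identify
  the two descriptions of the intermediate spaces. If \<open>S\<close> is a shift then \<open>\<theta>\<^sub>S = 0\<close>, and if \<open>C\<close> is a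
  spherical co-isometry then the target of \<open>\<theta>\<^sub>C\<close> is \<open>0\<close>, so that the outer factors reduce to partial
  isometries.\<close>

section \<open>Hilbert space preliminaries\<close>

text \<open>Factors are compared on Taylor coefficients, not pointwise: a colligation acts as a
  linear system on multi-indexed sequences, so cascading is a splitting of the state sequence and no
  resolvent identities occur. The way back to \<open>mult_op\<close>, which is defined through
  values on the ball, is an energy inequality for contractive colligations. It holds with the
  Drury-Arveson weights because the multinomial coefficient of \<alpha> is the sum of those of its
  predecessors. The second obstacle is one of types. The three auxiliary spaces have to be closed
  subspaces of the single type \<open>('a \<times> 'b \<times> 'c) ^ 'n\<close>, whereas the kernels
  that split off in the cascade lie in the larger sum of H^n and H. Each of them needs its own
  isometric embedding into H^n: the first comes from the defect space of T, the last from a single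
  coordinate, and only the middle one needs a polar decomposition.\<close>

lemma scaleC_zero_right [simp]: "c *\<^sub>C 0 = (0::'a::chilbert_space)"
  using scaleC_add_right[of c 0 "0::'a"] by simp

lemma scaleC_minus_right: "c *\<^sub>C (- x) = - (c *\<^sub>C (x::'a::chilbert_space))"
  using scaleC_add_right[of c x "-x"] by (simp add: eq_neg_iff_add_eq_0 add.commute)

lemma scaleC_diff_right: "c *\<^sub>C (x - y) = c *\<^sub>C x - c *\<^sub>C (y::'a::chilbert_space)"
  using scaleC_add_right[of c x "-y"] by (simp add: scaleC_minus_right)

lemma scaleC_minus_one: "(-1) *\<^sub>C x = - (x::'a::chilbert_space)"
  using scaleC_of_real[of "-1" x] by simp

lemma scaleC_sum_right: "c *\<^sub>C (\<Sum>i\<in>I. f i) = (\<Sum>i\<in>I. c *\<^sub>C (f i::'a::chilbert_space))"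
  by (induction I rule: infinite_finite_induct) (auto simp: scaleC_add_right)

lemma scaleC_scaleR: "c *\<^sub>C (r *\<^sub>R x) = r *\<^sub>R (c *\<^sub>C (x::'a::chilbert_space))"
  by (simp add: scaleC_scaleC mult.commute flip: scaleC_of_real)

lemma bounded_linear_scaleC: "bounded_linear (\<lambda>x::'a::chilbert_space. c *\<^sub>C x)"
  by (rule bounded_linear_intro[where K = "cmod c"])
    (auto simp: scaleC_add_right scaleC_scaleR norm_scaleC)

lemma cinner_add_right: "cinner x (y + z) = cinner x y + cinner x (z::'a::chilbert_space)"
  by (metis cinner_add_left cinner_commute complex_cnj_add)

lemma cinner_scaleC_right: "cinner x (c *\<^sub>C y) = cnj c * cinner x (y::'a::chilbert_space)"
  by (metis cinner_commute cinner_scaleC_left complex_cnj_mult)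

lemma cinner_zero_left [simp]: "cinner 0 (y::'a::chilbert_space) = 0"
  using cinner_add_left[of 0 0 y] by simp

lemma cinner_zero_right [simp]: "cinner (y::'a::chilbert_space) 0 = 0"
  using cinner_add_right[of y 0 0] by simp

lemma Im_cinner: "Im (cinner x y) = - inner (\<i> *\<^sub>C x) (y::'a::chilbert_space)"
  by (simp add: cinner_scaleC_left flip: Re_cinner)

lemma inner_ii_left: "inner (\<i> *\<^sub>C x) y = - inner x (\<i> *\<^sub>C (y::'a::chilbert_space))"
  by (simp add: cinner_scaleC_left cinner_scaleC_right flip: Re_cinner)

text \<open>The imaginary part of \<open>cinner x y\<close> is, up to sign, a real inner product
  with \<i> moved into the first slot. Complex identities thus reduce to real ones, and most
  arguments below are made with \<open>inner\<close>.\<close>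

lemma cinner_eqI:
  assumes "inner x y = inner u v" "inner (\<i> *\<^sub>C x) y = inner (\<i> *\<^sub>C u) v"
  shows "cinner (x::'a::chilbert_space) y = cinner (u::'b::chilbert_space) v"
  using assms by (simp add: complex_eq_iff Im_cinner Re_cinner)

lemma closed_csubspace_minus: "closed_csubspace M \<Longrightarrow> x \<in> M \<Longrightarrow> - x \<in> M"
  unfolding closed_csubspace_def by (metis scaleC_minus_one)

lemma closed_csubspace_diff: "closed_csubspace M \<Longrightarrow> x \<in> M \<Longrightarrow> y \<in> M \<Longrightarrow> x - y \<in> M"
  using closed_csubspace_minus[of M y] unfolding closed_csubspace_def
  by (metis add_uminus_conv_diff)

lemma closed_csubspace_scaleR: "closed_csubspace M \<Longrightarrow> x \<in> M \<Longrightarrow> r *\<^sub>R x \<in> M"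
  unfolding closed_csubspace_def by (metis scaleC_of_real)

lemma closed_csubspace_UNIV: "closed_csubspace UNIV"
  by (simp add: closed_csubspace_def)

lemma closed_csubspace_Times:
  "closed_csubspace E \<Longrightarrow> closed_csubspace F \<Longrightarrow> closed_csubspace (E \<times> F)"
  by (auto simp: closed_csubspace_def closed_Times zero_prod_def scaleC_prod_def)

text \<open>A minimising sequence is Cauchy by the parallelogram law.\<close>

lemma closest_point_exists_hilbert:
  fixes x :: "'a::{real_inner,complete_space}"
  assumes S: "closed S" "convex S" "S \<noteq> {}"
  shows "\<exists>p\<in>S. \<forall>q\<in>S. norm (x - p) \<le> norm (x - q)"
proof -
  define d where "d = Inf ((\<lambda>q. norm (x - q)) ` S)"
  have bdd: "bdd_below ((\<lambda>q. norm (x - q)) ` S)"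
    by (rule bdd_belowI[of _ 0]) auto
  have d_le: "d \<le> norm (x - q)" if "q \<in> S" for q
    unfolding d_def using that bdd by (auto intro: cInf_lower)
  have d0: "d \<ge> 0"
    unfolding d_def using S(3) by (intro cInf_greatest) auto
  have "\<exists>q\<in>S. norm (x - q) < d + 1 / Suc n" for n
  proof -
    have "Inf ((\<lambda>q. norm (x - q)) ` S) < d + 1 / Suc n"
      unfolding d_def by simp
    then show ?thesis
      using cInf_lessD[of "(\<lambda>q. norm (x - q)) ` S"] S(3) by blast
  qed
  then obtain p where p: "\<And>n. p n \<in> S" "\<And>n. norm (x - p n) < d + 1 / Suc n"
    by metis
  have par: "(norm (p m - p n))\<^sup>2 \<le> 2 * ((norm (x - p m))\<^sup>2 - d\<^sup>2) + 2 * ((norm (x - p n))\<^sup>2 - d\<^sup>2)"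
    for m n
  proof -
    have "(1/2) *\<^sub>R p m + (1/2) *\<^sub>R p n \<in> S"
      using S(2) p(1) by (auto simp: convex_def)
    then have "d\<^sup>2 \<le> (norm (x - ((1/2) *\<^sub>R p m + (1/2) *\<^sub>R p n)))\<^sup>2"
      using d_le d0 by (intro power_mono) auto
    also have "x - ((1/2) *\<^sub>R p m + (1/2) *\<^sub>R p n) = (1/2) *\<^sub>R ((x - p m) + (x - p n))"
      by (simp add: algebra_simps flip: scaleR_add_left)
    also have "(norm \<dots>)\<^sup>2 = (norm ((x - p m) + (x - p n)))\<^sup>2 / 4"
      by (simp add: power_mult_distrib power2_eq_square)
    finally have "4 * d\<^sup>2 \<le> (norm ((x - p m) + (x - p n)))\<^sup>2" by simp
    moreover have "(norm ((x - p m) + (x - p n)))\<^sup>2 + (norm ((x - p n) - (x - p m)))\<^sup>2 =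
        2 * (norm (x - p m))\<^sup>2 + 2 * (norm (x - p n))\<^sup>2"
      by (simp add: power2_norm_eq_inner inner_add_left inner_add_right inner_diff_left
          inner_diff_right inner_commute)
    ultimately show ?thesis by simp
  qed
  have lim: "(\<lambda>n. (d + 1 / Suc n)\<^sup>2 - d\<^sup>2) \<longlonglongrightarrow> (d + 0)\<^sup>2 - d\<^sup>2"
    by (intro tendsto_intros) (rule LIMSEQ_Suc[OF lim_1_over_n])
  have "Cauchy p"
  proof (rule metric_CauchyI)
    fix e :: real assume e: "e > 0"
    have "\<forall>\<^sub>F n in sequentially. (d + 1 / Suc n)\<^sup>2 - d\<^sup>2 < e\<^sup>2 / 4"
      by (rule order_tendstoD(2)[OF lim]) (use e in auto)
    then obtain M where M: "\<And>n. n \<ge> M \<Longrightarrow> (d + 1 / Suc n)\<^sup>2 - d\<^sup>2 < e\<^sup>2 / 4"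
      unfolding eventually_sequentially by blast
    have "dist (p m) (p n) < e" if "m \<ge> M" "n \<ge> M" for m n
    proof -
      have "(norm (x - p k))\<^sup>2 \<le> (d + 1 / Suc k)\<^sup>2" for k
        by (intro power_mono less_imp_le[OF p(2)]) simp
      note k = this[of m] this[of n]
      have arith: "y < e'" if "y \<le> 2 * (a - c) + 2 * (b - c)" "a \<le> a'" "b \<le> b'"
          "a' - c < e' / 4" "b' - c < e' / 4" for y a b c a' b' e' :: real
        using that by argo
      have "(norm (p m - p n))\<^sup>2 < e\<^sup>2"
        by (rule arith[OF par k M[OF that(1)] M[OF that(2)]])
      then show ?thesis
        using e by (simp add: dist_norm power_less_imp_less_base)
    qed
    then show "\<exists>M. \<forall>m\<ge>M. \<forall>n\<ge>M. dist (p m) (p n) < e" by blast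
  qed
  then obtain l where l: "p \<longlonglongrightarrow> l"
    using Cauchy_convergent convergent_def by blast
  have "l \<in> S"
    using S(1) p(1) l closed_sequentially by blast
  moreover have "norm (x - l) \<le> d"
  proof (rule LIMSEQ_le)
    show "(\<lambda>n. norm (x - p n)) \<longlonglongrightarrow> norm (x - l)" by (intro tendsto_intros l)
    have "(\<lambda>n. d + 1 / real (Suc n)) \<longlonglongrightarrow> d + 0"
      by (intro tendsto_intros) (rule LIMSEQ_Suc[OF lim_1_over_n])
    then show "(\<lambda>n. d + 1 / real (Suc n)) \<longlonglongrightarrow> d" by simp
  qed (use p(2) less_imp_le in blast)
  ultimately show ?thesis
    using d_le order_trans by blast
qed

lemma orthogonal_projection_exists:
  fixes x :: "'a::{real_inner,complete_space}"
  assumes M: "closed M" "subspace M"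
  shows "\<exists>p\<in>M. \<forall>m\<in>M. inner (x - p) m = 0"
proof -
  obtain p where p: "p \<in> M" "\<And>q. q \<in> M \<Longrightarrow> norm (x - p) \<le> norm (x - q)"
    using closest_point_exists_hilbert[OF M(1) subspace_imp_convex[OF M(2)], of x]
      subspace_0[OF M(2)] by blast
  have "inner (x - p) m = 0" if m: "m \<in> M" for m
  proof (cases "m = 0")
    case False
    \<comment> \<open>This t minimises the distance from x to p + t m along the line through p, so
      minimality of p forces the inner product to vanish.\<close>
    define t where "t = inner (x - p) m / inner m m"
    have "p + t *\<^sub>R m \<in> M"
      using M(2) p(1) m by (simp add: subspace_add subspace_mul)
    then have "(norm (x - p))\<^sup>2 \<le> (norm (x - (p + t *\<^sub>R m)))\<^sup>2"
      using p(2) by (intro power_mono) auto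
    also have "\<dots> = (norm (x - p))\<^sup>2 - 2 * t * inner (x - p) m + t\<^sup>2 * inner m m"
      unfolding power2_norm_eq_inner
      by (simp add: inner_add_left inner_add_right inner_diff_left inner_diff_right inner_commute
          power2_eq_square algebra_simps)
    also have "\<dots> = (norm (x - p))\<^sup>2 - (inner (x - p) m)\<^sup>2 / inner m m"
      using False by (simp add: t_def power2_eq_square field_simps)
    finally have "(inner (x - p) m)\<^sup>2 / inner m m \<le> 0" by simp
    then show ?thesis
      using False by (simp add: divide_le_0_iff) (metis inner_ge_zero inner_eq_zero_iff order_antisym)
  qed auto
  then show ?thesis using p(1) by blast
qed

text \<open>For nonzero f the orthogonal complement of the kernel is a line. The residual z of a
  projection onto the kernel spans it, and the representing vector is the multiple of z that gives f
  the right value at z.\<close>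

lemma riesz_representation:
  fixes f :: "'a::{real_inner,complete_space} \<Rightarrow> real"
  assumes f: "bounded_linear f"
  shows "\<exists>v. \<forall>u. f u = inner u v"
proof (cases "\<forall>u. f u = 0")
  case False
  interpret f: bounded_linear f by fact
  obtain x where x: "f x \<noteq> 0" using False by blast
  have "closed {u. f u = 0}"
    by (intro closed_Collect_eq continuous_intros linear_continuous_on f)
  moreover have "subspace {u. f u = 0}"
    by (auto simp: subspace_def f.add f.scaleR f.zero)
  ultimately obtain p where p: "f p = 0" "\<And>m. f m = 0 \<Longrightarrow> inner (x - p) m = 0"
    using orthogonal_projection_exists[of "{u. f u = 0}" x] by auto
  define z where "z = x - p"
  have fz: "f z \<noteq> 0" using x p(1) by (simp add: z_def f.diff)
  then have z0: "inner z z \<noteq> 0" using f.zero by auto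
  have "f u = inner u ((f z / inner z z) *\<^sub>R z)" for u
  proof -
    have "f (u - (f u / f z) *\<^sub>R z) = 0" using fz by (simp add: f.diff f.scaleR)
    then have "inner z (u - (f u / f z) *\<^sub>R z) = 0" using p(2) by (simp add: z_def)
    then have "inner z u = f u / f z * inner z z" by (simp add: inner_diff_right)
    then show ?thesis using fz z0 by (simp add: field_simps inner_commute)
  qed
  then show ?thesis by blast
qed (auto intro: exI[of _ 0])


section \<open>Bounded operators and adjoints\<close>

abbreviation bop :: "('a::chilbert_space \<Rightarrow> 'b::chilbert_space) \<Rightarrow> bool" where
  "bop \<equiv> bounded_op UNIV UNIV"

lemma bop_bounded_linear: "bop A \<Longrightarrow> bounded_linear A"
proof -
  assume A: "bop A"
  then obtain K where "\<And>x. norm (A x) \<le> K * norm x" by (auto simp: bounded_op_def)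
  moreover have "A (r *\<^sub>R x) = r *\<^sub>R A x" for r x
    using A by (simp add: bounded_op_def flip: scaleC_of_real)
  ultimately show ?thesis
    using A by (intro bounded_linear_intro[where K = K]) (auto simp: bounded_op_def mult.commute)
qed

lemma bopI: "bounded_linear A \<Longrightarrow> (\<And>c x. A (c *\<^sub>C x) = c *\<^sub>C A x) \<Longrightarrow> bop A"
  using bounded_linear.bounded[of A]
  by (auto simp: bounded_op_def linear_add[OF bounded_linear.linear] mult.commute)

lemma bop_scaleC: "bop A \<Longrightarrow> A (c *\<^sub>C x) = c *\<^sub>C A x"
  by (simp add: bounded_op_def)

lemmas bop_add = bop_bounded_linear[THEN bounded_linear.linear, THEN linear_add]
lemmas bop_diff = bop_bounded_linear[THEN bounded_linear.linear, THEN linear_diff]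
lemmas bop_minus = bop_bounded_linear[THEN bounded_linear.linear, THEN linear_neg]
lemmas bop_zero = bop_bounded_linear[THEN bounded_linear.linear, THEN linear_0]
lemmas bop_scaleR = bop_bounded_linear[THEN bounded_linear.linear, THEN linear_cmul]
lemmas bop_tendsto = bop_bounded_linear[THEN bounded_linear.tendsto]

lemma bop_id: "bop (\<lambda>x. x)"
  by (auto intro!: bopI bounded_linear_ident)

lemma bop_const_0: "bop (\<lambda>x. 0)"
  by (auto intro!: bopI bounded_linear_zero)

lemma bop_compose: "bop A \<Longrightarrow> bop B \<Longrightarrow> bop (\<lambda>x. A (B x))"
  by (rule bopI[OF bounded_linear_compose[OF bop_bounded_linear bop_bounded_linear]])
    (auto simp: bop_scaleC)

lemma bop_plus: "bop A \<Longrightarrow> bop B \<Longrightarrow> bop (\<lambda>x. A x + B x)"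
  by (rule bopI[OF bounded_linear_add[OF bop_bounded_linear bop_bounded_linear]])
    (auto simp: bop_scaleC scaleC_add_right)

lemma bop_uminus: "bop A \<Longrightarrow> bop (\<lambda>x. - A x)"
  by (rule bopI[OF bounded_linear_minus[OF bop_bounded_linear]])
    (auto simp: bop_scaleC scaleC_minus_right)

lemma bop_minus_op: "bop A \<Longrightarrow> bop B \<Longrightarrow> bop (\<lambda>x. A x - B x)"
  by (rule bopI[OF bounded_linear_sub[OF bop_bounded_linear bop_bounded_linear]])
    (auto simp: bop_scaleC scaleC_diff_right)

lemma bop_scaleR_op: "bop A \<Longrightarrow> bop (\<lambda>x. r *\<^sub>R A x)"
  by (rule bopI[OF bounded_linear_compose[OF bounded_linear_scaleR_right bop_bounded_linear]])
    (auto simp: bop_scaleC scaleC_scaleR)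

lemma bop_scaleC_op: "bop A \<Longrightarrow> bop (\<lambda>x. c *\<^sub>C A x)"
  by (rule bopI[OF bounded_linear_compose[OF bounded_linear_scaleC bop_bounded_linear]])
    (auto simp: bop_scaleC scaleC_scaleC mult.commute)

lemma bop_sum: "(\<And>i. i \<in> I \<Longrightarrow> bop (A i)) \<Longrightarrow> bop (\<lambda>x. \<Sum>i\<in>I. A i x)"
  by (rule bopI[OF bounded_linear_sum[OF bop_bounded_linear]])
    (auto simp: bop_scaleC scaleC_sum_right)

lemma bop_fst: "bop fst"
  by (auto intro!: bopI bounded_linear_fst simp: scaleC_prod_def)

lemma bop_snd: "bop snd"
  by (auto intro!: bopI bounded_linear_snd simp: scaleC_prod_def)

lemma bop_Pair: "bop A \<Longrightarrow> bop B \<Longrightarrow> bop (\<lambda>x. (A x, B x))"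
  by (rule bopI[OF bounded_linear_Pair[OF bop_bounded_linear bop_bounded_linear]])
    (auto simp: bop_scaleC scaleC_prod_def)

lemma bop_nth: "bop (\<lambda>x. x $ i)"
  by (auto intro!: bopI bounded_linear_vec_nth simp: scaleC_vec_def)

lemma norm_vec_sq: "(norm (x :: 'a::chilbert_space ^ 'n::finite))\<^sup>2 = (\<Sum>i\<in>UNIV. (norm (x $ i))\<^sup>2)"
  by (simp add: power2_norm_eq_inner inner_vec_def)

lemma norm_prod_sq: "(norm (x :: 'a::chilbert_space \<times> 'b::chilbert_space))\<^sup>2 =
    (norm (fst x))\<^sup>2 + (norm (snd x))\<^sup>2"
  by (simp add: power2_norm_eq_inner inner_prod_def)

lemma bop_vec:
  assumes "\<And>i. bop (A i)"
  shows "bop (\<lambda>x. \<chi> i. A i x :: 'b::chilbert_space ^ 'n::finite)"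
proof (rule bopI)
  \<comment> \<open>As a finite sum over the coordinate embeddings, the tuple inherits boundedness
    from its entries.\<close>
  have eq: "(\<lambda>x. \<chi> i. A i x) = (\<lambda>x. \<Sum>i\<in>UNIV. axis i (A i x))"
    by (auto simp: fun_eq_iff vec_eq_iff axis_def if_distrib[where f = "\<lambda>v. v $ _"] cong: if_cong)
  have ax: "bounded_linear (axis i :: 'b \<Rightarrow> 'b ^ 'n)" for i
    by (rule bounded_linear_intro[where K = 1])
      (auto simp: axis_def vec_eq_iff norm_vec_def L2_set_def if_distrib[where f = "\<lambda>v. (norm v)\<^sup>2"] cong: if_cong)
  show "bounded_linear (\<lambda>x. \<chi> i. A i x :: 'b ^ 'n)"
    unfolding eq by (intro bounded_linear_sum bounded_linear_compose[OF ax] bop_bounded_linear assms)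
qed (use assms in \<open>auto simp: scaleC_vec_def vec_eq_iff bop_scaleC\<close>)

lemmas bop_intros = bop_id bop_const_0 bop_plus bop_uminus bop_minus_op bop_scaleR_op
  bop_scaleC_op bop_sum bop_fst bop_snd bop_Pair bop_nth bop_vec

lemma cinner_opI:
  assumes "\<And>u. inner (A u) y = inner u v" "\<And>c u. A (c *\<^sub>C u) = c *\<^sub>C A u"
  shows "cinner (A u) y = cinner u v"
  by (rule cinner_eqI) (auto simp: assms simp flip: assms(2))

text \<open>Real inner products suffice to identify the adjoint, since A is complex homogeneous; the
  definite description in \<open>adj_on\<close> is then resolved by uniqueness.\<close>

lemma adj_eqI:
  assumes "\<And>c u. A (c *\<^sub>C u) = c *\<^sub>C A u" "\<And>u. inner (A u) y = inner u v"
  shows "adj A y = v"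
  unfolding adj_on_def
proof (rule the_equality)
  show "v \<in> UNIV \<and> (\<forall>u\<in>UNIV. cinner (A u) y = cinner u v)"
    using cinner_opI[of A y v] assms by auto
next
  fix w assume "w \<in> UNIV \<and> (\<forall>u\<in>UNIV. cinner (A u) y = cinner u w)"
  then have "inner u w = inner u v" for u
    using assms(2)[of u] by (metis Re_cinner UNIV_I)
  then have "inner (w - v) (w - v) = 0" by (simp add: inner_diff_right)
  then show "w = v" by simp
qed

lemma inner_adj:
  assumes "bop A" shows "inner (A u) y = inner u (adj A y)"
proof -
  have "bounded_linear (\<lambda>u. inner (A u) y)"
    by (intro bounded_linear_inner_left_comp bop_bounded_linear assms)
  then obtain v where "\<And>u. inner (A u) y = inner u v" using riesz_representation by blast
  then show ?thesis using adj_eqI[of A y v] assms by (simp add: bop_scaleC)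
qed

lemma inner_eq_imp_eq: "(\<And>u. inner u x = inner u y) \<Longrightarrow> x = (y::'a::real_inner)"
  by (metis inner_diff_right inner_eq_zero_iff right_minus_eq)

lemma norm_adj_le:
  assumes "bop A" "\<And>u. norm (A u) \<le> K * norm u" "0 \<le> K"
  shows "norm (adj A y) \<le> K * norm y"
proof (cases "adj A y = 0")
  case False
  have "(norm (adj A y))\<^sup>2 = inner (A (adj A y)) y"
    by (simp add: power2_norm_eq_inner inner_adj[OF assms(1)])
  also have "\<dots> \<le> norm (A (adj A y)) * norm y" by (rule norm_cauchy_schwarz)
  also have "\<dots> \<le> (K * norm (adj A y)) * norm y"
    by (intro mult_right_mono assms) auto
  finally have "norm (adj A y) * norm (adj A y) \<le> norm (adj A y) * (K * norm y)"
    by (simp add: power2_eq_square algebra_simps)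
  then show ?thesis using False by (simp add: mult_le_cancel_left)
qed (use assms in auto)

lemma bop_adj:
  assumes A: "bop A" shows "bop (adj A)"
proof -
  obtain K where K: "K > 0" "\<And>x. norm (A x) \<le> norm x * K"
    using bounded_linear.pos_bounded[OF bop_bounded_linear[OF A]] by blast
  have "bounded_linear (adj A)"
  proof (rule bounded_linear_intro[where K = K])
    show "norm (adj A y) \<le> norm y * K" for y
      using norm_adj_le[OF A, of K y] K by (simp add: mult.commute)
    show "adj A (x + y) = adj A x + adj A y" for x y
      by (rule inner_eq_imp_eq) (simp add: inner_add_right flip: inner_adj[OF A])
    show "adj A (r *\<^sub>R y) = r *\<^sub>R adj A y" for r y
      by (rule inner_eq_imp_eq) (simp flip: inner_adj[OF A])
  qed
  moreover have "adj A (c *\<^sub>C y) = c *\<^sub>C adj A y" for c y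
  proof (rule inner_eq_imp_eq)
    fix u
    have "cinner (A u) y = cinner u (adj A y)"
      by (rule cinner_opI) (use A in \<open>auto simp: inner_adj bop_scaleC\<close>)
    then have "Re (cinner (A u) (c *\<^sub>C y)) = Re (cinner u (c *\<^sub>C adj A y))"
      by (simp add: cinner_scaleC_right)
    then show "inner u (adj A (c *\<^sub>C y)) = inner u (c *\<^sub>C adj A y)"
      by (simp add: Re_cinner flip: inner_adj[OF A])
  qed
  ultimately show ?thesis by (rule bopI)
qed

lemma closed_csubspace_subspace: "closed_csubspace M \<Longrightarrow> subspace M"
  by (simp add: subspace_def closed_csubspace_scaleR) (simp add: closed_csubspace_def)

lemma csubspace_projection:
  assumes M: "closed_csubspace M"
  obtains P where "bop P" "\<And>x. P x \<in> M" "\<And>x. x \<in> M \<Longrightarrow> P x = x"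
    "\<And>x m. m \<in> M \<Longrightarrow> inner (x - P x) m = 0" "\<And>x. norm (P x) \<le> norm x"
proof -
  have "\<exists>p\<in>M. \<forall>m\<in>M. inner (x - p) m = 0" for x
    using M orthogonal_projection_exists[OF _ closed_csubspace_subspace[OF M]]
    by (auto simp: closed_csubspace_def)
  then obtain P where P: "\<And>x. P x \<in> M" "\<And>x m. m \<in> M \<Longrightarrow> inner (x - P x) m = 0" by metis
  \<comment> \<open>Orthogonality of the residual characterises the projection, so additivity and
    homogeneity of P are each one application of this uniqueness.\<close>
  have uniq: "P x = p" if "p \<in> M" "\<And>m. m \<in> M \<Longrightarrow> inner (x - p) m = 0" for x p
  proof -
    have "inner (p - P x) (p - P x) = inner (x - P x) (p - P x) - inner (x - p) (p - P x)"
      by (simp add: inner_diff_left)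
    also have "\<dots> = 0"
      using P that closed_csubspace_diff[OF M] by (metis diff_zero)
    finally show ?thesis by simp
  qed
  have M': "x + y \<in> M" "c *\<^sub>C x \<in> M" "r *\<^sub>R x \<in> M" if "x \<in> M" "y \<in> M" for x y c r
    using M that closed_csubspace_scaleR[OF M] by (auto simp: closed_csubspace_def)
  have bd: "norm (P x) \<le> norm x" for x
  proof (rule power2_le_imp_le)
    have "inner (x - P x) (P x) = 0" using P by blast
    then have "(norm x)\<^sup>2 = (norm (P x))\<^sup>2 + (norm (x - P x))\<^sup>2"
      by (simp add: power2_norm_eq_inner inner_diff_left inner_diff_right inner_commute)
    then show "(norm (P x))\<^sup>2 \<le> (norm x)\<^sup>2" by simp
  qed auto
  have "bop P"
  proof (rule bopI[OF bounded_linear_intro[where K = 1]])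
    show "P (x + y) = P x + P y" for x y
    proof (rule uniq)
      show "inner (x + y - (P x + P y)) m = 0" if "m \<in> M" for m
        using P(2)[OF that, of x] P(2)[OF that, of y] by (simp add: inner_diff_left inner_add_left)
    qed (auto intro: M' P)
    show "P (r *\<^sub>R x) = r *\<^sub>R P x" for x r
    proof (rule uniq)
      show "inner (r *\<^sub>R x - r *\<^sub>R P x) m = 0" if "m \<in> M" for m
        using P(2)[OF that, of x] by (simp add: inner_diff_left)
    qed (auto intro: M' P)
    show "P (c *\<^sub>C x) = c *\<^sub>C P x" for x c
    proof (rule uniq)
      fix m assume m: "m \<in> M"
      have "inner (c *\<^sub>C (x - P x)) m = inner (x - P x) (cnj c *\<^sub>C m)"
        by (simp add: cinner_scaleC_left cinner_scaleC_right flip: Re_cinner)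
      then show "inner (c *\<^sub>C x - c *\<^sub>C P x) m = 0"
        using P(2)[OF M'(2)[OF m m, of "cnj c"], of x] by (simp add: scaleC_diff_right)
    qed (auto intro: M' P)
  qed (auto simp: bd)
  then show ?thesis
    using that P bd uniq by (metis diff_self inner_zero_left)
qed

lemma closed_csubspace_closure_range:
  assumes A: "bop A" shows "closed_csubspace (closure (range A))"
  unfolding closed_csubspace_def
proof (intro conjI ballI allI)
  show "0 \<in> closure (range A)"
    using bop_zero[OF A] closure_subset by (metis rangeI subsetD)
next
  fix x y assume "x \<in> closure (range A)" "y \<in> closure (range A)"
  then obtain u v where uv: "\<And>n. u n \<in> range A" "u \<longlonglongrightarrow> x" "\<And>n. v n \<in> range A" "v \<longlonglongrightarrow> y"
    by (auto simp: closure_sequential)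
  have "u n + v n \<in> range A" for n
    using uv(1,3)[of n] by (auto simp flip: bop_add[OF A])
  moreover have "(\<lambda>n. u n + v n) \<longlonglongrightarrow> x + y" by (intro tendsto_intros uv)
  ultimately show "x + y \<in> closure (range A)"
    unfolding closure_sequential by (intro exI[of _ "\<lambda>n. u n + v n"]) simp
next
  fix c x assume "x \<in> closure (range A)"
  then obtain u where u: "\<And>n. u n \<in> range A" "u \<longlonglongrightarrow> x"
    by (auto simp: closure_sequential)
  have "c *\<^sub>C u n \<in> range A" for n
    using u(1)[of n] by (auto simp flip: bop_scaleC[OF A])
  moreover have "(\<lambda>n. c *\<^sub>C u n) \<longlonglongrightarrow> c *\<^sub>C x"
    by (rule bounded_linear.tendsto[OF bounded_linear_scaleC u(2)])
  ultimately show "c *\<^sub>C x \<in> closure (range A)"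
    unfolding closure_sequential by (intro exI[of _ "\<lambda>n. c *\<^sub>C u n"]) simp
qed auto


section \<open>Unitary operators between closed subspaces\<close>

text \<open>This is \<^const>\<open>unitary_op\<close> without reference to adjoints.\<close>

definition hilbert_iso ::
  "'a::chilbert_space set \<Rightarrow> 'b::chilbert_space set \<Rightarrow> ('a \<Rightarrow> 'b) \<Rightarrow> bool" where
  "hilbert_iso E F U \<longleftrightarrow> closed_csubspace E \<and> U ` E = F \<and>
     (\<forall>x\<in>E. \<forall>y\<in>E. U (x + y) = U x + U y) \<and> (\<forall>c. \<forall>x\<in>E. U (c *\<^sub>C x) = c *\<^sub>C U x) \<and>
     (\<forall>x\<in>E. norm (U x) = norm x)"

lemma closed_csubspaceD:
  assumes "closed_csubspace E"
  shows "closed E" "0 \<in> E" "\<And>x y. x \<in> E \<Longrightarrow> y \<in> E \<Longrightarrow> x + y \<in> E"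
    "\<And>c x. x \<in> E \<Longrightarrow> c *\<^sub>C x \<in> E" "\<And>x y. x \<in> E \<Longrightarrow> y \<in> E \<Longrightarrow> x - y \<in> E"
  using assms closed_csubspace_diff[OF assms] by (auto simp: closed_csubspace_def)

lemma hilbert_isoD:
  assumes "hilbert_iso E F U"
  shows "closed_csubspace E" "U ` E = F" "\<And>x y. x \<in> E \<Longrightarrow> y \<in> E \<Longrightarrow> U (x + y) = U x + U y"
    "\<And>c x. x \<in> E \<Longrightarrow> U (c *\<^sub>C x) = c *\<^sub>C U x" "\<And>x. x \<in> E \<Longrightarrow> norm (U x) = norm x"
    "\<And>x. x \<in> E \<Longrightarrow> U x \<in> F"
  using assms by (auto simp: hilbert_iso_def)

lemma hilbert_iso_diff:
  assumes "hilbert_iso E F U" "x \<in> E" "y \<in> E" shows "U (x - y) = U x - U y"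
proof -
  note E = closed_csubspaceD[OF hilbert_isoD(1)[OF assms(1)]]
  have "U (x - y) + U y = U x"
    using hilbert_isoD(3)[OF assms(1), of "x - y" y] E assms by simp
  then show ?thesis by (simp add: algebra_simps)
qed

lemma hilbert_iso_inj: "hilbert_iso E F U \<Longrightarrow> inj_on U E"
proof (rule inj_onI)
  fix x y assume U: "hilbert_iso E F U" "x \<in> E" "y \<in> E" "U x = U y"
  then have "norm (x - y) = 0"
    using hilbert_isoD(5)[OF U(1), of "x - y"] hilbert_iso_diff[OF U(1-3)]
      closed_csubspaceD[OF hilbert_isoD(1)[OF U(1)]] by simp
  then show "x = y" by simp
qed

lemma hilbert_iso_inner:
  assumes U: "hilbert_iso E F U" and xy: "x \<in> E" "y \<in> E"
  shows "inner (U x) (U y) = inner x y"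
proof -
  note E = closed_csubspaceD[OF hilbert_isoD(1)[OF U]]
  have "(norm (U x + U y))\<^sup>2 = (norm (x + y))\<^sup>2" "(norm (U x))\<^sup>2 = (norm x)\<^sup>2" "(norm (U y))\<^sup>2 = (norm y)\<^sup>2"
    using hilbert_isoD(3,5)[OF U] E(3) xy by metis+
  then show ?thesis
    by (simp add: power2_norm_eq_inner inner_add_left inner_add_right inner_commute)
qed

lemma hilbert_iso_cinner:
  assumes U: "hilbert_iso E F U" and xy: "x \<in> E" "y \<in> E"
  shows "cinner (U x) (U y) = cinner x y"
  using hilbert_iso_inner[OF U xy] hilbert_iso_inner[OF U _ xy(2), of "\<i> *\<^sub>C x"]
    closed_csubspaceD(4)[OF hilbert_isoD(1)[OF U] xy(1)] hilbert_isoD(4)[OF U xy(1)]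
  by (intro cinner_eqI) auto

lemma hilbert_iso_compose:
  "hilbert_iso E F U \<Longrightarrow> hilbert_iso F G V \<Longrightarrow> hilbert_iso E G (\<lambda>x. V (U x))"
  unfolding hilbert_iso_def by (auto simp: image_image[symmetric])

lemma hilbert_iso_inv:
  assumes U: "hilbert_iso E F U" shows "hilbert_iso F E (inv_into E U)"
proof -
  note E = closed_csubspaceD[OF hilbert_isoD(1)[OF U]]
  note UD = hilbert_isoD[OF U]
  have inv: "inv_into E U (U x) = x" if "x \<in> E" for x
    using that hilbert_iso_inj[OF U] by (rule inv_into_f_f[rotated])
  have inF: "\<exists>x\<in>E. y = U x" if "y \<in> F" for y using that UD(2) by blast
  \<comment> \<open>An isometry pulls a convergent sequence in F back to a Cauchy sequence in the
    complete space E, whose limit is mapped to the given limit.\<close>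
  have "closed F"
    unfolding closed_sequential_limits
  proof (intro allI impI, elim conjE)
    fix y l assume y: "\<forall>n. y n \<in> F" "y \<longlonglongrightarrow> l"
    have "\<forall>n. \<exists>x. x \<in> E \<and> y n = U x" using inF y(1) by blast
    then obtain x where x: "\<And>n. x n \<in> E" "\<And>n. y n = U (x n)" by metis
    have "dist (x m) (x n) = dist (y m) (y n)" for m n
      using UD(5)[OF E(5)[OF x(1)[of m] x(1)[of n]]]
      by (simp add: dist_norm x(2) hilbert_iso_diff[OF U x(1) x(1)])
    then have "Cauchy x"
      using LIMSEQ_imp_Cauchy[OF y(2)] by (simp add: Cauchy_def)
    then obtain k where k: "x \<longlonglongrightarrow> k" using Cauchy_convergent convergent_def by blast
    then have kE: "k \<in> E" using E(1) x(1) closed_sequentially by blast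
    have nd: "norm (y n - U k) = norm (x n - k)" for n
      using UD(5)[OF E(5)[OF x(1)[of n] kE]] by (simp add: x(2) hilbert_iso_diff[OF U x(1) kE])
    have "(\<lambda>n. norm (y n - U k)) \<longlonglongrightarrow> 0"
      unfolding nd by (rule tendsto_norm_zero[OF LIM_zero[OF k]])
    then have "(\<lambda>n. y n - U k) \<longlonglongrightarrow> 0" by (rule tendsto_norm_zero_cancel)
    then have "y \<longlonglongrightarrow> U k" by (rule LIM_zero_cancel)
    then show "l \<in> F" using y(2) LIMSEQ_unique UD(6) kE by blast
  qed
  moreover have "0 \<in> F"
    using UD(5,6)[OF E(2)] by simp
  moreover have "x + y \<in> F" if xy: "x \<in> F" "y \<in> F" for x y
  proof -
    obtain u v where "u \<in> E" "x = U u" "v \<in> E" "y = U v" using inF xy by metis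
    then show ?thesis using UD(3)[of u v] UD(6)[OF E(3)[of u v]] by simp
  qed
  moreover have "c *\<^sub>C x \<in> F" if x: "x \<in> F" for c x
  proof -
    obtain u where "u \<in> E" "x = U u" using inF x by metis
    then show ?thesis using UD(4)[of u c] UD(6)[OF E(4)[of u c]] by simp
  qed
  ultimately have "closed_csubspace F" by (simp add: closed_csubspace_def)
  moreover have "inv_into E U ` F = E"
    using hilbert_iso_inj[OF U] UD(2) by (auto simp: image_image)
  moreover have "\<forall>x\<in>F. \<forall>y\<in>F. inv_into E U (x + y) = inv_into E U x + inv_into E U y"
  proof (intro ballI)
    fix x y assume "x \<in> F" "y \<in> F"
    then obtain u v where "u \<in> E" "x = U u" "v \<in> E" "y = U v" using inF by metis
    then show "inv_into E U (x + y) = inv_into E U x + inv_into E U y"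
      using inv E(3) by (simp flip: UD(3))
  qed
  moreover have "\<forall>c. \<forall>x\<in>F. inv_into E U (c *\<^sub>C x) = c *\<^sub>C inv_into E U x"
  proof (intro allI ballI)
    fix c x assume "x \<in> F"
    then obtain u where "u \<in> E" "x = U u" using inF by metis
    then show "inv_into E U (c *\<^sub>C x) = c *\<^sub>C inv_into E U x"
      using inv E(4) by (simp flip: UD(4))
  qed
  moreover have "\<forall>x\<in>F. norm (inv_into E U x) = norm x"
    using inv UD(5) by (auto dest!: inF)
  ultimately show ?thesis by (simp add: hilbert_iso_def)
qed

lemma hilbert_iso_inv_into:
  assumes "hilbert_iso E F U"
  shows "\<And>x. x \<in> E \<Longrightarrow> inv_into E U (U x) = x" "\<And>y. y \<in> F \<Longrightarrow> U (inv_into E U y) = y"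
  using hilbert_iso_inj[OF assms] hilbert_isoD(2)[OF assms]
  by (auto simp: f_inv_into_f)

lemma hilbert_iso_closed_image: "hilbert_iso E F U \<Longrightarrow> closed_csubspace F"
  using hilbert_iso_inv hilbert_isoD(1) by blast

lemma hilbert_iso_subset:
  assumes U: "hilbert_iso E F U" and M: "closed_csubspace M" "M \<subseteq> E"
  shows "hilbert_iso M (U ` M) U"
  using M hilbert_isoD(3-5)[OF U] by (auto simp: hilbert_iso_def subset_iff)

lemma hilbert_iso_bounded_op: "hilbert_iso E F U \<Longrightarrow> bounded_op E F U"
  unfolding bounded_op_def hilbert_iso_def by (auto intro: exI[of _ 1])

lemma adj_on_eqI:
  assumes E: "closed_csubspace E" and x: "x \<in> E" and adj: "\<And>u. u \<in> E \<Longrightarrow> cinner (A u) y = cinner u x"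
  shows "adj_on E F A y = x"
  unfolding adj_on_def
proof (rule the_equality)
  fix w assume w: "w \<in> E \<and> (\<forall>u\<in>E. cinner (A u) y = cinner u w)"
  then have d: "w - x \<in> E" using closed_csubspaceD(5)[OF E] x by blast
  then have "inner (w - x) w = inner (w - x) x"
    using w adj by (metis Re_cinner)
  then have "inner (w - x) (w - x) = 0" by (simp add: inner_diff_right)
  then show "w = x" by simp
qed (use assms in auto)

lemma hilbert_iso_unitary_op:
  assumes U: "hilbert_iso E F U" shows "unitary_op E F U"
proof -
  have adj: "adj_on E F U (U x) = x" if "x \<in> E" for x
    by (rule adj_on_eqI[OF hilbert_isoD(1)[OF U] that]) (rule hilbert_iso_cinner[OF U _ that])
  then have "U (adj_on E F U y) = y" if "y \<in> F" for y
    using that hilbert_isoD(2)[OF U] by auto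
  then show ?thesis
    using adj hilbert_iso_bounded_op[OF U] by (simp add: unitary_op_def)
qed

lemma limit_in_closure_range:
  fixes p :: "'a::metric_space"
  shows "(\<lambda>n. f (s n)) \<longlonglongrightarrow> p \<Longrightarrow> p \<in> closure (range f)"
  unfolding closure_sequential by (rule exI[of _ "\<lambda>n. f (s n)"]) simp

text \<open>Equal norms make P x \<mapsto> Q x a well defined isometry between the ranges, whatever
  preimage \<open>inv P\<close> picks, and uniform continuity extends it to the closures. This is
  the source of the unitaries onto defect spaces: an identity between norms is enough to produce
  them.\<close>

lemma isometric_extension:
  fixes P :: "'x::chilbert_space \<Rightarrow> 'p::chilbert_space" and Q :: "'x \<Rightarrow> 'q::chilbert_space"
  assumes P: "bop P" and Q: "bop Q" and eq: "\<And>x. norm (P x) = norm (Q x)"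
  obtains W where "hilbert_iso (closure (range P)) (closure (range Q)) W" "\<And>x. W (P x) = Q x"
proof -
  define f where "f = (\<lambda>p. Q (inv P p))"
  have d: "dist (Q x) (Q y) = dist (P x) (P y)" for x y
    using eq[of "x - y"] by (simp add: dist_norm bop_diff[OF P] bop_diff[OF Q])
  have f: "f (P x) = Q x" for x
  proof -
    have "P (inv P (P x)) = P x" by (simp add: f_inv_into_f)
    then show ?thesis using d[of "inv P (P x)" x] by (simp add: f_def)
  qed
  have "uniformly_continuous_on (range P) f"
    by (auto simp: uniformly_continuous_on_def f d)
  then obtain W where W: "uniformly_continuous_on (closure (range P)) W" "\<And>p. p \<in> range P \<Longrightarrow> f p = W p"
    by (rule uniformly_continuous_on_extension_on_closure) blast
  have WP: "W (P x) = Q x" for x using W(2)[of "P x"] f by simp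
  have Wlim: "(\<lambda>n. Q (s n)) \<longlonglongrightarrow> W p" if "(\<lambda>n. P (s n)) \<longlonglongrightarrow> p" for s p
  proof -
    have "p \<in> closure (range P)" using that by (rule limit_in_closure_range)
    then have "((\<lambda>n. W (P (s n))) \<longlongrightarrow> W p) sequentially"
      using continuous_on_tendsto_compose[OF uniformly_continuous_imp_continuous[OF W(1)] that]
      by (simp add: eventuallyI closure_subset[THEN subsetD])
    then show ?thesis by (simp add: WP)
  qed
  have ex: "\<exists>s. (\<lambda>n. P (s n)) \<longlonglongrightarrow> p" if p: "p \<in> closure (range P)" for p
  proof -
    obtain y where y: "\<And>n. y n \<in> range P" "y \<longlonglongrightarrow> p" using p by (auto simp: closure_sequential)
    have "\<forall>n. \<exists>x. y n = P x" using y(1) by blast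
    then obtain s where "\<And>n. y n = P (s n)" by metis
    then have "y = (\<lambda>n. P (s n))" by auto
    then show ?thesis using y(2) by blast
  qed
  have "W ` closure (range P) = closure (range Q)"
  proof (intro equalityI subsetI)
    fix q assume "q \<in> W ` closure (range P)"
    then obtain s where "(\<lambda>n. Q (s n)) \<longlonglongrightarrow> q" using ex Wlim by blast
    then show "q \<in> closure (range Q)" by (rule limit_in_closure_range)
  next
    fix q assume "q \<in> closure (range Q)"
    then obtain y where y: "\<And>n. y n \<in> range Q" "y \<longlonglongrightarrow> q" by (auto simp: closure_sequential)
    have "\<forall>n. \<exists>x. y n = Q x" using y(1) by blast
    then obtain s where "\<And>n. y n = Q (s n)" by metis
    then have "y = (\<lambda>n. Q (s n))" by auto
    then have s: "(\<lambda>n. Q (s n)) \<longlonglongrightarrow> q" using y(2) by simp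
    then have "Cauchy (\<lambda>n. P (s n))"
      using LIMSEQ_imp_Cauchy[OF s] by (simp add: Cauchy_def d)
    then obtain p where p: "(\<lambda>n. P (s n)) \<longlonglongrightarrow> p"
      using Cauchy_convergent convergent_def by blast
    then have "p \<in> closure (range P)" by (rule limit_in_closure_range)
    moreover have "W p = q" using LIMSEQ_unique[OF Wlim[OF p] s] .
    ultimately show "q \<in> W ` closure (range P)" by blast
  qed
  moreover have "W (x + y) = W x + W y"
    if xy: "x \<in> closure (range P)" "y \<in> closure (range P)" for x y
  proof -
    obtain s t where st: "(\<lambda>n. P (s n)) \<longlonglongrightarrow> x" "(\<lambda>n. P (t n)) \<longlonglongrightarrow> y" using ex xy by blast
    then have "(\<lambda>n. P (s n + t n)) \<longlonglongrightarrow> x + y"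
      unfolding bop_add[OF P] by (rule tendsto_add)
    from LIMSEQ_unique[OF Wlim[OF this]] tendsto_add[OF Wlim[OF st(1)] Wlim[OF st(2)]]
    show ?thesis by (simp add: bop_add[OF Q])
  qed
  moreover have "W (c *\<^sub>C x) = c *\<^sub>C W x" if x: "x \<in> closure (range P)" for c x
  proof -
    obtain s where s: "(\<lambda>n. P (s n)) \<longlonglongrightarrow> x" using ex x by blast
    note lim = bounded_linear.tendsto[OF bounded_linear_scaleC]
    have "(\<lambda>n. P (c *\<^sub>C s n)) \<longlonglongrightarrow> c *\<^sub>C x"
      unfolding bop_scaleC[OF P] by (rule lim[OF s])
    from LIMSEQ_unique[OF Wlim[OF this]] lim[OF Wlim[OF s], of c]
    show ?thesis by (simp add: bop_scaleC[OF Q])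
  qed
  moreover have "norm (W x) = norm x" if x: "x \<in> closure (range P)" for x
  proof -
    obtain s where s: "(\<lambda>n. P (s n)) \<longlonglongrightarrow> x" using ex x by blast
    from LIMSEQ_unique[OF tendsto_norm[OF s]] tendsto_norm[OF Wlim[OF s]]
    show ?thesis by (simp add: eq)
  qed
  ultimately have "hilbert_iso (closure (range P)) (closure (range Q)) W"
    using closed_csubspace_closure_range[OF P] by (simp add: hilbert_iso_def)
  then show ?thesis using that WP by blast
qed


section \<open>Square roots of positive operators\<close>

text \<open>In a complex space a real quadratic form belongs to a symmetric operator. Testing the
  form at \<i>x + y isolates the real parts of the mixed terms.\<close>

lemma positive_op_selfadjoint:
  assumes B: "positive_op B" shows "inner (B x) y = inner x (B y)"
proof -
  have bop: "bop B" using B by (simp add: positive_op_def)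
  have Im0: "Im (cinner (B z) z) = 0" for z
    using B by (auto simp: positive_op_def complex_nonneg_Reals_iff)
  have "Im (cinner (B (\<i> *\<^sub>C x + y)) (\<i> *\<^sub>C x + y)) = 0" by (rule Im0)
  then have "Re (cinner (B x) y) = Re (cinner (B y) x)"
    using Im0[of x] Im0[of y]
    by (simp add: bop_add[OF bop] bop_scaleC[OF bop] cinner_add_left cinner_add_right
        cinner_scaleC_left cinner_scaleC_right)
  then show ?thesis by (simp add: Re_cinner inner_commute)
qed

lemma positive_opI:
  assumes bop: "bop B" and sa: "\<And>x y. inner (B x) y = inner x (B y)" and pos: "\<And>x. inner (B x) x \<ge> 0"
  shows "positive_op B"
  unfolding positive_op_def
proof (intro conjI allI bop)
  fix x
  have "inner (\<i> *\<^sub>C B x) x = inner (\<i> *\<^sub>C x) (B x)" by (simp add: sa flip: bop_scaleC[OF bop])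
  also have "\<dots> = - inner (\<i> *\<^sub>C B x) x" unfolding inner_ii_left[of x] by (simp add: inner_commute)
  finally show "cinner (B x) x \<in> \<real>\<^sub>\<ge>\<^sub>0"
    using pos[of x] by (simp add: complex_nonneg_Reals_iff Im_cinner Re_cinner)
qed

text \<open>Fixed-point iteration for Y = (R + Y Y) / 2, whose intended solution is 1 minus the
  positive root of 1 - R.\<close>

primrec sqrt_iter :: "('a::chilbert_space \<Rightarrow> 'a) \<Rightarrow> nat \<Rightarrow> 'a \<Rightarrow> 'a" where
  "sqrt_iter R 0 = (\<lambda>x. 0)"
| "sqrt_iter R (Suc n) = (\<lambda>x. (1/2) *\<^sub>R (R x + sqrt_iter R n (sqrt_iter R n x)))"

text \<open>The same iteration for the scalar R = 1. It dominates the norms of the operator iterates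
  and of their increments.\<close>

primrec sqrt_bound :: "nat \<Rightarrow> real" where
  "sqrt_bound 0 = 0"
| "sqrt_bound (Suc n) = (1 + (sqrt_bound n)\<^sup>2) / 2"

lemma sqrt_bound_le: "0 \<le> sqrt_bound n" "sqrt_bound n \<le> 1"
  by (induction n) (auto simp: power_le_one)

lemma sqrt_bound_mono: "sqrt_bound n \<le> sqrt_bound (Suc n)"
  using zero_le_power2[of "1 - sqrt_bound n"] by (simp add: power2_eq_square algebra_simps)

lemma convergent_sqrt_bound: "convergent sqrt_bound"
  by (rule Bseq_mono_convergent)
    (auto simp: sqrt_bound_le intro!: BseqI'[of _ 1] lift_Suc_mono_le[of sqrt_bound] sqrt_bound_mono
      simp del: sqrt_bound.simps)

definition contractive_sa :: "('a::chilbert_space \<Rightarrow> 'a) \<Rightarrow> bool" where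
  "contractive_sa R \<longleftrightarrow>
     bop R \<and> (\<forall>x y. inner (R x) y = inner x (R y)) \<and> (\<forall>x. norm (R x) \<le> norm x)"

lemma bop_sqrt_iter: "bop R \<Longrightarrow> bop (sqrt_iter R n)"
  by (induction n) (simp_all add: bop_const_0 bop_scaleR_op bop_plus bop_compose)

text \<open>An intertwiner of R and R' passes through the recursion. The commutation of the
  iterates, the uniqueness of the root and the relation between the two defect operators all come
  from this.\<close>

lemma sqrt_iter_intertwine:
  assumes "bop X" "\<And>x. X (R x) = R' (X x)"
  shows "X (sqrt_iter R n x) = sqrt_iter R' n (X x)"
  by (induction n arbitrary: x)
    (auto simp: bop_zero[OF assms(1)] bop_scaleR[OF assms(1)] bop_add[OF assms(1)] assms(2))

lemma sqrt_iter_commute: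
  assumes "bop R"
  shows "sqrt_iter R m (sqrt_iter R n x) = sqrt_iter R n (sqrt_iter R m x)"
  by (intro sqrt_iter_intertwine bop_sqrt_iter assms) (rule sqrt_iter_intertwine[symmetric], auto simp: assms)

lemma norm_sqrt_iter_le:
  assumes R: "contractive_sa R"
  shows "norm (sqrt_iter R n x) \<le> sqrt_bound n * norm x"
proof (induction n arbitrary: x)
  case (Suc n)
  let ?y = "sqrt_iter R n (sqrt_iter R n x)"
  have "norm ?y \<le> sqrt_bound n * norm (sqrt_iter R n x)" by (rule Suc)
  also have "\<dots> \<le> sqrt_bound n * (sqrt_bound n * norm x)"
    by (intro mult_left_mono Suc sqrt_bound_le)
  finally have "norm (R x + ?y) \<le> norm x + sqrt_bound n * (sqrt_bound n * norm x)"
    using R by (intro norm_triangle_mono) (auto simp: contractive_sa_def)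
  then show ?case
    by (simp add: power2_eq_square algebra_simps del: scaleR_add_right)
qed auto

text \<open>For commuting iterates Y Y - Z Z = (Y + Z)(Y - Z). The scalar iteration obeys the same
  factorization, so the induction closes with exactly its increments.\<close>

lemma norm_sqrt_iter_diff_le:
  assumes R: "contractive_sa R"
  shows "norm (sqrt_iter R (Suc n) x - sqrt_iter R n x) \<le> (sqrt_bound (Suc n) - sqrt_bound n) * norm x"
proof (induction n arbitrary: x)
  case 0
  then show ?case using R by (simp add: contractive_sa_def)
next
  case (Suc n)
  have bR: "bop R" using R by (simp add: contractive_sa_def)
  define Y Z where "Y = sqrt_iter R (Suc n)" and "Z = sqrt_iter R n"
  define p q where "p = sqrt_bound (Suc n)" and "q = sqrt_bound n"
  have comm: "Y (Z x) = Z (Y x)" unfolding Y_def Z_def by (rule sqrt_iter_commute[OF bR])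
  have bop: "bop Y" "bop Z" unfolding Y_def Z_def by (rule bop_sqrt_iter[OF bR])+
  define w where "w = Y x - Z x"
  have pq: "0 \<le> p" "0 \<le> q" unfolding p_def q_def by (rule sqrt_bound_le(1))+
  have w: "norm w \<le> (p - q) * norm x"
    unfolding w_def Y_def Z_def p_def q_def by (rule Suc)
  have "sqrt_iter R (Suc (Suc n)) x - sqrt_iter R (Suc n) x = (1/2) *\<^sub>R (Y (Y x) - Z (Z x))"
    unfolding sqrt_iter.simps(2)[of R "Suc n"] Y_def[symmetric]
    by (simp add: Y_def Z_def algebra_simps)
  also have "Y (Y x) - Z (Z x) = Y w + Z w"
    by (simp add: w_def bop_diff[OF bop(1)] bop_diff[OF bop(2)] comm)
  also have "norm ((1/2) *\<^sub>R (Y w + Z w)) \<le> (norm (Y w) + norm (Z w)) / 2"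
    using norm_triangle_ineq[of "Y w" "Z w"] by simp
  also have "\<dots> \<le> (p * norm w + q * norm w) / 2"
    unfolding Y_def Z_def p_def q_def
    by (intro divide_right_mono add_mono norm_sqrt_iter_le[OF R]) simp
  also have "\<dots> = (p + q) / 2 * norm w" by (simp add: algebra_simps)
  also have "\<dots> \<le> (p + q) / 2 * ((p - q) * norm x)"
    using w pq by (intro mult_left_mono) auto
  also have "\<dots> = (sqrt_bound (Suc (Suc n)) - sqrt_bound (Suc n)) * norm x"
  proof -
    have "sqrt_bound (Suc (Suc n)) - sqrt_bound (Suc n) = (p\<^sup>2 - q\<^sup>2) / 2"
      unfolding p_def sqrt_bound.simps(2)[of "Suc n"] q_def sqrt_bound.simps(2)[of n]
      by (simp add: diff_divide_distrib add_divide_distrib)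
    moreover have "(p + q) / 2 * ((p - q) * norm x) = (p\<^sup>2 - q\<^sup>2) / 2 * norm x"
      by (simp add: power2_eq_square field_simps)
    ultimately show ?thesis by (simp only:)
  qed
  finally show ?case .
qed

lemma sqrt_iter_converges:
  assumes R: "contractive_sa R"
  obtains Y where "\<And>x. (\<lambda>n. sqrt_iter R n x) \<longlonglongrightarrow> Y x"
proof -
  have le: "norm (sqrt_iter R (m + k) x - sqrt_iter R m x) \<le> (sqrt_bound (m + k) - sqrt_bound m) * norm x"
    for m k x
  proof (induction k)
    case (Suc k)
    have "norm (sqrt_iter R (Suc (m + k)) x - sqrt_iter R m x) \<le>
        norm (sqrt_iter R (Suc (m + k)) x - sqrt_iter R (m + k) x) + norm (sqrt_iter R (m + k) x - sqrt_iter R m x)"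
      using norm_triangle_ineq[of "sqrt_iter R (Suc (m + k)) x - sqrt_iter R (m + k) x"
          "sqrt_iter R (m + k) x - sqrt_iter R m x"] by (simp del: sqrt_iter.simps)
    then show ?case
      using Suc norm_sqrt_iter_diff_le[OF R, of "m + k" x]
      by (simp only: add_Suc_right left_diff_distrib)
  qed auto
  have "convergent (\<lambda>n. sqrt_iter R n x)" for x
  proof (rule Cauchy_convergent, rule metric_CauchyI)
    fix e :: real assume e: "e > 0"
    then have "e / (1 + norm x) > 0" by (simp add: add_pos_nonneg)
    from metric_CauchyD[OF convergent_Cauchy[OF convergent_sqrt_bound] this]
    obtain M where M: "\<And>m n. m \<ge> M \<Longrightarrow> n \<ge> M \<Longrightarrow> dist (sqrt_bound m) (sqrt_bound n) < e / (1 + norm x)"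
      by blast
    have main: "dist (sqrt_iter R n x) (sqrt_iter R m x) < e" if "m \<ge> M" "n \<ge> m" for m n
    proof -
      have "norm (sqrt_iter R n x - sqrt_iter R m x) \<le> (sqrt_bound n - sqrt_bound m) * norm x"
        using le[of m "n - m" x] that by simp
      also have "\<dots> \<le> \<bar>sqrt_bound n - sqrt_bound m\<bar> * (1 + norm x)"
        by (intro mult_mono) auto
      also have "\<dots> < e / (1 + norm x) * (1 + norm x)"
        using M[of n m] that by (intro mult_strict_right_mono) (auto simp: dist_norm add_pos_nonneg)
      also have "\<dots> = e" by (simp add: add_nonneg_eq_0_iff)
      finally show ?thesis by (simp add: dist_norm)
    qed
    have "dist (sqrt_iter R m x) (sqrt_iter R n x) < e" if "m \<ge> M" "n \<ge> M" for m n
      using main[of m n] main[of n m] that by (cases "m \<le> n") (auto simp: dist_commute)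
    then show "\<exists>M. \<forall>m\<ge>M. \<forall>n\<ge>M. dist (sqrt_iter R m x) (sqrt_iter R n x) < e" by blast
  qed
  then show ?thesis using that unfolding convergent_def by metis
qed

text \<open>The limit \<open>Y\<close> of the iteration satisfies \<open>2Y = R + Y\<^sup>2\<close>, so \<open>(1 - Y)\<^sup>2 = 1 - R\<close>.\<close>

lemma sqrt_op_limit:
  assumes R: "contractive_sa R"
  shows "(\<lambda>n. x - sqrt_iter R n x) \<longlonglongrightarrow> sqrt_op (\<lambda>x. x - R x) x" (is "?lim")
    and "positive_op (sqrt_op (\<lambda>x. x - R x))" (is ?pos)
    and "sqrt_op (\<lambda>x. x - R x) (sqrt_op (\<lambda>x. x - R x) x) = x - R x" (is ?sq)
proof -
  have bR: "bop R" and saR: "\<And>x y. inner (R x) y = inner x (R y)"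
    using R by (auto simp: contractive_sa_def)
  obtain Y where Y: "\<And>x. (\<lambda>n. sqrt_iter R n x) \<longlonglongrightarrow> Y x"
    by (rule sqrt_iter_converges[OF R]) blast
  have nY: "norm (Y x) \<le> norm x" for x
  proof (rule LIMSEQ_le_const2[OF tendsto_norm[OF Y]])
    have "norm (sqrt_iter R n x) \<le> norm x" for n
      using norm_sqrt_iter_le[OF R, of n x] mult_right_mono[OF sqrt_bound_le(2)[of n], of "norm x"]
      by simp
    then show "\<exists>N. \<forall>n\<ge>N. norm (sqrt_iter R n x) \<le> norm x" by blast
  qed
  note bn = bop_sqrt_iter[OF bR]
  have bY: "bop Y"
  proof (rule bopI[OF bounded_linear_intro[where K = 1]])
    show "Y (x + y) = Y x + Y y" for x y
      using LIMSEQ_unique[OF Y[of "x + y"]] tendsto_add[OF Y[of x] Y[of y]]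
      by (simp add: bop_add[OF bn])
    show "Y (r *\<^sub>R x) = r *\<^sub>R Y x" for r x
      using LIMSEQ_unique[OF Y[of "r *\<^sub>R x"]] tendsto_scaleR[OF tendsto_const[of r] Y[of x]]
      by (simp add: bop_scaleR[OF bn])
    show "Y (c *\<^sub>C x) = c *\<^sub>C Y x" for c x
      using LIMSEQ_unique[OF Y[of "c *\<^sub>C x"]] bounded_linear.tendsto[OF bounded_linear_scaleC Y[of x]]
      by (simp add: bop_scaleC[OF bn])
  qed (simp add: nY)
  have san: "inner (sqrt_iter R n x) y = inner x (sqrt_iter R n y)" for n x y
    by (induction n arbitrary: x y) (auto simp: inner_add_left inner_add_right saR)
  have saY: "inner (Y x) y = inner x (Y y)" for x y
    using LIMSEQ_unique[OF tendsto_inner[OF Y[of x] tendsto_const[of y]]]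
      tendsto_inner[OF tendsto_const[of x] Y[of y]] by (simp add: san)
  have YY: "2 *\<^sub>R Y x = R x + Y (Y x)" for x
  proof -
    \<comment> \<open>Both slots converge at once: the outer iterate has norm at most 1, so
      replacing the inner iterate by its limit costs no more than their distance.\<close>
    have "(\<lambda>n. sqrt_iter R n (sqrt_iter R n x)) \<longlonglongrightarrow> Y (Y x)"
    proof (rule Lim_transform)
      show "(\<lambda>n. sqrt_iter R n (Y x)) \<longlonglongrightarrow> Y (Y x)" by (rule Y)
      have "norm (sqrt_iter R n (sqrt_iter R n x) - sqrt_iter R n (Y x)) \<le> norm (sqrt_iter R n x - Y x)" for n
        using norm_sqrt_iter_le[OF R, of n "sqrt_iter R n x - Y x"]
          mult_right_mono[OF sqrt_bound_le(2)[of n], of "norm (sqrt_iter R n x - Y x)"]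
        by (simp add: bop_diff[OF bn])
      then show "(\<lambda>n. sqrt_iter R n (sqrt_iter R n x) - sqrt_iter R n (Y x)) \<longlonglongrightarrow> 0"
        by (intro Lim_null_comparison[OF _ tendsto_norm_zero[OF LIM_zero[OF Y[of x]]]]) simp
    qed
    then have "(\<lambda>n. sqrt_iter R (Suc n) x) \<longlonglongrightarrow> (1/2) *\<^sub>R (R x + Y (Y x))"
      by (auto intro!: tendsto_intros)
    from LIMSEQ_unique[OF this LIMSEQ_Suc[OF Y[of x]]]
    have "2 *\<^sub>R ((1/2) *\<^sub>R (R x + Y (Y x))) = 2 *\<^sub>R Y x" by (rule arg_cong)
    then show ?thesis by simp
  qed
  define B' where "B' = (\<lambda>x. x - Y x)"
  have bB': "bop B'" unfolding B'_def by (intro bop_intros bY)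
  have pos: "positive_op B'"
  proof (rule positive_opI[OF bB'])
    show "inner (B' x) y = inner x (B' y)" for x y
      by (simp add: B'_def inner_diff_left inner_diff_right saY)
    show "inner (B' x) x \<ge> 0" for x
      using norm_cauchy_schwarz[of "Y x" x] mult_right_mono[OF nY[of x], of "norm x"]
      by (simp add: B'_def inner_diff_left power2_eq_square flip: power2_norm_eq_inner)
  qed
  have BB: "B' (B' x) = x - R x" for x
    using YY[of x] by (simp add: B'_def bop_diff[OF bY] algebra_simps scaleR_2)
  \<comment> \<open>A positive root C commutes with R, hence with Y and B'. For D = B' - C this
    gives (B' + C) D = 0, and since both quadratic forms are nonnegative, each vanishes on the range
    of D. Polarising at x + D x yields D D = 0, and symmetry of D yields D = 0.\<close>
  have uniq: "C = B'" if C: "positive_op C" "C \<circ> C = (\<lambda>x. x - R x)" for C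
  proof
    fix x
    have bC: "bop C" using C(1) by (simp add: positive_op_def)
    have CC: "C (C x) = x - R x" for x using C(2) by (auto simp: fun_eq_iff)
    have "C (R x) = R (C x)" for x
    proof -
      have "C (x - R x) = C x - R (C x)" using CC[of "C x"] by (simp add: CC[of x])
      then show ?thesis by (simp add: bop_diff[OF bC])
    qed
    then have "C (sqrt_iter R n x) = sqrt_iter R n (C x)" for n x
      by (rule sqrt_iter_intertwine[OF bC])
    then have "C (Y x) = Y (C x)" for x
      using LIMSEQ_unique[OF bop_tendsto[OF bC Y[of x]]] Y[of "C x"] by simp
    then have comm: "C (B' x) = B' (C x)" for x by (simp add: B'_def bop_diff[OF bC])
    define D where "D = (\<lambda>x. B' x - C x)"
    have bD: "bop D" unfolding D_def by (intro bop_intros bB' bC)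
    have saD: "inner (D x) y = inner x (D y)" for x y
      using positive_op_selfadjoint[OF pos] positive_op_selfadjoint[OF C(1)]
      by (simp add: D_def inner_diff_left inner_diff_right)
    have ge: "inner (B' y) y \<ge> 0" "inner (C y) y \<ge> 0" for y
      using pos C(1) by (auto simp: positive_op_def complex_nonneg_Reals_iff simp flip: Re_cinner)
    have "inner (D (D x)) (D x) = 0" for x
    proof -
      have "B' (D x) + C (D x) = 0"
        by (simp add: D_def bop_diff[OF bB'] bop_diff[OF bC] comm BB CC)
      then have "inner (B' (D x)) (D x) + inner (C (D x)) (D x) = 0"
        by (simp flip: inner_add_left)
      then show ?thesis
        using ge[of "D x"] by (simp add: D_def inner_diff_left)
    qed
    from this[of x] this[of "D x"] this[of "x + D x"]
    have "inner (D (D x)) (D (D x)) = 0"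
      by (simp add: bop_add[OF bD] inner_add_left inner_add_right saD[of "D (D x)" "D x"])
    then have "inner (D x) (D x) = 0" unfolding saD[of x] by simp
    then show "C x = B' x" by (simp add: D_def)
  qed
  have eq: "sqrt_op (\<lambda>x. x - R x) = B'"
    unfolding sqrt_op_def
  proof (rule the_equality)
    show "positive_op B' \<and> B' \<circ> B' = (\<lambda>x. x - R x)" using pos BB by (simp add: fun_eq_iff)
    show "C = B'" if "positive_op C \<and> C \<circ> C = (\<lambda>x. x - R x)" for C
      by (rule uniq[OF conjunct1[OF that] conjunct2[OF that]])
  qed
  show ?lim unfolding eq unfolding B'_def by (intro tendsto_intros Y)
  show ?pos unfolding eq by (rule pos)
  show ?sq unfolding eq by (rule BB)
qed

lemma sqrt_op_intertwine:
  assumes R: "contractive_sa R" "contractive_sa R'" and X: "bop X" "\<And>x. X (R x) = R' (X x)"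
  shows "X (sqrt_op (\<lambda>x. x - R x) x) = sqrt_op (\<lambda>x. x - R' x) (X x)"
  using LIMSEQ_unique[OF bop_tendsto[OF X(1) sqrt_op_limit(1)[OF R(1), of x]]]
    sqrt_op_limit(1)[OF R(2), of "X x"]
  by (simp add: bop_diff[OF X(1)] sqrt_iter_intertwine[of X R R', OF X])


section \<open>Defect operators\<close>

lemma bop_row: "(\<And>i. bop (T i)) \<Longrightarrow> bop (row T)"
  unfolding row_def[abs_def] by (intro bop_sum bop_compose[OF _ bop_nth])

lemma commuting_row_contraction_bop: "commuting_row_contraction T \<Longrightarrow> bop (T i)"
  by (simp add: commuting_row_contraction_def)

lemma adj_row:
  assumes "\<And>i. bop (T i)" shows "adj (row T) h = (\<chi> i. adj (T i) h)"
  by (rule adj_eqI)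
    (auto simp: bop_scaleC[OF bop_row[OF assms]], simp add: row_def inner_sum_left inner_vec_def inner_adj[OF assms])

locale row_contraction =
  fixes T :: "'n::finite \<Rightarrow> 'h::chilbert_space \<Rightarrow> 'h"
  assumes T: "commuting_row_contraction T"
begin

lemma bop_T: "bop (T i)" and bop_rowT: "bop (row T)" and bop_adj_rowT: "bop (adj (row T))"
  using commuting_row_contraction_bop[OF T] by (auto intro!: bop_row bop_adj)

lemma inner_adj_rowT: "inner (row T x) h = inner x (adj (row T) h)"
  by (rule inner_adj[OF bop_rowT])

lemma inner_adj_rowT': "inner (adj (row T) h) x = inner h (row T x)"
  using inner_adj_rowT[of x h] by (simp add: inner_commute)

lemma norm_adj_rowT: "norm (adj (row T) h) \<le> norm h"
proof (rule power2_le_imp_le)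
  have "inner (h - (\<Sum>i\<in>UNIV. T i (adj (T i) h))) h \<ge> 0"
    using T by (auto simp: commuting_row_contraction_def positive_op_def complex_nonneg_Reals_iff
        simp flip: Re_cinner)
  then show "(norm (adj (row T) h))\<^sup>2 \<le> (norm h)\<^sup>2"
    by (simp add: inner_diff_left inner_sum_left inner_adj[OF bop_T] adj_row[OF bop_T] norm_vec_sq
        power2_norm_eq_inner)
qed simp

lemma norm_rowT: "norm (row T x) \<le> norm x"
proof (cases "row T x = 0")
  case False
  have "(norm (row T x))\<^sup>2 = inner x (adj (row T) (row T x))"
    by (simp add: power2_norm_eq_inner inner_adj_rowT)
  also have "\<dots> \<le> norm x * norm (row T x)"
    using norm_cauchy_schwarz[of x "adj (row T) (row T x)"]
      mult_left_mono[OF norm_adj_rowT[of "row T x"], of "norm x"] by simp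
  finally show ?thesis using False by (simp add: power2_eq_square)
qed simp

lemma contractive_sa_defect: "contractive_sa (\<lambda>x. adj (row T) (row T x))"
  "contractive_sa (\<lambda>h. row T (adj (row T) h))"
  using norm_adj_rowT norm_rowT order_trans
  by (auto simp: contractive_sa_def inner_adj_rowT inner_adj_rowT' intro!: bop_compose[OF bop_rowT] bop_compose[OF bop_adj_rowT] bop_rowT bop_adj_rowT)
    (blast intro: order_trans)+

lemma positive_defect: "positive_op (defect T)"
  unfolding defect_def by (rule sqrt_op_limit(2)[OF contractive_sa_defect(1)])

lemma bop_defect: "bop (defect T)"
  using positive_defect by (simp add: positive_op_def)

lemma inner_defect: "inner (defect T x) y = inner x (defect T y)"
  by (rule positive_op_selfadjoint[OF positive_defect])

lemma defect_defect: "defect T (defect T x) = x - adj (row T) (row T x)"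
  unfolding defect_def by (rule sqrt_op_limit(3)[OF contractive_sa_defect(1)])

lemma positive_defect_star: "positive_op (defect_star T)"
  unfolding defect_star_def by (rule sqrt_op_limit(2)[OF contractive_sa_defect(2)])

lemma bop_defect_star: "bop (defect_star T)"
  using positive_defect_star by (simp add: positive_op_def)

lemma inner_defect_star: "inner (defect_star T x) y = inner x (defect_star T y)"
  by (rule positive_op_selfadjoint[OF positive_defect_star])

lemma defect_star_defect_star: "defect_star T (defect_star T h) = h - row T (adj (row T) h)"
  unfolding defect_star_def by (rule sqrt_op_limit(3)[OF contractive_sa_defect(2)])

text \<open>The row intertwines its two products with the adjoint, hence also the square roots. This
  relation and its adjoint make the mixed terms in the Halmos operator cancel.\<close>

lemma row_defect: "row T (defect T x) = defect_star T (row T x)"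
  unfolding defect_def defect_star_def
  by (rule sqrt_op_intertwine[OF contractive_sa_defect bop_rowT]) simp

lemma adj_row_defect_star: "adj (row T) (defect_star T h) = defect T (adj (row T) h)"
  unfolding defect_def defect_star_def
  by (rule sqrt_op_intertwine[OF contractive_sa_defect(2,1) bop_adj_rowT]) simp

lemma norm_defect: "(norm (defect T x))\<^sup>2 = (norm x)\<^sup>2 - (norm (row T x))\<^sup>2"
  by (simp add: power2_norm_eq_inner inner_defect defect_defect inner_diff_right
      flip: inner_adj_rowT)

lemma norm_defect_star: "(norm (defect_star T h))\<^sup>2 = (norm h)\<^sup>2 - (norm (adj (row T) h))\<^sup>2"
  by (simp add: power2_norm_eq_inner inner_defect_star defect_star_defect_star inner_diff_right
      flip: inner_adj_rowT')

lemma closed_csubspace_defect_space: "closed_csubspace (defect_space T)"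
  unfolding defect_space_def by (rule closed_csubspace_closure_range[OF bop_defect])

lemma closed_csubspace_defect_star_space: "closed_csubspace (defect_star_space T)"
  unfolding defect_star_space_def by (rule closed_csubspace_closure_range[OF bop_defect_star])

end

text \<open>With A = J P, where P projects onto K, the positive root B of the product of
  \<open>adj A\<close> and A has the same norms as A, so B x \<mapsto> A x extends to an isometry.
  Its domain is all of K because A is injective there. The lemma moves a Hilbert space into another
  type when only an injective contraction into that type is at hand.\<close>

lemma polar_embedding:
  fixes J :: "'e::chilbert_space \<Rightarrow> 'q::chilbert_space"
  assumes K: "closed_csubspace K" and J: "bop J" "\<And>x. norm (J x) \<le> norm x"
    and inj: "\<And>x. x \<in> K \<Longrightarrow> J x = 0 \<Longrightarrow> x = 0"
  obtains W :: "'e \<Rightarrow> 'q" and M where "hilbert_iso K M W"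
proof -
  obtain P where P: "bop P" "\<And>x. P x \<in> K" "\<And>x. x \<in> K \<Longrightarrow> P x = x"
    "\<And>x m. m \<in> K \<Longrightarrow> inner (x - P x) m = 0" "\<And>x. norm (P x) \<le> norm x"
    using csubspace_projection[OF K] by blast
  define A where "A = (\<lambda>x. J (P x))"
  have bA: "bop A" unfolding A_def by (rule bop_compose[OF J(1) P(1)])
  have nA: "norm (A x) \<le> norm x" for x
    unfolding A_def using J(2) P(5) order_trans by blast
  have nA': "norm (adj A y) \<le> norm y" for y
    using norm_adj_le[OF bA, of 1 y] nA by simp
  have iA': "inner (adj A y) x = inner y (A x)" for x y
    by (simp add: inner_commute[of "adj A y"] inner_adj[OF bA, symmetric] inner_commute)
  \<comment> \<open>Chosen so that x - R x is \<open>adj A (A x)\<close>, the shape in which the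
    square root has been constructed.\<close>
  define R where "R = (\<lambda>x. x - adj A (A x))"
  have "contractive_sa R"
    unfolding contractive_sa_def
  proof (intro conjI allI)
    show "bop R" unfolding R_def by (intro bop_intros bop_compose[OF bop_adj[OF bA]] bA)
    show "inner (R x) y = inner x (R y)" for x y
      by (simp add: R_def inner_diff_left inner_diff_right iA' inner_adj[OF bA, symmetric])
    show "norm (R x) \<le> norm x" for x
    proof (rule power2_le_imp_le)
      have "(norm (R x))\<^sup>2 = (norm x)\<^sup>2 - 2 * (norm (A x))\<^sup>2 + (norm (adj A (A x)))\<^sup>2"
        unfolding power2_norm_eq_inner R_def
        by (simp add: inner_diff_left inner_diff_right iA' inner_commute[of x "adj A (A x)"])
      moreover have "(norm (adj A (A x)))\<^sup>2 \<le> (norm (A x))\<^sup>2"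
        using nA' by (intro power_mono) auto
      ultimately show "(norm (R x))\<^sup>2 \<le> (norm x)\<^sup>2" by (smt (verit) zero_le_power2)
    qed simp
  qed
  define B where "B = sqrt_op (\<lambda>x. x - R x)"
  have B: "positive_op B" "B (B x) = adj A (A x)" for x
    using sqrt_op_limit(2,3)[OF \<open>contractive_sa R\<close>] by (auto simp: B_def R_def)
  have bB: "bop B" using B(1) by (simp add: positive_op_def)
  have saB: "inner (B x) y = inner x (B y)" for x y by (rule positive_op_selfadjoint[OF B(1)])
  have nB: "norm (B x) = norm (A x)" for x
  proof -
    have "(norm (B x))\<^sup>2 = (norm (A x))\<^sup>2"
      by (simp add: power2_norm_eq_inner saB B(2) inner_adj[OF bA])
    then show ?thesis by simp
  qed
  obtain W where W: "hilbert_iso (closure (range B)) (closure (range A)) W"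
    using isometric_extension[OF bB bA nB] by blast
  \<comment> \<open>B annihilates the complement of K because A does, and B is symmetric; hence its
    range lies in K.\<close>
  have BK: "B x \<in> K" for x
  proof -
    have "A (B x - P (B x)) = 0" by (simp add: A_def bop_diff[OF P(1)] P(2,3) bop_zero[OF J(1)])
    then have "B (B x - P (B x)) = 0" using nB[of "B x - P (B x)"] by simp
    then have "inner (B x) (B x - P (B x)) = 0" by (simp add: saB)
    moreover have "inner (P (B x)) (B x - P (B x)) = 0"
      using P(4)[OF P(2)] by (simp add: inner_commute)
    ultimately have "inner (B x - P (B x)) (B x - P (B x)) = 0" by (simp add: inner_diff_left)
    then show ?thesis using P(2)[of "B x"] by simp
  qed
  have "closure (range B) = K"
  proof
    show "closure (range B) \<subseteq> K"
      using BK closed_csubspaceD(1)[OF K] by (intro closure_minimal) auto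
    show "K \<subseteq> closure (range B)"
    proof
      fix x assume x: "x \<in> K"
      obtain p where p: "p \<in> closure (range B)" "\<And>m. m \<in> closure (range B) \<Longrightarrow> inner (x - p) m = 0"
        using orthogonal_projection_exists[OF closed_closure
            closed_csubspace_subspace[OF closed_csubspace_closure_range[OF bB]]] by blast
      have pK: "p \<in> K" using p(1) \<open>closure (range B) \<subseteq> K\<close> by blast
      have "inner (B (x - p)) u = 0" for u
        using p(2)[of "B u"] closure_subset[of "range B"] by (auto simp: saB)
      then have "B (x - p) = 0" by (metis inner_eq_zero_iff)
      then have "A (x - p) = 0" using nB[of "x - p"] by simp
      moreover have d: "x - p \<in> K" using closed_csubspaceD(5)[OF K] x pK by blast
      ultimately have "x - p = 0" using inj[OF d] P(3)[OF d] by (simp add: A_def)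
      then show "x \<in> closure (range B)" using p(1) by simp
    qed
  qed
  then show ?thesis using that W by metis
qed


section \<open>Multi-indices\<close>

definition mdeg :: "('n::finite \<Rightarrow> nat) \<Rightarrow> nat" where
  "mdeg \<alpha> = (\<Sum>i\<in>UNIV. \<alpha> i)"

definition level :: "nat \<Rightarrow> ('n::finite \<Rightarrow> nat) set" where
  "level m = {\<alpha>. mdeg \<alpha> = m}"

definition up :: "'n \<Rightarrow> ('n \<Rightarrow> nat) \<Rightarrow> 'n \<Rightarrow> nat" where
  "up j \<alpha> = \<alpha>(j := Suc (\<alpha> j))"

text \<open>Truncated subtraction makes \<open>dn j\<close> inverse to \<open>up j\<close> only
  where the entry at j is positive, which is why sums over predecessors always carry the condition
  \<alpha> j > 0.\<close>

definition dn :: "'n \<Rightarrow> ('n \<Rightarrow> nat) \<Rightarrow> 'n \<Rightarrow> nat" where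
  "dn j \<alpha> = \<alpha>(j := \<alpha> j - 1)"

definition monom :: "complex ^ 'n::finite \<Rightarrow> ('n \<Rightarrow> nat) \<Rightarrow> complex" where
  "monom z \<alpha> = (\<Prod>i\<in>UNIV. (z $ i) ^ \<alpha> i)"

lemma dn_up [simp]: "dn j (up j \<alpha>) = \<alpha>" and up_dn [simp]: "\<alpha> j > 0 \<Longrightarrow> up j (dn j \<alpha>) = \<alpha>"
  and up_pos [simp]: "up j \<alpha> j > 0"
  by (auto simp: up_def dn_def)

lemma up_nonzero [simp]: "up j \<alpha> j \<noteq> 0"
  by (simp add: up_def)

lemma inj_up: "inj (up j)"
  by (metis dn_up injI)

lemma mdeg_up [simp]: "mdeg (up j \<alpha>) = Suc (mdeg \<alpha>)"
  by (simp add: mdeg_def up_def sum.remove[of UNIV j])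

lemma mdeg_dn: "\<alpha> j > 0 \<Longrightarrow> Suc (mdeg (dn j \<alpha>)) = mdeg \<alpha>"
  by (metis mdeg_up up_dn)

lemma mdeg_0_iff: "mdeg \<alpha> = 0 \<longleftrightarrow> (\<forall>i. \<alpha> i = 0)"
  by (simp add: mdeg_def)

lemma finite_mdeg_less: "finite {\<alpha> :: 'n::finite \<Rightarrow> nat. mdeg \<alpha> < M}"
proof (rule finite_subset)
  show "{\<alpha> :: 'n \<Rightarrow> nat. mdeg \<alpha> < M} \<subseteq> PiE UNIV (\<lambda>_. {..M})"
  proof
    fix \<alpha> :: "'n \<Rightarrow> nat" assume "\<alpha> \<in> {\<alpha>. mdeg \<alpha> < M}"
    moreover have "\<alpha> i \<le> mdeg \<alpha>" for i
      unfolding mdeg_def by (rule member_le_sum) auto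
    ultimately show "\<alpha> \<in> PiE UNIV (\<lambda>_. {..M})"
      by (auto intro: less_imp_le le_less_trans)
  qed
qed (intro finite_PiE, auto)

lemma finite_level [simp]: "finite (level m)"
  by (rule finite_subset[OF _ finite_mdeg_less[of "Suc m"]]) (auto simp: level_def)

lemma sum_levels: "(\<Sum>m<M. \<Sum>\<alpha>\<in>level m. G \<alpha>) = (\<Sum>\<alpha> | mdeg \<alpha> < M. G \<alpha>)"
proof -
  have "(\<Sum>m<M. \<Sum>\<alpha>\<in>level m. G \<alpha>) = (\<Sum>m<M. \<Sum>\<alpha>\<in>{\<alpha>\<in>{\<alpha>. mdeg \<alpha> < M}. mdeg \<alpha> = m}. G \<alpha>)"
    by (intro sum.cong refl) (auto simp: level_def)
  also have "\<dots> = (\<Sum>\<alpha> | mdeg \<alpha> < M. G \<alpha>)"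
    by (rule sum.group) (auto simp: finite_mdeg_less)
  finally show ?thesis .
qed

text \<open>Double counting of the edges between two consecutive degrees, once from above by
  lowering and once from below by raising. Every induction on the degree goes through it.\<close>

lemma sum_level_Suc:
  "(\<Sum>\<alpha>\<in>level (Suc m). \<Sum>j | \<alpha> j > 0. F j \<alpha>) = (\<Sum>\<beta>\<in>level m. \<Sum>j\<in>UNIV. F j (up j \<beta>))"
proof -
  have "(\<Sum>\<alpha>\<in>level (Suc m). \<Sum>j | \<alpha> j > 0. F j \<alpha>) =
      (\<Sum>(\<alpha>, j)\<in>(SIGMA \<alpha>:level (Suc m). {j. \<alpha> j > 0}). F j \<alpha>)"
    by (rule sum.Sigma) auto
  also have "\<dots> = (\<Sum>(\<beta>, j)\<in>level m \<times> UNIV. F j (up j \<beta>))"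
    by (rule sum.reindex_bij_witness[where i = "\<lambda>(\<beta>, j). (up j \<beta>, j)" and j = "\<lambda>(\<alpha>, j). (dn j \<alpha>, j)"])
      (auto simp: level_def dest: mdeg_dn)
  finally show ?thesis by (simp add: sum.cartesian_product)
qed

lemma monom_up: "monom z (up j \<alpha>) = z $ j * monom z \<alpha>"
proof -
  have "(\<Prod>i\<in>UNIV - {j}. (z $ i) ^ up j \<alpha> i) = (\<Prod>i\<in>UNIV - {j}. (z $ i) ^ \<alpha> i)"
    by (intro prod.cong) (auto simp: up_def)
  then show ?thesis
    by (simp add: monom_def prod.remove[of UNIV j] up_def)
qed

lemma multinom_nonzero [simp]: "multinom \<alpha> \<noteq> 0"
  using multinom_pos[of \<alpha>] by simp

lemma multinom_up: "multinom (up j \<beta>) * (real (\<beta> j) + 1) = multinom \<beta> * (real (mdeg \<beta>) + 1)"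
proof -
  have "(\<Prod>i\<in>UNIV - {j}. fact (up j \<beta> i)) = (\<Prod>i\<in>UNIV - {j}. fact (\<beta> i) :: real)"
    by (intro prod.cong) (auto simp: up_def)
  then have "(\<Prod>i\<in>UNIV. fact (up j \<beta> i) :: real) = (real (\<beta> j) + 1) * (\<Prod>i\<in>UNIV. fact (\<beta> i))"
    by (simp add: prod.remove[of UNIV j] up_def algebra_simps)
  moreover have "(\<Prod>i\<in>UNIV. fact (\<beta> i) :: real) \<noteq> 0" by simp
  moreover have "fact (mdeg (up j \<beta>)) = (real (mdeg \<beta>) + 1) * fact (mdeg \<beta>)"
    by (simp add: algebra_simps)
  ultimately show ?thesis
    unfolding multinom_def mdeg_def[symmetric] by (simp add: divide_simps)
qed

text \<open>Pascal's rule. It is the reason why the Drury-Arveson weights fit row contractions: the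
  energy estimate and the computation of the shift's defect both rest on it.\<close>

lemma multinom_Suc:
  assumes "mdeg \<alpha> = Suc m"
  shows "multinom \<alpha> = (\<Sum>j | \<alpha> j > 0. multinom (dn j \<alpha>))"
proof -
  have "multinom (dn j \<alpha>) * (real m + 1) = multinom \<alpha> * real (\<alpha> j)" if "\<alpha> j > 0" for j
  proof -
    have "real (dn j \<alpha> j) + 1 = real (\<alpha> j)" "mdeg (dn j \<alpha>) = m"
      using that mdeg_dn[of \<alpha> j, OF that] assms by (auto simp: dn_def of_nat_diff)
    then show ?thesis using multinom_up[of j "dn j \<alpha>"] up_dn[of \<alpha> j, OF that] by simp
  qed
  then have "(\<Sum>j | \<alpha> j > 0. multinom (dn j \<alpha>)) * (real m + 1) = (\<Sum>j | \<alpha> j > 0. multinom \<alpha> * real (\<alpha> j))"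
    unfolding sum_distrib_right by (intro sum.cong) auto
  also have "\<dots> = (\<Sum>j\<in>UNIV. multinom \<alpha> * real (\<alpha> j))"
    by (intro sum.mono_neutral_left) auto
  also have "\<dots> = multinom \<alpha> * (real m + 1)"
    using assms by (simp add: mdeg_def flip: sum_distrib_left of_nat_sum)
  finally show ?thesis by (simp add: add_nonneg_eq_0_iff)
qed

lemma multinom_0: "mdeg \<alpha> = 0 \<Longrightarrow> multinom \<alpha> = 1"
  by (simp add: multinom_def mdeg_0_iff)

lemma level_0: "level 0 = {\<lambda>_. 0}"
  by (auto simp: level_def mdeg_0_iff)

lemma norm_cvec_sq: "(norm (z :: complex ^ 'n::finite))\<^sup>2 = (\<Sum>i\<in>UNIV. (cmod (z $ i))\<^sup>2)"
  by (simp add: norm_vec_def L2_set_def sum_nonneg)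

text \<open>The multinomial theorem at the numbers |z_i|^2, derived from Pascal's rule. Summed over
  m, these terms form the geometric series of the reproducing kernel on the diagonal.\<close>

lemma sum_multinom_monom:
  "(\<Sum>\<alpha>\<in>level m. multinom \<alpha> * (cmod (monom z \<alpha>))\<^sup>2) = (norm z)\<^sup>2 ^ m"
proof (induction m)
  case 0
  then show ?case by (simp add: level_0 multinom_0 mdeg_0_iff monom_def)
next
  case (Suc m)
  have "(\<Sum>\<alpha>\<in>level (Suc m). multinom \<alpha> * (cmod (monom z \<alpha>))\<^sup>2) =
      (\<Sum>\<alpha>\<in>level (Suc m). \<Sum>j | \<alpha> j > 0. multinom (dn j \<alpha>) * (cmod (monom z \<alpha>))\<^sup>2)"
    by (intro sum.cong refl) (simp add: level_def multinom_Suc sum_distrib_right)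
  also have "\<dots> = (\<Sum>\<beta>\<in>level m. \<Sum>j\<in>UNIV. multinom \<beta> * (cmod (z $ j * monom z \<beta>))\<^sup>2)"
    by (simp add: sum_level_Suc monom_up)
  also have "\<dots> = (norm z)\<^sup>2 * (\<Sum>\<beta>\<in>level m. multinom \<beta> * (cmod (monom z \<beta>))\<^sup>2)"
    by (simp add: norm_cvec_sq norm_mult power_mult_distrib sum_distrib_left sum_distrib_right mult_ac
        sum.swap[of _ UNIV])
  finally show ?case using Suc by simp
qed


section \<open>Power series in the Drury-Arveson space\<close>

lemma h2_eval_eq: "h2_eval f z = (\<Sum>\<^sub>\<infinity>\<alpha>. monom z \<alpha> *\<^sub>C coeff f \<alpha>)"
  by (simp add: h2_eval_def monom_def)

lemma summable_levels:
  assumes "\<And>\<alpha>. G \<alpha> \<ge> (0::real)" "\<And>M. (\<Sum>m<M. \<Sum>\<alpha>\<in>level m. G \<alpha>) \<le> K"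
  shows "G summable_on UNIV" "infsum G UNIV \<le> K"
proof -
  have le: "sum G F \<le> K" if F: "finite F" for F
  proof -
    define M where "M = Suc (Max (insert 0 (mdeg ` F)))"
    have "F \<subseteq> {\<alpha>. mdeg \<alpha> < M}"
      using F by (auto simp: M_def less_Suc_eq_le)
    then have "sum G F \<le> (\<Sum>\<alpha> | mdeg \<alpha> < M. G \<alpha>)"
      by (intro sum_mono2 finite_mdeg_less) (auto simp: assms)
    then show ?thesis using assms(2)[of M] by (simp add: sum_levels)
  qed
  show s: "G summable_on UNIV"
    by (rule nonneg_bdd_above_summable_on) (auto simp: assms intro!: bdd_aboveI2[where M = K] le)
  show "infsum G UNIV \<le> K"
    by (rule infsum_le_finite_sums[OF s]) (rule le)
qed

text \<open>The finite sets of multi-indices of degree below M exhaust all multi-indices, so an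
  unconditional sum may be regrouped by degree.\<close>

lemma has_sum_levels:
  fixes g :: "('n::finite \<Rightarrow> nat) \<Rightarrow> 'a::real_normed_vector"
  assumes "(g has_sum s) UNIV"
  shows "(\<lambda>m. \<Sum>\<alpha>\<in>level m. g \<alpha>) sums s"
proof -
  have "filterlim (\<lambda>M. {\<alpha>. mdeg \<alpha> < M}) (finite_subsets_at_top (UNIV :: ('n \<Rightarrow> nat) set)) sequentially"
    unfolding filterlim_finite_subsets_at_top
  proof (intro allI impI)
    fix X :: "('n \<Rightarrow> nat) set" assume X: "finite X \<and> X \<subseteq> UNIV"
    have "X \<subseteq> {\<alpha>. mdeg \<alpha> < M}" if "M \<ge> Suc (Max (insert 0 (mdeg ` X)))" for M
      using X that by (auto simp: Suc_le_eq)
    then show "\<forall>\<^sub>F M in sequentially. finite {\<alpha>. mdeg \<alpha> < M} \<and> X \<subseteq> {\<alpha>. mdeg \<alpha> < M} \<and> {\<alpha>. mdeg \<alpha> < M} \<subseteq> UNIV"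
      by (auto simp: finite_mdeg_less eventually_sequentially)
  qed
  then have "(\<lambda>M. sum g {\<alpha>. mdeg \<alpha> < M}) \<longlonglongrightarrow> s"
    using assms unfolding has_sum_def by (rule filterlim_compose[rotated])
  then show ?thesis by (simp add: sums_def sum_levels)
qed

text \<open>Cauchy-Schwarz bounds the terms of degree m by K times the m-th power of the norm of z.
  The hypothesis controls each degree separately and not the total, because the lemma is also
  applied to state sequences, for which only such a bound is available.\<close>

lemma summable_monom:
  assumes z: "norm (z :: complex ^ 'n::finite) < 1" and K: "K \<ge> 0"
    and c: "\<And>m. (\<Sum>\<alpha>\<in>level m. (norm (c \<alpha>))\<^sup>2 / multinom \<alpha>) \<le> K\<^sup>2"
  shows "(\<lambda>\<alpha>. monom z \<alpha> *\<^sub>C (c \<alpha> :: 'a::chilbert_space)) summable_on UNIV"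
proof (rule abs_summable_summable, rule summable_levels)
  fix M
  have "(\<Sum>\<alpha>\<in>level m. norm (monom z \<alpha> *\<^sub>C c \<alpha>)) \<le> K * norm z ^ m" for m
  proof (rule power2_le_imp_le)
    have "(\<Sum>\<alpha>\<in>level m. norm (monom z \<alpha> *\<^sub>C c \<alpha>)) =
        (\<Sum>\<alpha>\<in>level m. (norm (c \<alpha>) / sqrt (multinom \<alpha>)) * (sqrt (multinom \<alpha>) * cmod (monom z \<alpha>)))"
      by (intro sum.cong) (auto simp: norm_scaleC)
    also have "\<dots>\<^sup>2 \<le> (\<Sum>\<alpha>\<in>level m. (norm (c \<alpha>) / sqrt (multinom \<alpha>))\<^sup>2) *
        (\<Sum>\<alpha>\<in>level m. (sqrt (multinom \<alpha>) * cmod (monom z \<alpha>))\<^sup>2)"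
      by (rule Cauchy_Schwarz_ineq_sum)
    also have "\<dots> = (\<Sum>\<alpha>\<in>level m. (norm (c \<alpha>))\<^sup>2 / multinom \<alpha>) * (norm z)\<^sup>2 ^ m"
      by (simp add: power_divide power_mult_distrib less_imp_le[OF multinom_pos] sum_multinom_monom)
    also have "\<dots> \<le> K\<^sup>2 * (norm z)\<^sup>2 ^ m"
      by (intro mult_right_mono c) auto
    finally show "(\<Sum>\<alpha>\<in>level m. norm (monom z \<alpha> *\<^sub>C c \<alpha>))\<^sup>2 \<le> (K * norm z ^ m)\<^sup>2"
      by (simp add: power_mult_distrib flip: power_mult) (simp add: mult.commute)
  qed (use K in auto)
  then have "(\<Sum>m<M. \<Sum>\<alpha>\<in>level m. norm (monom z \<alpha> *\<^sub>C c \<alpha>)) \<le> (\<Sum>m<M. K * norm z ^ m)"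
    by (rule sum_mono)
  also have "\<dots> = K * (\<Sum>m<M. norm z ^ m)" by (simp add: sum_distrib_left)
  also have "(\<Sum>m<M. norm z ^ m) \<le> 1 / (1 - norm z)"
    using z by (simp add: pos_le_divide_eq mult.commute flip: one_diff_power_eq[of "norm z" M])
  finally show "(\<Sum>m<M. \<Sum>\<alpha>\<in>level m. norm (monom z \<alpha> *\<^sub>C c \<alpha>)) \<le> K * (1 / (1 - norm z))"
    using K by (simp add: mult_left_mono)
qed auto

lemma sum_level_coeff_le: "(\<Sum>\<alpha>\<in>level m. (norm (coeff f \<alpha>))\<^sup>2 / multinom \<alpha>) \<le> (norm f)\<^sup>2"
  by (rule norm_coeff_sum_le) simp

lemma has_sum_h2_eval:
  assumes "norm z < 1"
  shows "((\<lambda>\<alpha>. monom z \<alpha> *\<^sub>C coeff f \<alpha>) has_sum h2_eval f z) UNIV"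
  unfolding h2_eval_eq
  by (rule has_sum_infsum, rule summable_monom[OF assms norm_ge_zero[of f]]) (rule sum_level_coeff_le)

section \<open>Uniqueness of power series on the ball\<close>

lemma power_series_zero:
  fixes a :: "nat \<Rightarrow> real"
  assumes "\<And>t. \<bar>t\<bar> < 1 \<Longrightarrow> (\<lambda>n. a n * t ^ n) sums 0"
  shows "a n = 0"
proof (induction n rule: less_induct)
  case (less n)
  have "(\<lambda>m. a (m + n) * t ^ m) sums 0" if t: "t \<noteq> 0" "norm t < 1" for t
  proof -
    have "(\<lambda>m. a (m + n) * t ^ (m + n)) sums (0 - (\<Sum>i<n. a i * t ^ i))"
      using sums_split_initial_segment[OF assms, of t n] t by simp
    then have "(\<lambda>m. a (m + n) * t ^ (m + n)) sums 0" by (simp add: less)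
    from sums_divide[OF this, of "t ^ n"] show ?thesis using t by (simp add: power_add)
  qed
  from powser_limit_0_strong[of 1 "\<lambda>m. a (m + n)" "\<lambda>_. 0", OF _ this]
  have "((\<lambda>_. 0) \<longlongrightarrow> a n) (at (0::real))" by simp
  then show ?case by (simp add: tendsto_const_iff)
qed

text \<open>Induction on the set of variables: grouped by the exponent of j, the sum is a polynomial
  in the j-th variable with infinitely many roots, so every group vanishes. Pairing the vector
  coefficients with one of them reduces this to real polynomials.\<close>

lemma monomials_independent:
  fixes c :: "('n \<Rightarrow> nat) \<Rightarrow> 'a::real_inner"
  assumes "finite I" "finite A" "r > 0"
    and "\<And>\<alpha> \<beta>. \<alpha> \<in> A \<Longrightarrow> \<beta> \<in> A \<Longrightarrow> (\<And>i. i \<in> I \<Longrightarrow> \<alpha> i = \<beta> i) \<Longrightarrow> \<alpha> = \<beta>"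
    and "\<And>t::'n \<Rightarrow> real. (\<And>i. 0 < t i \<and> t i < r) \<Longrightarrow> (\<Sum>\<alpha>\<in>A. (\<Prod>i\<in>I. t i ^ \<alpha> i) *\<^sub>R c \<alpha>) = 0"
    and "\<alpha> \<in> A"
  shows "c \<alpha> = 0"
  using assms
proof (induction I arbitrary: A \<alpha> rule: finite_induct)
  case empty
  then have "A = {\<alpha>}" by blast
  then show ?case using empty.prems(4)[of "\<lambda>_. r / 2"] \<open>r > 0\<close> by simp
next
  case (insert j I)
  define B where "B k = {\<beta>\<in>A. \<beta> j = k}" for k
  have "(\<Sum>\<beta>\<in>B k. (\<Prod>i\<in>I. t i ^ \<beta> i) *\<^sub>R c \<beta>) = 0" if t: "\<And>i. 0 < t i \<and> t i < r" for t :: "'n \<Rightarrow> real" and k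
  proof -
    define d where "d k = (\<Sum>\<beta>\<in>B k. (\<Prod>i\<in>I. t i ^ \<beta> i) *\<^sub>R c \<beta>)" for k
    define N where "N = Max (insert k ((\<lambda>\<beta>. \<beta> j) ` A))"
    have N: "k \<le> N" "(\<lambda>\<beta>. \<beta> j) ` A \<subseteq> {..N}"
      using insert.prems(1) by (auto simp: N_def)
    have "(\<Sum>k\<le>N. inner (d k) (d k') * s ^ k) = 0" if s: "s \<in> {0<..<r}" for s k'
    proof -
      have "(\<Sum>\<beta>\<in>A. (\<Prod>i\<in>insert j I. (t(j := s)) i ^ \<beta> i) *\<^sub>R c \<beta>) = 0"
        by (rule insert.prems(4)) (use s t in auto)
      also have "(\<Sum>\<beta>\<in>A. (\<Prod>i\<in>insert j I. (t(j := s)) i ^ \<beta> i) *\<^sub>R c \<beta>) =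
          (\<Sum>\<beta>\<in>A. (s ^ \<beta> j) *\<^sub>R (\<Prod>i\<in>I. t i ^ \<beta> i) *\<^sub>R c \<beta>)"
      proof (intro sum.cong refl)
        fix \<beta>
        have "(\<Prod>i\<in>I. (t(j := s)) i ^ \<beta> i) = (\<Prod>i\<in>I. t i ^ \<beta> i)"
          by (rule prod.cong) (use insert.hyps in auto)
        then show "(\<Prod>i\<in>insert j I. (t(j := s)) i ^ \<beta> i) *\<^sub>R c \<beta> = (s ^ \<beta> j) *\<^sub>R (\<Prod>i\<in>I. t i ^ \<beta> i) *\<^sub>R c \<beta>"
          using insert.hyps by simp
      qed
      also have "\<dots> = (\<Sum>k\<le>N. \<Sum>\<beta>\<in>{\<beta>\<in>A. \<beta> j = k}. (s ^ \<beta> j) *\<^sub>R (\<Prod>i\<in>I. t i ^ \<beta> i) *\<^sub>R c \<beta>)"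
        by (rule sum.group[symmetric]) (use insert.prems(1) N in auto)
      also have "\<dots> = (\<Sum>k\<le>N. (s ^ k) *\<^sub>R d k)"
        by (intro sum.cong refl) (simp add: d_def B_def scaleR_sum_right)
      finally have "inner (\<Sum>k\<le>N. (s ^ k) *\<^sub>R d k) (d k') = 0" by simp
      then show ?thesis by (simp add: inner_sum_left mult.commute)
    qed
    then have "{0<..<r} \<subseteq> {s. (\<Sum>k\<le>N. inner (d k) (d k') * s ^ k) = 0}" for k' by blast
    then have "infinite {s. (\<Sum>k\<le>N. inner (d k) (d k') * s ^ k) = 0}" for k'
      using infinite_Ioo[OF \<open>r > 0\<close>] infinite_super by blast
    then have "inner (d k) (d k) = 0"
      using polyfun_finite_roots[of "\<lambda>k'. inner (d k') (d k)" N] N(1) by blast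
    then show ?thesis by (simp add: d_def)
  qed
  moreover have "\<gamma> = \<beta>" if "\<gamma> \<in> B (\<alpha> j)" "\<beta> \<in> B (\<alpha> j)" "\<And>i. i \<in> I \<Longrightarrow> \<gamma> i = \<beta> i" for \<gamma> \<beta>
    by (rule insert.prems(3)) (use that in \<open>auto simp: B_def\<close>)
  moreover have "finite (B (\<alpha> j))" "\<alpha> \<in> B (\<alpha> j)"
    using insert.prems by (auto simp: B_def)
  ultimately show ?case
    using insert.IH[of "B (\<alpha> j)" \<alpha>] \<open>r > 0\<close> by blast
qed

text \<open>Along the real line through z the function is a power series in t whose coefficients are
  its homogeneous parts, so each part vanishes on the ball; independence of the monomials then kills
  its coefficients. This is what makes the definite description in \<open>mult_op\<close> well
  determined.\<close>

lemma h2_eval_zero_imp_zero: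
  fixes f :: "('n::finite, 'a::chilbert_space) h2"
  assumes "\<And>z. norm z < 1 \<Longrightarrow> h2_eval f z = 0"
  shows "f = 0"
proof (rule h2_eqI)
  fix \<alpha> :: "'n \<Rightarrow> nat"
  define P where "P m z = (\<Sum>\<alpha>\<in>level m. monom z \<alpha> *\<^sub>C coeff f \<alpha>)" for m z
  have P0: "P m z = 0" if z: "norm z < 1" for m z
  proof -
    have "inner (P n z) (P m z) = 0" for n
    proof (rule power_series_zero[where a = "\<lambda>n. inner (P n z) (P m z)"])
      fix t :: real assume t: "\<bar>t\<bar> < 1"
      have "norm (t *\<^sub>R z) < 1"
        using mult_le_one[of "\<bar>t\<bar>" "norm z"] mult_strict_mono[of "\<bar>t\<bar>" 1 "norm z" 1] t z by simp
      from has_sum_levels[OF has_sum_h2_eval[OF this, of f]]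
      have "(\<lambda>n. \<Sum>\<alpha>\<in>level n. monom (t *\<^sub>R z) \<alpha> *\<^sub>C coeff f \<alpha>) sums 0"
        using assms[OF \<open>norm (t *\<^sub>R z) < 1\<close>] by simp
      moreover have "(\<Sum>\<alpha>\<in>level n. monom (t *\<^sub>R z) \<alpha> *\<^sub>C coeff f \<alpha>) = (t ^ n) *\<^sub>R P n z" for n
      proof -
        have "monom (t *\<^sub>R z) \<alpha> = of_real (t ^ mdeg \<alpha>) * monom z \<alpha>" for \<alpha>
        proof -
          have "(t *\<^sub>R z) $ i = of_real t * z $ i" for i
            unfolding vector_scaleR_component by (rule scaleR_conv_of_real)
          then show ?thesis by (simp add: monom_def mdeg_def power_mult_distrib prod.distrib power_sum)
        qed
        then have "(\<Sum>\<alpha>\<in>level n. monom (t *\<^sub>R z) \<alpha> *\<^sub>C coeff f \<alpha>) =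
            (\<Sum>\<alpha>\<in>level n. (t ^ n) *\<^sub>R (monom z \<alpha> *\<^sub>C coeff f \<alpha>))"
          by (intro sum.cong) (auto simp: level_def scaleC_of_real[symmetric] scaleC_scaleC)
        then show ?thesis by (simp add: P_def scaleR_sum_right)
      qed
      ultimately have "(\<lambda>n. (t ^ n) *\<^sub>R P n z) sums 0" by simp
      from bounded_linear.sums[OF bounded_linear_inner_left[of "P m z"] this]
      show "(\<lambda>n. inner (P n z) (P m z) * t ^ n) sums 0" by (simp add: mult.commute)
    qed
    from this[of m] show ?thesis by simp
  qed
  show "coeff f \<alpha> = coeff 0 \<alpha>"
    unfolding coeff_zero
  \<comment> \<open>The bound r keeps the test points inside the ball: the norm is at most the sum
    of the coordinates, each of which is below \<open>1 / CARD('n)\<close>.\<close>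
  proof (rule monomials_independent[where I = UNIV and A = "level (mdeg \<alpha>)" and r = "1 / CARD('n)"])
    fix t :: "'n \<Rightarrow> real" assume t: "\<And>i. 0 < t i \<and> t i < 1 / CARD('n)"
    define z where "z = (\<chi> i. complex_of_real (t i))"
    have "norm z \<le> (\<Sum>i\<in>UNIV. cmod (z $ i))"
      unfolding norm_vec_def by (rule L2_set_le_sum) simp
    also have "\<dots> < (\<Sum>i\<in>(UNIV::'n set). 1 / CARD('n))"
      by (intro sum_strict_mono) (use t less_imp_le[of 0 "t _"] in \<open>auto simp: z_def\<close>)
    finally have "P (mdeg \<alpha>) z = 0" by (intro P0) simp
    moreover have "monom z \<beta> = of_real (\<Prod>i\<in>UNIV. t i ^ \<beta> i)" for \<beta>
      by (simp add: monom_def z_def)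
    ultimately show "(\<Sum>\<alpha>\<in>level (mdeg \<alpha>). (\<Prod>i\<in>UNIV. t i ^ \<alpha> i) *\<^sub>R coeff f \<alpha>) = 0"
      by (simp add: P_def scaleC_of_real del: of_real_prod)
  qed (simp_all, auto simp: level_def)
qed

lemma h2_eval_diff:
  assumes "norm z < 1" shows "h2_eval (f - g) z = h2_eval f z - h2_eval g z"
proof -
  have "((\<lambda>\<alpha>. monom z \<alpha> *\<^sub>C coeff f \<alpha> + - (monom z \<alpha> *\<^sub>C coeff g \<alpha>)) has_sum (h2_eval f z + - h2_eval g z)) UNIV"
    by (intro has_sum_add has_sum_uminus[THEN iffD2] has_sum_h2_eval[OF assms]) (simp add: has_sum_h2_eval[OF assms])
  then show ?thesis
    by (simp add: h2_eval_eq infsumI coeff_simps scaleC_diff_right)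
qed

lemma mult_op_eqI:
  assumes "\<And>z. norm z < 1 \<Longrightarrow> h2_eval g z = \<Phi> z (h2_eval f z)"
  shows "mult_op \<Phi> f = g"
  unfolding mult_op_def
proof (rule the_equality)
  fix g' assume g': "\<forall>z\<in>ball 0 1. h2_eval g' z = \<Phi> z (h2_eval f z)"
  have "g' - g = 0"
    by (rule h2_eval_zero_imp_zero) (use g' assms in \<open>auto simp: h2_eval_diff\<close>)
  then show "g' = g" by simp
qed (use assms in auto)


section \<open>Transfer functions of contractive colligations\<close>

text \<open>A colligation \<open>V : H \<oplus> E \<rightarrow> H\<^sup>n \<oplus> F\<close> is viewed as a linear system with state sequence \<open>x\<close>, input
  sequence \<open>a\<close> and output sequence \<open>y\<close>, all indexed by multi-indices. In terms of the power series
  of the three sequences it reads \<open>x(z) = Z V\<^sub>1(x(z), a(z))\<close> and \<open>y(z) = V\<^sub>2(x(z), a(z))\<close>.\<close>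

definition traj ::
  "('h::chilbert_space \<times> 'e::chilbert_space \<Rightarrow> ('h ^ 'n::finite) \<times> 'f::chilbert_space) \<Rightarrow>
   (('n \<Rightarrow> nat) \<Rightarrow> 'e) \<Rightarrow> (('n \<Rightarrow> nat) \<Rightarrow> 'h) \<Rightarrow> (('n \<Rightarrow> nat) \<Rightarrow> 'f) \<Rightarrow> bool" where
  "traj V a x y \<longleftrightarrow>
     (\<forall>\<alpha>. x \<alpha> = (\<Sum>j | \<alpha> j > 0. fst (V (x (dn j \<alpha>), a (dn j \<alpha>))) $ j) \<and> y \<alpha> = snd (V (x \<alpha>, a \<alpha>)))"

text \<open>The counter stands for the degree of \<alpha>. A state depends only on states one degree
  lower, so evaluating with the counter equal to \<open>mdeg \<alpha>\<close> solves the trajectory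
  equations.\<close>

primrec traj_state ::
  "('h::chilbert_space \<times> 'e::chilbert_space \<Rightarrow> ('h ^ 'n::finite) \<times> 'f::chilbert_space) \<Rightarrow>
   (('n \<Rightarrow> nat) \<Rightarrow> 'e) \<Rightarrow> nat \<Rightarrow> ('n \<Rightarrow> nat) \<Rightarrow> 'h" where
  "traj_state V a 0 = (\<lambda>\<alpha>. 0)"
| "traj_state V a (Suc m) = (\<lambda>\<alpha>. \<Sum>j | \<alpha> j > 0. fst (V (traj_state V a m (dn j \<alpha>), a (dn j \<alpha>))) $ j)"

lemma trajD:
  assumes "traj V a x y"
  shows "x \<alpha> = (\<Sum>j | \<alpha> j > 0. fst (V (x (dn j \<alpha>), a (dn j \<alpha>))) $ j)"
    and "y \<alpha> = snd (V (x \<alpha>, a \<alpha>))"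
  using assms unfolding traj_def by blast+

lemma trajI:
  assumes "\<And>\<alpha>. x \<alpha> = (\<Sum>j | \<alpha> j > 0. fst (V (x (dn j \<alpha>), a (dn j \<alpha>))) $ j)"
    and "\<And>\<alpha>. y \<alpha> = snd (V (x \<alpha>, a \<alpha>))"
  shows "traj V a x y"
  using assms unfolding traj_def by blast

lemma traj_exists: "\<exists>x y. traj V a x y"
proof -
  define x where "x \<alpha> = traj_state V a (mdeg \<alpha>) \<alpha>" for \<alpha>
  have "x \<alpha> = (\<Sum>j | \<alpha> j > 0. fst (V (x (dn j \<alpha>), a (dn j \<alpha>))) $ j)" for \<alpha>
  proof (cases "mdeg \<alpha>")
    case 0
    then have "\<alpha> i = 0" for i by (simp add: mdeg_0_iff)
    then show ?thesis using 0 by (simp add: x_def)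
  next
    case (Suc m)
    then have "mdeg (dn j \<alpha>) = m" if "\<alpha> j > 0" for j using mdeg_dn[of \<alpha> j, OF that] by simp
    then show ?thesis by (simp add: x_def Suc)
  qed
  then have "traj V a x (\<lambda>\<alpha>. snd (V (x \<alpha>, a \<alpha>)))" unfolding traj_def by blast
  then show ?thesis by blast
qed

text \<open>Operator identities are proved below through this uniqueness: two descriptions of the
  same system with the same input must have the same output.\<close>

lemma traj_unique:
  assumes "traj V a x y" "traj V a x' y'" shows "x = x'" "y = y'"
proof -
  have "x \<alpha> = x' \<alpha>" for \<alpha>
  proof (induction "mdeg \<alpha>" arbitrary: \<alpha> rule: less_induct)
    case less
    have "x (dn j \<alpha>) = x' (dn j \<alpha>)" if "\<alpha> j > 0" for j
      using less[of "dn j \<alpha>"] mdeg_dn[of \<alpha> j, OF that] by simp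
    then show ?case
      by (subst trajD(1)[OF assms(1)], subst trajD(1)[OF assms(2)]) (auto intro!: sum.cong)
  qed
  then show x: "x = x'" by auto
  show "y = y'"
  proof
    fix \<alpha>
    have "y \<alpha> = snd (V (x \<alpha>, a \<alpha>))" "y' \<alpha> = snd (V (x' \<alpha>, a \<alpha>))"
      using assms unfolding traj_def by blast+
    then show "y \<alpha> = y' \<alpha>" by (simp only: x)
  qed
qed

text \<open>Cauchy-Schwarz with weights. With the multinomial coefficients of the predecessors as c,
  Pascal's rule turns the denominator on the left into the weight of the new index.\<close>

lemma norm_sum_sq_le:
  assumes "finite J" "\<And>j. j \<in> J \<Longrightarrow> c j > (0::real)"
  shows "(norm (\<Sum>j\<in>J. v j))\<^sup>2 / (\<Sum>j\<in>J. c j) \<le> (\<Sum>j\<in>J. (norm (v j))\<^sup>2 / c j)"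
proof (cases "J = {}")
  case False
  have "(norm (\<Sum>j\<in>J. v j))\<^sup>2 \<le> (\<Sum>j\<in>J. norm (v j))\<^sup>2"
    by (intro power_mono norm_sum) auto
  also have "(\<Sum>j\<in>J. norm (v j)) = (\<Sum>j\<in>J. (norm (v j) / sqrt (c j)) * sqrt (c j))"
    using assms by (intro sum.cong) (auto simp: less_imp_neq[symmetric])
  also have "\<dots>\<^sup>2 \<le> (\<Sum>j\<in>J. (norm (v j) / sqrt (c j))\<^sup>2) * (\<Sum>j\<in>J. (sqrt (c j))\<^sup>2)"
    by (rule Cauchy_Schwarz_ineq_sum)
  also have "\<dots> = (\<Sum>j\<in>J. (norm (v j))\<^sup>2 / c j) * (\<Sum>j\<in>J. c j)"
    using assms by (simp add: power_divide less_imp_le)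
  finally show ?thesis
    using sum_pos[OF assms(1) False assms(2)] by (simp add: divide_le_eq)
qed simp

text \<open>Contractivity of V trades state and input of degree m for output and outgoing state.
  Distributing the outgoing state to degree m + 1 does not increase its weighted energy, so the
  estimates telescope over the degrees.\<close>

lemma traj_energy:
  fixes V :: "'h::chilbert_space \<times> 'e::chilbert_space \<Rightarrow> ('h ^ 'n::finite) \<times> 'f::chilbert_space"
  assumes traj: "traj V a x y" and V: "\<And>p. norm (V p) \<le> norm p"
  shows "(\<Sum>\<alpha>\<in>level M. (norm (x \<alpha>))\<^sup>2 / multinom \<alpha>) +
      (\<Sum>m<M. \<Sum>\<alpha>\<in>level m. (norm (y \<alpha>))\<^sup>2 / multinom \<alpha>) \<le>
      (\<Sum>m<M. \<Sum>\<alpha>\<in>level m. (norm (a \<alpha>))\<^sup>2 / multinom \<alpha>)"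
proof (induction M)
  case 0
  have "x (\<lambda>_. 0) = 0" by (subst trajD(1)[OF traj]) simp
  then show ?case by (simp add: level_0)
next
  case (Suc m)
  define w where "w \<beta> = fst (V (x \<beta>, a \<beta>))" for \<beta>
  have "(\<Sum>\<alpha>\<in>level (Suc m). (norm (x \<alpha>))\<^sup>2 / multinom \<alpha>) \<le>
      (\<Sum>\<alpha>\<in>level (Suc m). \<Sum>j | \<alpha> j > 0. (norm (w (dn j \<alpha>) $ j))\<^sup>2 / multinom (dn j \<alpha>))"
  proof (rule sum_mono)
    fix \<alpha> assume "\<alpha> \<in> (level (Suc m) :: ('n \<Rightarrow> nat) set)"
    then have "multinom \<alpha> = (\<Sum>j | \<alpha> j > 0. multinom (dn j \<alpha>))"
      using multinom_Suc[of \<alpha> m] by (simp add: level_def)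
    moreover have "x \<alpha> = (\<Sum>j | \<alpha> j > 0. w (dn j \<alpha>) $ j)"
      unfolding w_def by (rule trajD(1)[OF traj])
    ultimately show "(norm (x \<alpha>))\<^sup>2 / multinom \<alpha> \<le>
        (\<Sum>j | \<alpha> j > 0. (norm (w (dn j \<alpha>) $ j))\<^sup>2 / multinom (dn j \<alpha>))"
      using norm_sum_sq_le[of "{j. \<alpha> j > 0}" "\<lambda>j. multinom (dn j \<alpha>)" "\<lambda>j. w (dn j \<alpha>) $ j"]
      by (simp add: multinom_pos)
  qed
  also have "\<dots> = (\<Sum>\<beta>\<in>level m. (norm (w \<beta>))\<^sup>2 / multinom \<beta>)"
    by (simp add: sum_level_Suc norm_vec_sq sum_divide_distrib)
  finally have 1: "(\<Sum>\<alpha>\<in>level (Suc m). (norm (x \<alpha>))\<^sup>2 / multinom \<alpha>) \<le> \<dots>" .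
  have "(\<Sum>\<beta>\<in>level m. (norm (w \<beta>))\<^sup>2 / multinom \<beta>) + (\<Sum>\<beta>\<in>level m. (norm (y \<beta>))\<^sup>2 / multinom \<beta>) \<le>
      (\<Sum>\<beta>\<in>level m. (norm (x \<beta>))\<^sup>2 / multinom \<beta>) + (\<Sum>\<beta>\<in>level m. (norm (a \<beta>))\<^sup>2 / multinom \<beta>)"
    unfolding sum.distrib[symmetric] add_divide_distrib[symmetric]
  proof (intro sum_mono divide_right_mono)
    fix \<beta> :: "'n \<Rightarrow> nat"
    have "(norm (V (x \<beta>, a \<beta>)))\<^sup>2 \<le> (norm (x \<beta>, a \<beta>))\<^sup>2"
      using V by (intro power_mono) auto
    then show "(norm (w \<beta>))\<^sup>2 + (norm (y \<beta>))\<^sup>2 \<le> (norm (x \<beta>))\<^sup>2 + (norm (a \<beta>))\<^sup>2"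
      by (simp add: norm_prod_sq w_def trajD(2)[OF traj])
  qed (simp add: less_imp_le multinom_pos)
  then show ?case using 1 Suc.IH by simp
qed

lemma traj_h2:
  fixes V :: "'h::chilbert_space \<times> 'e::chilbert_space \<Rightarrow> ('h ^ 'n::finite) \<times> 'f::chilbert_space"
  assumes traj: "traj V (coeff f) x y" and V: "\<And>p. norm (V p) \<le> norm p"
  shows "(\<lambda>\<alpha>. (norm (y \<alpha>))\<^sup>2 / multinom \<alpha>) summable_on UNIV"
    and "norm (Abs_h2 y) \<le> norm f"
    and "(\<Sum>\<alpha>\<in>level M. (norm (x \<alpha>))\<^sup>2 / multinom \<alpha>) \<le> (norm f)\<^sup>2"
proof -
  have nn: "0 \<le> (norm v)\<^sup>2 / multinom \<alpha>" for v :: "'z::real_normed_vector" and \<alpha> :: "'n \<Rightarrow> nat"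
    by (simp add: less_imp_le multinom_pos)
  have le: "(\<Sum>\<alpha>\<in>level M. (norm (x \<alpha>))\<^sup>2 / multinom \<alpha>) +
      (\<Sum>m<M. \<Sum>\<alpha>\<in>level m. (norm (y \<alpha>))\<^sup>2 / multinom \<alpha>) \<le> (norm f)\<^sup>2" for M
    using traj_energy[OF traj V, of M] norm_coeff_sum_le[OF finite_mdeg_less, of f M]
    unfolding sum_levels by linarith
  have xn: "0 \<le> (\<Sum>\<alpha>\<in>level M. (norm (x \<alpha>))\<^sup>2 / multinom \<alpha>)"
    and yn: "0 \<le> (\<Sum>m<M. \<Sum>\<alpha>\<in>level m. (norm (y \<alpha>))\<^sup>2 / multinom \<alpha>)" for M
    by (intro sum_nonneg nn)+
  show "(\<Sum>\<alpha>\<in>level M. (norm (x \<alpha>))\<^sup>2 / multinom \<alpha>) \<le> (norm f)\<^sup>2"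
    using le[of M] yn[of M] by linarith
  have "(\<Sum>m<M. \<Sum>\<alpha>\<in>level m. (norm (y \<alpha>))\<^sup>2 / multinom \<alpha>) \<le> (norm f)\<^sup>2" for M
    using le[of M] xn[of M] by linarith
  note s = summable_levels[OF nn this]
  show "(\<lambda>\<alpha>. (norm (y \<alpha>))\<^sup>2 / multinom \<alpha>) summable_on UNIV" by (rule s(1))
  have "norm (Abs_h2 y) \<le> sqrt ((norm f)\<^sup>2)"
    unfolding norm_h2_def[of "Abs_h2 y"] coeff_Abs_h2[OF s(1)] by (rule real_sqrt_le_mono) (rule s(2))
  then show "norm (Abs_h2 y) \<le> norm f" by simp
qed

lemma has_sum_sum:
  fixes f :: "'i \<Rightarrow> 'b \<Rightarrow> 'a::real_normed_vector"
  assumes "\<And>i. i \<in> I \<Longrightarrow> (f i has_sum s i) A"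
  shows "((\<lambda>x. \<Sum>i\<in>I. f i x) has_sum (\<Sum>i\<in>I. s i)) A"
  using assms
  by (induction I rule: infinite_finite_induct) (auto intro: has_sum_add)

text \<open>The recursion is summed against the monomials of z. Raising the index in direction j
  multiplies the monomial by z_j, which turns the recursion into a fixed-point equation for the
  summed state X.\<close>

lemma traj_eval:
  fixes V :: "'h::chilbert_space \<times> 'e::chilbert_space \<Rightarrow> ('h ^ 'n::finite) \<times> 'f::chilbert_space"
  assumes traj: "traj V (coeff f) x y" and bV: "bop V" and V: "\<And>p. norm (V p) \<le> norm p"
    and z: "norm z < 1"
  obtains X where "X = (\<Sum>j\<in>UNIV. (z $ j) *\<^sub>C (fst (V (X, h2_eval f z)) $ j))"
    "h2_eval (Abs_h2 y) z = snd (V (X, h2_eval f z))"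
proof -
  define X where "X = (\<Sum>\<^sub>\<infinity>\<alpha>. monom z \<alpha> *\<^sub>C x \<alpha>)"
  have X: "((\<lambda>\<alpha>. monom z \<alpha> *\<^sub>C x \<alpha>) has_sum X) UNIV"
    unfolding X_def
    by (rule has_sum_infsum, rule summable_monom[OF z norm_ge_zero[of f]]) (rule traj_h2(3)[OF traj V])
  have p1: "bounded_linear (\<lambda>h. (h, 0) :: 'h \<times> 'e)" and p2: "bounded_linear (\<lambda>e. (0, e) :: 'h \<times> 'e)"
    by (intro bounded_linear_Pair bounded_linear_ident bounded_linear_zero)+
  have pair: "((\<lambda>\<alpha>. monom z \<alpha> *\<^sub>C (x \<alpha>, coeff f \<alpha>)) has_sum (X, h2_eval f z)) UNIV"
    using has_sum_add[OF has_sum_bounded_linear[OF p1 X] has_sum_bounded_linear[OF p2 has_sum_h2_eval[OF z, of f]]]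
    by (simp add: scaleC_prod_def o_def)
  have img: "((\<lambda>\<alpha>. monom z \<alpha> *\<^sub>C A (x \<alpha>, coeff f \<alpha>)) has_sum A (X, h2_eval f z)) UNIV" if "bop A"
    for A :: "'h \<times> 'e \<Rightarrow> 'b::chilbert_space"
    using has_sum_bounded_linear[OF bop_bounded_linear[OF that] pair]
    by (simp add: bop_scaleC[OF that] o_def)
  define w where "w j \<beta> = fst (V (x \<beta>, coeff f \<beta>)) $ j" for j \<beta>
  \<comment> \<open>Indices with \<alpha> j = 0 contribute nothing, and the others form the image of
    the injective map \<open>up j\<close>; reindexing supplies the factor z_j.\<close>
  have trm: "((\<lambda>\<alpha>. if \<alpha> j > 0 then monom z \<alpha> *\<^sub>C w j (dn j \<alpha>) else 0) has_sum
      (z $ j) *\<^sub>C (fst (V (X, h2_eval f z)) $ j)) UNIV" for j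
  proof -
    have "bop (\<lambda>p. fst (V p) $ j)"
      by (intro bop_compose[OF bop_nth] bop_compose[OF bop_fst] bV)
    from has_sum_bounded_linear[OF bounded_linear_scaleC[of "z $ j"] img[OF this]]
    have "((\<lambda>\<beta>. monom z (up j \<beta>) *\<^sub>C w j \<beta>) has_sum (z $ j) *\<^sub>C (fst (V (X, h2_eval f z)) $ j)) UNIV"
      by (simp add: monom_up w_def o_def scaleC_scaleC)
    then have "((\<lambda>\<alpha>. monom z \<alpha> *\<^sub>C w j (dn j \<alpha>)) has_sum (z $ j) *\<^sub>C (fst (V (X, h2_eval f z)) $ j)) (range (up j))"
      by (subst has_sum_reindex[OF inj_up]) (simp add: o_def)
    also have "?this \<longleftrightarrow> ?thesis"
    proof (rule has_sum_cong_neutral)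
      fix \<alpha> assume "\<alpha> \<in> UNIV - range (up j)"
      then have "\<not> \<alpha> j > 0" by (metis DiffD2 rangeI up_dn)
      then show "(if \<alpha> j > 0 then monom z \<alpha> *\<^sub>C w j (dn j \<alpha>) else 0) = 0" by simp
    qed auto
    finally show ?thesis .
  qed
  have "((\<lambda>\<alpha>. \<Sum>j\<in>UNIV. if \<alpha> j > 0 then monom z \<alpha> *\<^sub>C w j (dn j \<alpha>) else 0) has_sum
      (\<Sum>j\<in>UNIV. (z $ j) *\<^sub>C (fst (V (X, h2_eval f z)) $ j))) UNIV"
    by (rule has_sum_sum) (rule trm)
  moreover have "(\<Sum>j\<in>UNIV. if \<alpha> j > 0 then monom z \<alpha> *\<^sub>C w j (dn j \<alpha>) else 0) = monom z \<alpha> *\<^sub>C x \<alpha>" for \<alpha>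
  proof -
    have "x \<alpha> = (\<Sum>j | \<alpha> j > 0. w j (dn j \<alpha>))"
      unfolding w_def by (rule trajD(1)[OF traj])
    then show ?thesis by (simp add: scaleC_sum_right sum.If_cases)
  qed
  ultimately have "X = (\<Sum>j\<in>UNIV. (z $ j) *\<^sub>C (fst (V (X, h2_eval f z)) $ j))"
    using has_sum_unique[OF X] by simp
  moreover have "h2_eval (Abs_h2 y) z = snd (V (X, h2_eval f z))"
  proof -
    have "((\<lambda>\<alpha>. monom z \<alpha> *\<^sub>C y \<alpha>) has_sum snd (V (X, h2_eval f z))) UNIV"
      using img[OF bop_compose[OF bop_snd bV]] by (simp add: trajD(2)[OF traj])
    then show ?thesis
      by (simp add: h2_eval_eq coeff_Abs_h2[OF traj_h2(1)[OF traj V]] infsumI)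
  qed
  ultimately show ?thesis using that by blast
qed

text \<open>The transfer function is described without inverting anything: any state that solves the
  fixed-point equation at z yields the value. The trajectory supplies such a state for every input
  that is a value of an element of the space.\<close>

definition realizes ::
  "('h::chilbert_space \<times> 'e::chilbert_space \<Rightarrow> ('h ^ 'n::finite) \<times> 'f::chilbert_space) \<Rightarrow>
   (complex ^ 'n \<Rightarrow> 'e \<Rightarrow> 'f) \<Rightarrow> bool" where
  "realizes V \<Phi> \<longleftrightarrow> bop V \<and> (\<forall>p. norm (V p) \<le> norm p) \<and>
     (\<forall>z x e. norm z < 1 \<longrightarrow> x = (\<Sum>j\<in>UNIV. (z $ j) *\<^sub>C (fst (V (x, e)) $ j)) \<longrightarrow> \<Phi> z e = snd (V (x, e)))"

lemma mult_op_transfer: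
  fixes V :: "'h::chilbert_space \<times> 'e::chilbert_space \<Rightarrow> ('h ^ 'n::finite) \<times> 'f::chilbert_space"
  assumes "realizes V \<Phi>"
  shows "\<exists>x. traj V (coeff f) x (coeff (mult_op \<Phi> f))" and "norm (mult_op \<Phi> f) \<le> norm f"
proof -
  have bV: "bop V" and V: "\<And>p. norm (V p) \<le> norm p"
    using assms by (auto simp: realizes_def)
  obtain x y where t: "traj V (coeff f) x y" using traj_exists by blast
  have "mult_op \<Phi> f = Abs_h2 y"
  proof (rule mult_op_eqI)
    fix z :: "complex ^ 'n" assume z: "norm z < 1"
    obtain X where "X = (\<Sum>j\<in>UNIV. (z $ j) *\<^sub>C (fst (V (X, h2_eval f z)) $ j))"
      "h2_eval (Abs_h2 y) z = snd (V (X, h2_eval f z))"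
      using traj_eval[OF t bV V z] .
    then show "h2_eval (Abs_h2 y) z = \<Phi> z (h2_eval f z)" using assms z unfolding realizes_def by metis
  qed
  then show "\<exists>x. traj V (coeff f) x (coeff (mult_op \<Phi> f))" "norm (mult_op \<Phi> f) \<le> norm f"
    using t traj_h2(2)[OF t V] coeff_Abs_h2[OF traj_h2(1)[OF t V]] by auto
qed

lemma traj_add:
  assumes bV: "bop V" and "traj V a x y" "traj V a' x' y'"
  shows "traj V (\<lambda>\<alpha>. a \<alpha> + a' \<alpha>) (\<lambda>\<alpha>. x \<alpha> + x' \<alpha>) (\<lambda>\<alpha>. y \<alpha> + y' \<alpha>)"
proof -
  have V: "V (h + h', e + e') = V (h, e) + V (h', e')" for h h' e e'
    using bop_add[OF bV, of "(h, e)" "(h', e')"] by simp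
  note t = trajD[OF assms(2)] trajD[OF assms(3)]
  show ?thesis
  proof (rule trajI)
    show "x \<alpha> + x' \<alpha> = (\<Sum>j | \<alpha> j > 0. fst (V (x (dn j \<alpha>) + x' (dn j \<alpha>), a (dn j \<alpha>) + a' (dn j \<alpha>))) $ j)" for \<alpha>
      by (subst t(1), subst t(3)) (simp add: V sum.distrib)
  qed (simp add: V t(2,4))
qed

lemma traj_scaleC:
  assumes bV: "bop V" and "traj V a x y"
  shows "traj V (\<lambda>\<alpha>. c *\<^sub>C a \<alpha>) (\<lambda>\<alpha>. c *\<^sub>C x \<alpha>) (\<lambda>\<alpha>. c *\<^sub>C y \<alpha>)"
proof -
  have V: "V (c *\<^sub>C h, c *\<^sub>C e) = c *\<^sub>C V (h, e)" for h e
    using bop_scaleC[OF bV, of c "(h, e)"] by (simp add: scaleC_prod_def)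
  note t = trajD[OF assms(2)]
  show ?thesis
  proof (rule trajI)
    show "c *\<^sub>C x \<alpha> = (\<Sum>j | \<alpha> j > 0. fst (V (c *\<^sub>C x (dn j \<alpha>), c *\<^sub>C a (dn j \<alpha>))) $ j)" for \<alpha>
      by (subst t(1)) (simp add: V scaleC_prod_def scaleC_vec_def scaleC_sum_right)
  qed (simp add: V t(2) scaleC_prod_def)
qed

lemma bop_mult_op_transfer:
  fixes V :: "'h::chilbert_space \<times> 'e::chilbert_space \<Rightarrow> ('h ^ 'n::finite) \<times> 'f::chilbert_space"
  assumes "realizes V \<Phi>"
  shows "bop (mult_op \<Phi>)"
  unfolding bounded_op_def
proof (intro conjI ballI allI)
  note m = mult_op_transfer[OF assms]
  have bV: "bop V" using assms by (simp add: realizes_def)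
  fix f g :: "('n, 'e) h2" and c
  obtain x1 where t1: "traj V (coeff f) x1 (coeff (mult_op \<Phi> f))" using m(1) by blast
  obtain x2 where t2: "traj V (coeff g) x2 (coeff (mult_op \<Phi> g))" using m(1) by blast
  obtain x3 where t3: "traj V (coeff (f + g)) x3 (coeff (mult_op \<Phi> (f + g)))" using m(1) by blast
  obtain x4 where t4: "traj V (coeff (c *\<^sub>C f)) x4 (coeff (mult_op \<Phi> (c *\<^sub>C f)))" using m(1) by blast
  have eq: "coeff (f + g) = (\<lambda>\<alpha>. coeff f \<alpha> + coeff g \<alpha>)" "coeff (c *\<^sub>C f) = (\<lambda>\<alpha>. c *\<^sub>C coeff f \<alpha>)"
    by (auto simp: coeff_simps coeff_scaleC)
  show "mult_op \<Phi> (f + g) = mult_op \<Phi> f + mult_op \<Phi> g"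
    using traj_unique(2)[OF t3[unfolded eq] traj_add[OF bV t1 t2]]
    by (intro h2_eqI) (simp add: coeff_simps)
  show "mult_op \<Phi> (c *\<^sub>C f) = c *\<^sub>C mult_op \<Phi> f"
    using traj_unique(2)[OF t4[unfolded eq] traj_scaleC[OF bV t1]]
    by (intro h2_eqI) (simp add: coeff_scaleC)
  show "\<exists>K. \<forall>f\<in>UNIV. norm (mult_op \<Phi> f) \<le> K * norm f"
    using m(2) by (intro exI[of _ 1]) simp
qed auto


section \<open>Operators on vector-valued Drury-Arveson spaces\<close>

lemma bop_coeff: "bop (\<lambda>f. coeff f \<alpha>)"
  unfolding bounded_op_def
  by (auto simp: coeff_simps coeff_scaleC intro: norm_coeff_le)

lemma closed_csubspace_h2_space:
  assumes E: "closed_csubspace (E :: 'a::chilbert_space set)"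
  shows "closed_csubspace (h2_space E :: ('n::finite, 'a) h2 set)"
proof -
  have "closed ((\<lambda>f :: ('n, 'a) h2. coeff f \<alpha>) -` E)" for \<alpha>
    by (rule continuous_closed_vimage[OF closed_csubspaceD(1)[OF E]])
      (rule linear_continuous_at[OF bop_bounded_linear[OF bop_coeff]])
  moreover have "(h2_space E :: ('n, 'a) h2 set) = (\<Inter>\<alpha>. (\<lambda>f. coeff f \<alpha>) -` E)" by (auto simp: h2_space_def)
  ultimately have "closed (h2_space E :: ('n, 'a) h2 set)" by (simp add: closed_INT)
  then show ?thesis
    using E by (auto simp: closed_csubspace_def h2_space_def coeff_simps coeff_scaleC)
qed

lemma norm_h2_sq: "(norm f)\<^sup>2 = (\<Sum>\<^sub>\<infinity>\<alpha>. (norm (coeff f \<alpha>))\<^sup>2 / multinom \<alpha>)"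
  unfolding norm_h2_def
  by (subst real_sqrt_pow2) (auto intro!: infsum_nonneg simp: less_imp_le multinom_pos)

lemma bounded_op_bound:
  assumes "bounded_op E F W"
  obtains K where "K \<ge> 0" "\<And>x. x \<in> E \<Longrightarrow> norm (W x) \<le> K * norm x"
proof -
  obtain K where "\<And>x. x \<in> E \<Longrightarrow> norm (W x) \<le> K * norm x"
    using assms unfolding bounded_op_def by blast
  moreover have "K * norm x \<le> \<bar>K\<bar> * norm x" for x :: 'a by (intro mult_right_mono) auto
  ultimately show ?thesis using that[of "\<bar>K\<bar>"] order_trans by fastforce
qed

text \<open>\<open>ampliation\<close> is built with \<open>Abs_h2\<close>, so its coefficients can
  be read off only after boundedness of W has given summability.\<close>

lemma coeff_ampliation:
  assumes W: "bounded_op E F W" and f: "f \<in> h2_space E"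
  shows "coeff (ampliation W f) \<alpha> = W (coeff f \<alpha>)"
proof -
  obtain K where K: "K \<ge> 0" "\<And>x. x \<in> E \<Longrightarrow> norm (W x) \<le> K * norm x"
    using bounded_op_bound[OF W] by blast
  have "(\<lambda>\<alpha>. (norm (W (coeff f \<alpha>)))\<^sup>2 / multinom \<alpha>) summable_on UNIV"
  proof (rule summable_on_comparison_test)
    show "(\<lambda>\<alpha>. K\<^sup>2 * ((norm (coeff f \<alpha>))\<^sup>2 / multinom \<alpha>)) summable_on UNIV"
      by (intro summable_on_cmult_right coeff_summable)
    have "(norm (W (coeff f \<alpha>)))\<^sup>2 \<le> (K * norm (coeff f \<alpha>))\<^sup>2" for \<alpha>
      using K f by (intro power_mono) (auto simp: h2_space_def)
    then show "(norm (W (coeff f \<alpha>)))\<^sup>2 / multinom \<alpha> \<le> K\<^sup>2 * ((norm (coeff f \<alpha>))\<^sup>2 / multinom \<alpha>)" for \<alpha>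
      using multinom_pos[of \<alpha>] by (simp add: power_mult_distrib divide_right_mono)
  qed (simp add: less_imp_le multinom_pos)
  then show ?thesis by (simp add: ampliation_def coeff_Abs_h2)
qed

lemma norm_ampliation_le:
  assumes W: "bounded_op E F W" and f: "f \<in> h2_space E"
    and K: "K \<ge> 0" "\<And>x. x \<in> E \<Longrightarrow> norm (W x) \<le> K * norm x"
  shows "norm (ampliation W f) \<le> K * norm f"
proof (rule power2_le_imp_le)
  have "(norm (ampliation W f))\<^sup>2 \<le> (\<Sum>\<^sub>\<infinity>\<alpha>. K\<^sup>2 * ((norm (coeff f \<alpha>))\<^sup>2 / multinom \<alpha>))"
    unfolding norm_h2_sq
  proof (rule infsum_mono[OF coeff_summable])
    show "(\<lambda>\<alpha>. K\<^sup>2 * ((norm (coeff f \<alpha>))\<^sup>2 / multinom \<alpha>)) summable_on UNIV"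
      by (intro summable_on_cmult_right coeff_summable)
    have "(norm (W (coeff f \<alpha>)))\<^sup>2 \<le> (K * norm (coeff f \<alpha>))\<^sup>2" for \<alpha>
      using K f by (intro power_mono) (auto simp: h2_space_def)
    then show "(norm (coeff (ampliation W f) \<alpha>))\<^sup>2 / multinom \<alpha> \<le> K\<^sup>2 * ((norm (coeff f \<alpha>))\<^sup>2 / multinom \<alpha>)" for \<alpha>
      using multinom_pos[of \<alpha>]
      by (simp add: power_mult_distrib divide_right_mono coeff_ampliation[OF W f])
  qed
  also have "\<dots> = (K * norm f)\<^sup>2"
    by (simp only: infsum_cmult_right' norm_h2_sq power_mult_distrib)
  finally show "(norm (ampliation W f))\<^sup>2 \<le> (K * norm f)\<^sup>2" .
qed (use K in auto)

lemma h2_spaceD: "f \<in> h2_space E \<Longrightarrow> coeff f \<alpha> \<in> E"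
  by (simp add: h2_space_def)

lemma h2_space_UNIV [simp]: "h2_space UNIV = UNIV"
  by (simp add: h2_space_def)

lemma bounded_opD:
  assumes "bounded_op E F W"
  shows "\<And>x. x \<in> E \<Longrightarrow> W x \<in> F" "\<And>x y. x \<in> E \<Longrightarrow> y \<in> E \<Longrightarrow> W (x + y) = W x + W y"
    "\<And>c x. x \<in> E \<Longrightarrow> W (c *\<^sub>C x) = c *\<^sub>C W x"
  using assms by (auto simp: bounded_op_def)

lemma bounded_op_ampliation:
  assumes E: "closed_csubspace E" and W: "bounded_op E F W"
  shows "bounded_op (h2_space E :: ('n::finite, 'a::chilbert_space) h2 set) (h2_space F) (ampliation W)"
proof -
  note WD = bounded_opD[OF W] and c = coeff_ampliation[OF W]
  note H = closed_csubspaceD[OF closed_csubspace_h2_space[OF E]]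
  obtain K where K: "K \<ge> 0" "\<And>x. x \<in> E \<Longrightarrow> norm (W x) \<le> K * norm x"
    using bounded_op_bound[OF W] by blast
  show ?thesis
    unfolding bounded_op_def
  proof (intro conjI ballI allI)
    fix f g :: "('n, 'a) h2" assume f: "f \<in> h2_space E" and g: "g \<in> h2_space E"
    show "ampliation W (f + g) = ampliation W f + ampliation W g"
      by (rule h2_eqI) (simp add: c f g H(3) coeff_simps WD(2) h2_spaceD[OF f] h2_spaceD[OF g])
  next
    fix f :: "('n, 'a) h2" and c' assume f: "f \<in> h2_space E"
    show "ampliation W (c' *\<^sub>C f) = c' *\<^sub>C ampliation W f"
      by (rule h2_eqI) (simp add: c f H(4) coeff_scaleC WD(3) h2_spaceD[OF f])
    show "ampliation W f \<in> h2_space F"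
      using WD(1) h2_spaceD[OF f] by (simp add: h2_space_def c f)
  next
    show "\<exists>K. \<forall>f\<in>h2_space E. norm (ampliation W f) \<le> K * norm f"
      using norm_ampliation_le[OF W _ K] by blast
  qed
qed

lemma coeff_block_diag:
  "coeff (block_diag A B f) \<alpha> = (coeff (A (ampliation fst f)) \<alpha>, coeff (B (ampliation snd f)) \<alpha>)"
proof -
  let ?a = "coeff (A (ampliation fst f))" and ?b = "coeff (B (ampliation snd f))"
  have "(\<lambda>\<alpha>. (norm (?a \<alpha>, ?b \<alpha>))\<^sup>2 / multinom \<alpha>) summable_on UNIV"
    using summable_on_add[OF coeff_summable coeff_summable, of "A (ampliation fst f)" "B (ampliation snd f)"]
    by (simp add: norm_prod_sq add_divide_distrib)
  then show ?thesis by (simp add: block_diag_def coeff_Abs_h2)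
qed

lemma coeff_ampliation_bop: "bop W \<Longrightarrow> coeff (ampliation W f) \<alpha> = W (coeff f \<alpha>)"
  by (rule coeff_ampliation[of UNIV UNIV]) auto

lemma cinner_h2_ampliation:
  assumes W: "bounded_op E F W" and W': "bounded_op F E W'" and f: "f \<in> h2_space E" and g: "g \<in> h2_space F"
    and eq: "\<And>x y. x \<in> E \<Longrightarrow> y \<in> F \<Longrightarrow> cinner (W x) y = cinner x (W' y)"
  shows "cinner (ampliation W f) g = cinner f (ampliation W' g)"
  unfolding cinner_h2_def
  by (intro infsum_cong) (simp add: coeff_ampliation[OF W f] coeff_ampliation[OF W' g] eq h2_spaceD[OF f] h2_spaceD[OF g])

text \<open>Multiplication by z_i is a one-step delay: the state stores the previous input of
  direction i, and the output is the state. The trajectory equations then give the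
  coefficients.\<close>

lemma realizes_coord_mult:
  "realizes (\<lambda>p :: 'a::chilbert_space \<times> 'a. (axis i (snd p) :: 'a ^ 'n::finite, fst p)) (\<lambda>z x. (z $ i) *\<^sub>C x)"
proof -
  have ax: "axis i x = (\<chi> j. if j = i then x else 0)" for x :: 'a by (simp add: axis_def)
  have "bop (\<lambda>p :: 'a \<times> 'a. (axis i (snd p) :: 'a ^ 'n, fst p))"
    unfolding ax
  proof (intro bop_intros)
    show "bop (\<lambda>x::'a \<times> 'a. if j = i then snd x else 0)" for j
      by (cases "j = i") (simp_all add: bop_snd bop_const_0)
  qed
  moreover have "norm (axis i (snd p) :: 'a ^ 'n, fst p) = norm p" for p :: "'a \<times> 'a"
  proof (rule power2_eq_imp_eq)
    show "(norm (axis i (snd p) :: 'a ^ 'n, fst p))\<^sup>2 = (norm p)\<^sup>2"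
      by (simp add: norm_prod_sq norm_vec_sq ax if_distrib[where f = "\<lambda>v. (norm v)\<^sup>2"] cong: if_cong)
  qed auto
  ultimately show ?thesis
    by (simp add: realizes_def ax if_distrib[where f = "\<lambda>v. _ *\<^sub>C v"] cong: if_cong)
qed

lemma coeff_coord_mult:
  fixes f :: "('n::finite, 'a::chilbert_space) h2"
  shows "coeff (coord_mult i f) \<alpha> = (if \<alpha> i > 0 then coeff f (dn i \<alpha>) else 0)"
proof -
  obtain x where x: "traj (\<lambda>p. (axis i (snd p) :: 'a ^ 'n, fst p)) (coeff f) x (coeff (coord_mult i f))"
    using mult_op_transfer(1)[OF realizes_coord_mult] by blast
  have "coeff (coord_mult i f) \<alpha> = x \<alpha>" using trajD(2)[OF x] by simp
  also have "\<dots> = (\<Sum>j | \<alpha> j > 0. if j = i then coeff f (dn j \<alpha>) else 0)"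
    by (subst trajD(1)[OF x]) (auto simp: axis_def intro!: sum.cong)
  finally show ?thesis by simp
qed


section \<open>Characteristic functions as transfer functions\<close>

text \<open>The first component is the next state, the second the output. The entry from input to
  output is -T, which is the value of \<theta>_T at 0.\<close>

definition halmos :: "('n::finite \<Rightarrow> 'h::chilbert_space \<Rightarrow> 'h) \<Rightarrow> 'h \<times> ('h ^ 'n) \<Rightarrow> ('h ^ 'n) \<times> 'h" where
  "halmos T p = (adj (row T) (fst p) + defect T (snd p), defect_star T (fst p) - row T (snd p))"

lemma norm_sum_scaleC_le:
  "norm (\<Sum>i\<in>UNIV. (z $ i) *\<^sub>C (v $ i)) \<le> norm z * norm (v :: 'a::chilbert_space ^ 'n::finite)"
proof (rule power2_le_imp_le)
  have "(norm (\<Sum>i\<in>UNIV. (z $ i) *\<^sub>C (v $ i)))\<^sup>2 \<le> (\<Sum>i\<in>UNIV. cmod (z $ i) * norm (v $ i))\<^sup>2"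
    by (intro power_mono sum_norm_le) (auto simp: norm_scaleC)
  also have "\<dots> \<le> (\<Sum>i\<in>UNIV. (cmod (z $ i))\<^sup>2) * (\<Sum>i\<in>UNIV. (norm (v $ i))\<^sup>2)"
    by (rule Cauchy_Schwarz_ineq_sum)
  finally show "(norm (\<Sum>i\<in>UNIV. (z $ i) *\<^sub>C (v $ i)))\<^sup>2 \<le> (norm z * norm v)\<^sup>2"
    by (simp add: norm_cvec_sq norm_vec_sq power_mult_distrib)
qed simp

context row_contraction
begin

lemma bop_halmos: "bop (halmos T)"
  unfolding halmos_def[abs_def]
  by (intro bop_intros bop_compose[OF bop_adj_rowT] bop_compose[OF bop_defect]
      bop_compose[OF bop_defect_star] bop_compose[OF bop_rowT])

lemma norm_halmos: "norm (halmos T p) = norm p"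
proof (rule power2_eq_imp_eq)
  have "inner (adj (row T) (fst p)) (defect T (snd p)) = inner (defect_star T (fst p)) (row T (snd p))"
    by (simp add: inner_adj_rowT' row_defect inner_defect_star)
  then have "(norm (halmos T p))\<^sup>2 =
      (norm (adj (row T) (fst p)))\<^sup>2 + (norm (defect T (snd p)))\<^sup>2 +
      (norm (defect_star T (fst p)))\<^sup>2 + (norm (row T (snd p)))\<^sup>2"
    by (simp add: halmos_def norm_prod_sq power2_norm_eq_inner inner_add_left inner_add_right
        inner_diff_left inner_diff_right inner_commute)
  then show "(norm (halmos T p))\<^sup>2 = (norm p)\<^sup>2"
    by (simp add: norm_defect norm_defect_star norm_prod_sq)
qed auto

lemma halmos_inverse:
  "halmos T (row T k + defect_star T f, defect T k - adj (row T) f) = (k, f)"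
  by (simp add: halmos_def bop_add[OF bop_adj_rowT] bop_diff[OF bop_defect] bop_add[OF bop_defect_star]
      bop_diff[OF bop_rowT] defect_defect defect_star_defect_star row_defect adj_row_defect_star)

lemma row_defect_space:
  assumes e: "e \<in> defect_space T" shows "row T e \<in> defect_star_space T"
proof -
  have "row T ` closure (range (defect T)) \<subseteq> closure (row T ` range (defect T))"
    by (rule closure_bounded_linear_image_subset[OF bop_bounded_linear[OF bop_rowT]])
  also have "\<dots> \<subseteq> closure (range (defect_star T))"
    by (rule closure_mono) (auto simp: row_defect)
  finally show ?thesis using e by (auto simp: defect_space_def defect_star_space_def)
qed

lemma adj_row_defect_star_space:
  assumes e: "e \<in> defect_star_space T" shows "adj (row T) e \<in> defect_space T"
proof -
  have "adj (row T) ` closure (range (defect_star T)) \<subseteq> closure (adj (row T) ` range (defect_star T))"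
    by (rule closure_bounded_linear_image_subset[OF bop_bounded_linear[OF bop_adj_rowT]])
  also have "\<dots> \<subseteq> closure (range (defect T))"
    by (rule closure_mono) (auto simp: adj_row_defect_star)
  finally show ?thesis using e by (auto simp: defect_space_def defect_star_space_def)
qed

lemma defect_in: "defect T x \<in> defect_space T" and defect_star_in: "defect_star T h \<in> defect_star_space T"
  unfolding defect_space_def defect_star_space_def by (rule closure_subset[THEN subsetD], rule rangeI)+

text \<open>The row maps one defect space into the other and its adjoint maps back, so both
  formulas, for \<open>halmos T\<close> and for its adjoint, respect the defect spaces. The Halmos
  operator thus restricts to the unitary colligation with inputs and outputs in these
  spaces.\<close>

lemma halmos_image: "halmos T ` (UNIV \<times> defect_space T) = UNIV \<times> defect_star_space T"
proof (intro equalityI subsetI)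
  fix p assume "p \<in> halmos T ` (UNIV \<times> defect_space T)"
  then show "p \<in> UNIV \<times> defect_star_space T"
    using closed_csubspaceD(5)[OF closed_csubspace_defect_star_space defect_star_in row_defect_space]
    by (auto simp: halmos_def)
next
  fix p :: "('h ^ 'n) \<times> 'h" assume p: "p \<in> UNIV \<times> defect_star_space T"
  have "defect T (fst p) - adj (row T) (snd p) \<in> defect_space T"
    using closed_csubspaceD(5)[OF closed_csubspace_defect_space defect_in adj_row_defect_star_space] p
    by auto
  then show "p \<in> halmos T ` (UNIV \<times> defect_space T)"
    using halmos_inverse[of "fst p" "snd p"]
    by (intro image_eqI[of _ _ "(row T (fst p) + defect_star T (snd p), defect T (fst p) - adj (row T) (snd p))"]) auto
qed

text \<open>\<open>char_fun\<close> uses \<open>inv\<close>, which merely selects a preimage. The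
  state of the trajectory is one, so injectivity identifies the selected preimage with it.\<close>

lemma resolvent_inj:
  assumes z: "norm z < 1"
  shows "inj (\<lambda>h. h - (\<Sum>i\<in>UNIV. (z $ i) *\<^sub>C adj (T i) h))"
proof (rule injI)
  fix h k assume eq: "h - (\<Sum>i\<in>UNIV. (z $ i) *\<^sub>C adj (T i) h) = k - (\<Sum>i\<in>UNIV. (z $ i) *\<^sub>C adj (T i) k)"
  have "h - k = (\<Sum>i\<in>UNIV. (z $ i) *\<^sub>C (adj (row T) (h - k) $ i))"
    using eq by (simp add: adj_row[OF bop_T] bop_diff[OF bop_adj[OF bop_T]] scaleC_diff_right
        sum_subtractf algebra_simps)
  then have "norm (h - k) \<le> norm z * norm (adj (row T) (h - k))"
    using norm_sum_scaleC_le[of z "adj (row T) (h - k)"] by simp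
  also have "\<dots> \<le> norm z * norm (h - k)"
    by (intro mult_left_mono norm_adj_rowT) auto
  finally have "(1 - norm z) * norm (h - k) \<le> 0" by (simp add: algebra_simps)
  then have "norm (h - k) \<le> 0" using z by (simp add: mult_le_0_iff)
  then show "h = k" by simp
qed

lemma char_fun_eq:
  assumes z: "norm z < 1"
    and x: "x - (\<Sum>i\<in>UNIV. (z $ i) *\<^sub>C adj (T i) x) = (\<Sum>i\<in>UNIV. (z $ i) *\<^sub>C (defect T e $ i))"
  shows "char_fun T z e = defect_star T x - row T e"
proof -
  have "inv (\<lambda>h. h - (\<Sum>i\<in>UNIV. (z $ i) *\<^sub>C adj (T i) h)) (row (\<lambda>i h. (z $ i) *\<^sub>C h) (defect T e)) = x"
    using inv_f_f[OF resolvent_inj[OF z], of x] by (simp add: x row_def)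
  then show ?thesis by (simp add: char_fun_def)
qed

lemma realizes_halmos: "realizes (halmos T) (char_fun T)"
  unfolding realizes_def
proof (intro conjI allI impI bop_halmos)
  show "norm (halmos T p) \<le> norm p" for p by (simp add: norm_halmos)
  fix z :: "complex ^ 'n" and x e
  assume z: "norm z < 1" and x: "x = (\<Sum>j\<in>UNIV. (z $ j) *\<^sub>C (fst (halmos T (x, e)) $ j))"
  have "x - (\<Sum>i\<in>UNIV. (z $ i) *\<^sub>C adj (T i) x) = (\<Sum>i\<in>UNIV. (z $ i) *\<^sub>C (defect T e $ i))"
    by (subst (1) x) (simp add: halmos_def adj_row[OF bop_T] scaleC_add_right sum.distrib)
  from char_fun_eq[OF z this] show "char_fun T z e = snd (halmos T (x, e))"
    by (simp add: halmos_def)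
qed

lemma char_op_traj: "\<exists>x. traj (halmos T) (coeff f) x (coeff (char_op T f))"
  by (rule mult_op_transfer(1)[OF realizes_halmos])

lemma bop_char_op: "bop (char_op T)"
  by (rule bop_mult_op_transfer[OF realizes_halmos])

lemma char_op_in:
  assumes f: "f \<in> h2_space (defect_space T)"
  shows "char_op T f \<in> h2_space (defect_star_space T)"
proof -
  obtain x where x: "traj (halmos T) (coeff f) x (coeff (char_op T f))" using char_op_traj by blast
  have "coeff (char_op T f) \<alpha> = snd (halmos T (x \<alpha>, coeff f \<alpha>))" for \<alpha> by (rule trajD(2)[OF x])
  moreover have "halmos T (x \<alpha>, coeff f \<alpha>) \<in> UNIV \<times> defect_star_space T" for \<alpha>
    unfolding halmos_image[symmetric] using h2_spaceD[OF f] by blast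
  ultimately show ?thesis unfolding h2_space_def by (auto simp: mem_Times_iff)
qed

lemma bounded_op_char_op: "bounded_op (h2_space (defect_space T)) (h2_space (defect_star_space T)) (char_op T)"
  using bop_char_op char_op_in by (auto simp: bounded_op_def)

end


section \<open>Unitary colligations with prescribed main operator\<close>

lemma hilbert_iso_orthogonal_sum:
  assumes E: "closed_csubspace E" and M: "M \<subseteq> E"
    and P: "bop P" "\<And>x. P x \<in> M" "\<And>x. x \<in> M \<Longrightarrow> P x = x" "\<And>x m. m \<in> M \<Longrightarrow> inner (x - P x) m = 0"
    and W: "hilbert_iso M A W" and K: "hilbert_iso {x\<in>E. \<forall>m\<in>M. inner x m = 0} B K"
  shows "hilbert_iso E (A \<times> B) (\<lambda>x. (W (P x), K (x - P x)))"
proof -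
  note ED = closed_csubspaceD[OF E] and WD = hilbert_isoD[OF W] and KD = hilbert_isoD[OF K]
  have c: "x - P x \<in> {x\<in>E. \<forall>m\<in>M. inner x m = 0}" if "x \<in> E" for x
    using ED(5)[OF that subsetD[OF M P(2)]] P(4) by blast
  show ?thesis
    unfolding hilbert_iso_def
  proof (intro conjI ballI allI E)
    fix x y assume x: "x \<in> E" and y: "y \<in> E"
    have "x + y - P (x + y) = (x - P x) + (y - P y)" by (simp add: bop_add[OF P(1)])
    then show "(W (P (x + y)), K (x + y - P (x + y))) = (W (P x), K (x - P x)) + (W (P y), K (y - P y))"
      by (simp only: KD(3)[OF c[OF x] c[OF y]] add_Pair bop_add[OF P(1)] WD(3)[OF P(2) P(2)])
  next
    fix x a assume x: "x \<in> E"
    have "a *\<^sub>C x - P (a *\<^sub>C x) = a *\<^sub>C (x - P x)" by (simp add: bop_scaleC[OF P(1)] scaleC_diff_right)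
    then show "(W (P (a *\<^sub>C x)), K (a *\<^sub>C x - P (a *\<^sub>C x))) = a *\<^sub>C (W (P x), K (x - P x))"
      by (simp only: KD(4)[OF c[OF x]] bop_scaleC[OF P(1)] WD(4)[OF P(2)] scaleC_prod_def fst_conv snd_conv)
  next
    fix x assume x: "x \<in> E"
    show "norm (W (P x), K (x - P x)) = norm x"
    proof (rule power2_eq_imp_eq)
      have "inner (x - P x) (P x) = 0" using P by blast
      then have "(norm (P x))\<^sup>2 + (norm (x - P x))\<^sup>2 = (norm x)\<^sup>2"
        by (simp add: power2_norm_eq_inner inner_diff_left inner_diff_right inner_commute)
      then show "(norm (W (P x), K (x - P x)))\<^sup>2 = (norm x)\<^sup>2"
        by (simp add: norm_prod_sq WD(5)[OF P(2)] KD(5)[OF c[OF x]])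
    qed auto
  next
    show "(\<lambda>x. (W (P x), K (x - P x))) ` E = A \<times> B"
    proof (intro equalityI subsetI)
      fix p assume "p \<in> (\<lambda>x. (W (P x), K (x - P x))) ` E"
      then show "p \<in> A \<times> B" using WD(6)[OF P(2)] KD(6)[OF c] by auto
    next
      fix p assume "p \<in> A \<times> B"
      then obtain m r where p: "p = (W m, K r)" and m: "m \<in> M" and r: "r \<in> E" "\<And>m. m \<in> M \<Longrightarrow> inner r m = 0"
        using WD(2) KD(2) by (auto 0 3)
      have "inner (r - P r) (P r) = 0" "inner r (P r) = 0" using P r(2) by auto
      then have "P r = 0" by (simp add: inner_diff_left)
      then have "P (m + r) = m" by (simp add: bop_add[OF P(1)] P(3)[OF m])
      moreover have "m + r \<in> E" using ED(3) M m r(1) by blast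
      ultimately show "p \<in> (\<lambda>x. (W (P x), K (x - P x))) ` E"
        by (intro image_eqI[of _ _ "m + r"]) (auto simp: p)
    qed
  qed
qed

lemma bop_eq_on_closure_range:
  assumes "bop X" "bop Y" "\<And>k. X (A k) = Y (A k)" "m \<in> closure (range A)"
  shows "X m = Y m"
proof -
  have "closed {m. X m = Y m}"
    by (intro closed_Collect_eq linear_continuous_on bop_bounded_linear assms)
  then have "closure (range A) \<subseteq> {m. X m = Y m}"
    using assms(3) by (intro closure_minimal) auto
  then show ?thesis using assms(4) by blast
qed

text \<open>W is meaningful only on M. Precomposed with the projection it becomes an operator on the
  whole space, to which density arguments for total operators apply.\<close>

lemma bop_hilbert_iso_projection:
  assumes P: "bop P" "\<And>x. P x \<in> M" "\<And>x. norm (P x) \<le> norm x" and W: "hilbert_iso M A W"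
  shows "bop (\<lambda>x. W (P x))"
  unfolding bounded_op_def
  by (auto simp: bop_add[OF P(1)] bop_scaleC[OF P(1)] hilbert_isoD(3-5)[OF W] P intro!: exI[of _ 1])

text \<open>A unitary colligation \<open>V\<close> with main operator \<open>S\<^sup>*\<close> is the Halmos colligation of \<open>S\<close> up to a
  direct summand that acts as a unitary from the kernel of its input operator onto the cokernel of
  its output operator. The operator \<open>B\<close> in the proof is the adjoint of the input operator: it is read
  off from \<open>V(row S k, B k) = (k, 0)\<close>.\<close>

lemma unitary_colligation:
  fixes V :: "'h::chilbert_space \<times> 'e::chilbert_space \<Rightarrow> ('h ^ 'n::finite) \<times> 'f::chilbert_space"
    and \<kappa> :: "'e \<Rightarrow> 'k::chilbert_space"
  assumes S: "commuting_row_contraction S" and bV: "bop V"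
    and E: "closed_csubspace E" and F: "closed_csubspace F"
    and nV: "\<And>h e. e \<in> E \<Longrightarrow> norm (V (h, e)) = norm (h, e)"
    and iV: "V ` (UNIV \<times> E) = UNIV \<times> F"
    and main: "\<And>h. fst (V (h, 0)) = adj (row S) h"
    and \<kappa>: "hilbert_iso {e\<in>E. fst (V (0, e)) = 0} K \<kappa>"
  obtains \<tau> \<tau>' where "hilbert_iso E (defect_space S \<times> K) \<tau>" "hilbert_iso F (defect_star_space S \<times> K) \<tau>'"
    "\<And>h e. e \<in> E \<Longrightarrow> halmos S (h, fst (\<tau> e)) = (fst (V (h, e)), fst (\<tau>' (snd (V (h, e)))))"
    "\<And>h e. e \<in> E \<Longrightarrow> snd (\<tau>' (snd (V (h, e)))) = snd (\<tau> e)"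
proof -
  interpret row_contraction S by unfold_locales (rule S)
  note ED = closed_csubspaceD[OF E] and FD = closed_csubspaceD[OF F]
  have U: "hilbert_iso (UNIV \<times> E) (UNIV \<times> F) V"
    unfolding hilbert_iso_def
    using closed_csubspace_Times[OF closed_csubspace_UNIV E] iV nV bop_add[OF bV] bop_scaleC[OF bV] by auto
  have innerV: "inner (V (h, e)) (V (h', e')) = inner h h' + inner e e'" if "e \<in> E" "e' \<in> E" for h h' e e'
    using hilbert_iso_inner[OF U, of "(h, e)" "(h', e')"] that by simp
  define Vi where "Vi = inv_into (UNIV \<times> E) V"
  have Vi: "hilbert_iso (UNIV \<times> F) (UNIV \<times> E) Vi" unfolding Vi_def by (rule hilbert_iso_inv[OF U])
  have VVi: "V (Vi (k, f)) = (k, f)" and ViE: "snd (Vi (k, f)) \<in> E" if "f \<in> F" for k f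
    using that hilbert_iso_inv_into(2)[OF U] hilbert_isoD(6)[OF Vi, of "(k, f)"]
    by (auto simp: Vi_def mem_Times_iff)
  have Vadd: "V (h, e) = V (h, 0) + V (0, e)" for h e
    using bop_add[OF bV, of "(h, 0)" "(0, e)"] by simp
  define B where "B k = snd (Vi (k, 0))" for k
  have BE: "B k \<in> E" for k unfolding B_def by (rule ViE) (rule FD(2))
  have fstVi: "fst (Vi (k, 0)) = row S k" for k
  proof (rule inner_eq_imp_eq)
    fix x
    have "inner x (fst (Vi (k, 0))) = inner (V (x, 0)) (V (Vi (k, 0)))"
      using innerV[of 0 "snd (Vi (k, 0))" x "fst (Vi (k, 0))"] ViE[OF FD(2), of k] ED(2) by simp
    also have "\<dots> = inner (adj (row S) x) k"
      unfolding VVi[OF FD(2)] by (simp add: inner_prod_def main)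
    finally show "inner x (fst (Vi (k, 0))) = inner x (row S k)" by (simp add: inner_adj_rowT')
  qed
  have VB: "V (row S k, B k) = (k, 0)" for k
    using VVi[OF FD(2), of k] by (simp add: B_def flip: fstVi)
  have bB: "bop B"
    unfolding bounded_op_def
  proof (intro conjI ballI allI)
    show "B (k + k') = B k + B k'" for k k'
      using hilbert_isoD(3)[OF Vi, of "(k, 0)" "(k', 0)"] FD(2) by (simp add: B_def)
    show "B (c *\<^sub>C k) = c *\<^sub>C B k" for c k
      using hilbert_isoD(4)[OF Vi, of "(k, 0)" c] FD(2) by (simp add: B_def scaleC_prod_def)
    have "norm (B k) \<le> 1 * norm k" for k
      using norm_snd_le[of "snd (Vi (k, 0))" "fst (Vi (k, 0))"] hilbert_isoD(5)[OF Vi, of "(k, 0)"] FD(2)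
      by (simp add: B_def norm_Pair)
    then show "\<exists>K. \<forall>k\<in>UNIV. norm (B k) \<le> K * norm k" by blast
  qed auto
  have nB: "norm (B k) = norm (defect S k)" for k
  proof (rule power2_eq_imp_eq)
    have "(norm (row S k, B k))\<^sup>2 = (norm (k, 0::'f))\<^sup>2"
      using nV[OF BE, of "row S k" k] by (simp add: VB)
    then show "(norm (B k))\<^sup>2 = (norm (defect S k))\<^sup>2" by (simp add: norm_prod_sq norm_defect)
  qed auto
  define C where "C h = snd (V (h, 0))" for h
  have bC: "bop C" unfolding C_def[abs_def] by (intro bop_compose[OF bop_snd] bop_compose[OF bV] bop_intros)
  have V0: "V (h, 0) = (adj (row S) h, C h)" for h by (simp add: C_def prod_eq_iff main)
  have nC: "norm (C h) = norm (defect_star S h)" for h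
  proof (rule power2_eq_imp_eq)
    have "(norm (adj (row S) h, C h))\<^sup>2 = (norm (h, 0::'e))\<^sup>2"
      using nV[OF ED(2), of h] by (simp add: V0)
    then show "(norm (C h))\<^sup>2 = (norm (defect_star S h))\<^sup>2" by (simp add: norm_prod_sq norm_defect_star)
  qed auto
  have CF: "C h \<in> F" for h
    using hilbert_isoD(6)[OF U, of "(h, 0)"] ED(2) by (simp add: V0)
  define M N where "M = closure (range B)" and "N = closure (range C)"
  have ME: "M \<subseteq> E" unfolding M_def using BE ED(1) by (intro closure_minimal) auto
  have NF: "N \<subseteq> F" unfolding N_def using CF FD(1) by (intro closure_minimal) auto
  obtain W where W: "hilbert_iso M (defect_space S) W" "\<And>k. W (B k) = defect S k"
    using isometric_extension[OF bB bop_defect nB] unfolding M_def defect_space_def by blast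
  obtain W' where W': "hilbert_iso N (defect_star_space S) W'" "\<And>h. W' (C h) = defect_star S h"
    using isometric_extension[OF bC bop_defect_star nC] unfolding N_def defect_star_space_def by blast
  obtain P where P: "bop P" "\<And>x. P x \<in> M" "\<And>x. x \<in> M \<Longrightarrow> P x = x"
    "\<And>x m. m \<in> M \<Longrightarrow> inner (x - P x) m = 0" "\<And>x. norm (P x) \<le> norm x"
    using csubspace_projection[OF closed_csubspace_closure_range[OF bB]] unfolding M_def by blast
  obtain Q where Q: "bop Q" "\<And>x. Q x \<in> N" "\<And>x. x \<in> N \<Longrightarrow> Q x = x"
    "\<And>x m. m \<in> N \<Longrightarrow> inner (x - Q x) m = 0" "\<And>x. norm (Q x) \<le> norm x"
    using csubspace_projection[OF closed_csubspace_closure_range[OF bC]] unfolding N_def by blast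
  have perp: "(\<forall>m\<in>closure (range A). inner x m = 0) \<longleftrightarrow> (\<forall>k. inner x (A k) = 0)"
    for x and A :: "'x::chilbert_space \<Rightarrow> 'y::chilbert_space"
  proof
    assume A: "\<forall>k. inner x (A k) = 0"
    have "closed {m. inner x m = 0}" by (intro closed_Collect_eq continuous_intros)
    then have "closure (range A) \<subseteq> {m. inner x m = 0}" using A by (intro closure_minimal) auto
    then show "\<forall>m\<in>closure (range A). inner x m = 0" by blast
  qed (use closure_subset[of "range A"] in auto)
  \<comment> \<open>B is the adjoint of the input operator, so the kernel of the latter is the
    orthogonal complement of the range of B.\<close>
  have kerM: "{e\<in>E. fst (V (0, e)) = 0} = {x\<in>E. \<forall>m\<in>M. inner x m = 0}"
  proof -
    have "fst (V (0, e)) = 0 \<longleftrightarrow> (\<forall>k. inner e (B k) = 0)" if e: "e \<in> E" for e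
    proof -
      have "inner e (B k) = inner (fst (V (0, e))) k" for k
        using innerV[OF e BE[of k], where h = 0 and h' = "row S k"] by (simp add: VB inner_prod_def)
      then show ?thesis by (metis inner_eq_zero_iff inner_zero_left)
    qed
    then show ?thesis unfolding M_def perp by blast
  qed
  define KF where "KF = {x\<in>F. \<forall>m\<in>N. inner x m = 0}"
  define \<delta> where "\<delta> e = snd (V (0, e))" for e
  \<comment> \<open>On this kernel V (0, e) = (0, \<delta> e), so \<delta> is isometric. For f
    orthogonal to the range of C, the preimage of (0, f) under V has vanishing state, which gives
    surjectivity.\<close>
  have \<delta>: "hilbert_iso {e\<in>E. fst (V (0, e)) = 0} KF \<delta>"
    unfolding hilbert_iso_def
  proof (intro conjI ballI allI)
    show "closed_csubspace {e\<in>E. fst (V (0, e)) = 0}" by (rule hilbert_isoD(1)[OF \<kappa>])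
    show "\<delta> (x + y) = \<delta> x + \<delta> y" for x y
      using bop_add[OF bV, of "(0, x)" "(0, y)"] by (simp add: \<delta>_def)
    show "\<delta> (c *\<^sub>C x) = c *\<^sub>C \<delta> x" for c x
      using bop_scaleC[OF bV, of c "(0, x)"] by (simp add: \<delta>_def scaleC_prod_def)
    show "norm (\<delta> x) = norm x" if "x \<in> {e\<in>E. fst (V (0, e)) = 0}" for x
      using nV[of x 0] that by (simp add: \<delta>_def norm_prod_def)
    show "\<delta> ` {e\<in>E. fst (V (0, e)) = 0} = KF"
    proof (intro equalityI subsetI)
      fix f assume "f \<in> \<delta> ` {e\<in>E. fst (V (0, e)) = 0}"
      then obtain e where e: "e \<in> E" "fst (V (0, e)) = 0" "f = snd (V (0, e))" by (auto simp: \<delta>_def)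
      have "f \<in> F" using hilbert_isoD(6)[OF U, of "(0, e)"] e by (simp add: mem_Times_iff)
      moreover have "inner f (C h) = 0" for h
        using innerV[OF e(1) ED(2), where h = 0 and h' = h] e by (simp add: inner_prod_def V0)
      ultimately show "f \<in> KF" unfolding KF_def N_def perp by blast
    next
      fix f assume "f \<in> KF"
      then have f: "f \<in> F" "\<And>h. inner f (C h) = 0" unfolding KF_def N_def perp by auto
      define h e where "h = fst (Vi (0, f))" and "e = snd (Vi (0, f))"
      have he: "V (h, e) = (0, f)" "e \<in> E" using VVi[OF f(1), of 0] ViE[OF f(1), of 0] by (auto simp: h_def e_def)
      have "inner h x = 0" for x
        using innerV[OF he(2) ED(2), where h = h and h' = x] f(2)[of x] by (simp add: he(1) V0)
      then have "h = 0" by (metis inner_eq_zero_iff)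
      then show "f \<in> \<delta> ` {e\<in>E. fst (V (0, e)) = 0}"
        using he by (intro image_eqI[of _ _ e]) (auto simp: \<delta>_def)
    qed
  qed
  define \<kappa>' where "\<kappa>' f = \<kappa> (inv_into {e\<in>E. fst (V (0, e)) = 0} \<delta> f)" for f
  have \<kappa>': "hilbert_iso {x\<in>F. \<forall>m\<in>N. inner x m = 0} K \<kappa>'"
    using hilbert_iso_compose[OF hilbert_iso_inv[OF \<delta>] \<kappa>] by (simp add: KF_def \<kappa>'_def[abs_def])
  define \<tau> where "\<tau> = (\<lambda>x. (W (P x), \<kappa> (x - P x)))"
  define \<tau>' where "\<tau>' = (\<lambda>x. (W' (Q x), \<kappa>' (x - Q x)))"
  have \<tau>: "hilbert_iso E (defect_space S \<times> K) \<tau>"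
    unfolding \<tau>_def by (rule hilbert_iso_orthogonal_sum[OF E ME P(1-4) W(1) \<kappa>[unfolded kerM]])
  have \<tau>': "hilbert_iso F (defect_star_space S \<times> K) \<tau>'"
    unfolding \<tau>'_def by (rule hilbert_iso_orthogonal_sum[OF F NF Q(1-4) W'(1) \<kappa>'])
  have bW: "bop (\<lambda>x. W (P x))" by (rule bop_hilbert_iso_projection[OF P(1,2,5) W(1)])
  have bW': "bop (\<lambda>x. W' (Q x))" by (rule bop_hilbert_iso_projection[OF Q(1,2,5) W'(1)])
  have bV0: "bop (\<lambda>e. V (0, e))" by (intro bop_compose[OF bV] bop_intros)
  note bfV = bop_compose[OF bop_fst bV0] and bsV = bop_compose[OF bop_snd bV0]
  \<comment> \<open>Subtract V (row S k, 0) from V (row S k, B k) = (k, 0). The values of V on the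
    range of B found here are then extended to its closure M by continuity.\<close>
  have VB0: "V (0, B k) = (defect S (defect S k), - C (row S k))" for k
    using Vadd[of "row S k" "B k"] by (simp add: VB V0 defect_defect eq_diff_eq prod_eq_iff add.commute)
      (simp add: eq_neg_iff_add_eq_0 add.commute)
  have PB: "P (B k) = B k" for k by (rule P(3)) (use closure_subset[of "range B"] in \<open>auto simp: M_def\<close>)
  have QC: "Q (C h) = C h" for h by (rule Q(3)) (use closure_subset[of "range C"] in \<open>auto simp: N_def\<close>)
  have M1: "fst (V (0, m)) = defect S (W (P m))" if "m \<in> M" for m
    using bop_eq_on_closure_range[OF bfV bop_compose[OF bop_defect bW], of B m] that
    by (simp add: M_def PB VB0 W(2))
  have M2: "W' (Q (snd (V (0, m)))) = - row S (W (P m))" if "m \<in> M" for m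
    using bop_eq_on_closure_range[OF bop_compose[OF bW' bsV] bop_uminus[OF bop_compose[OF bop_rowT bW]], of B m] that
      bop_minus[OF bW'] by (simp add: M_def PB VB0 W(2) W'(2) QC row_defect)
  have M3: "snd (V (0, m)) - Q (snd (V (0, m))) = 0" if "m \<in> M" for m
    using bop_eq_on_closure_range[OF bop_minus_op[OF bsV bop_compose[OF Q(1) bsV]] bop_const_0, of B m] that
    by (simp add: M_def VB0 bop_minus[OF Q(1)] QC)
  have z: "\<kappa> 0 = 0" "\<kappa>' 0 = 0" "W' 0 = 0"
    using hilbert_isoD(5)[OF \<kappa>, of 0] hilbert_isoD(5)[OF \<kappa>', of 0] hilbert_isoD(5)[OF W'(1), of 0]
      closed_csubspaceD(2)[OF hilbert_isoD(1)[OF \<kappa>]] closed_csubspaceD(2)[OF hilbert_isoD(1)[OF \<kappa>']]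
      closed_csubspaceD(2)[OF hilbert_isoD(1)[OF W'(1)]] by auto
  have key: "fst (V (h, e)) = adj (row S) h + defect S (W (P e))"
    "\<tau>' (snd (V (h, e))) = (defect_star S h - row S (W (P e)), \<kappa> (e - P e))" if e: "e \<in> E" for h e
  proof -
    define m r where "m = P e" and "r = e - P e"
    have m: "m \<in> M" by (simp add: m_def P(2))
    have r: "r \<in> {e\<in>E. fst (V (0, e)) = 0}"
      unfolding kerM r_def using ED(5)[OF e subsetD[OF ME P(2)]] P(4) by blast
    have Vhe: "V (h, e) = V (h, 0) + (V (0, m) + V (0, r))"
      using Vadd[of h e] bop_add[OF bV, of "(0, m)" "(0, r)"] by (simp add: m_def r_def)
    show "fst (V (h, e)) = adj (row S) h + defect S (W (P e))"
      using r M1[OF m] P(3)[OF m] by (simp add: Vhe V0) (simp add: m_def)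
    have s: "snd (V (h, e)) = C h + (snd (V (0, m)) + \<delta> r)" by (simp add: Vhe V0 \<delta>_def)
    have dr: "\<delta> r \<in> {x\<in>F. \<forall>m\<in>N. inner x m = 0}" using hilbert_isoD(6)[OF \<delta> r] by (simp add: KF_def)
    have "inner (\<delta> r - Q (\<delta> r)) (Q (\<delta> r)) = 0" "inner (\<delta> r) (Q (\<delta> r)) = 0"
      using Q(2,4) dr by auto
    then have Qr: "Q (\<delta> r) = 0" by (simp add: inner_diff_left)
    have "W' (Q (snd (V (h, e)))) = W' (Q (C h)) + (W' (Q (snd (V (0, m)))) + W' (Q (\<delta> r)))"
      unfolding s by (simp only: bop_add[OF bW'])
    also have "\<dots> = defect_star S h - row S (W (P e))"
      using M2[OF m] P(3)[OF m] by (simp add: QC W'(2) Qr z) (simp add: m_def)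
    finally have 1: "W' (Q (snd (V (h, e)))) = defect_star S h - row S (W (P e))" .
    have "snd (V (h, e)) - Q (snd (V (h, e))) = \<delta> r"
      unfolding s using M3[OF m] by (simp add: bop_add[OF Q(1)] QC Qr)
    then have 2: "\<kappa>' (snd (V (h, e)) - Q (snd (V (h, e)))) = \<kappa> r"
      using hilbert_iso_inv_into(1)[OF \<delta> r] by (simp add: \<kappa>'_def)
    show "\<tau>' (snd (V (h, e))) = (defect_star S h - row S (W (P e)), \<kappa> (e - P e))"
      unfolding \<tau>'_def by (simp add: 1 2 r_def)
  qed
  show ?thesis
  proof (rule that[OF \<tau> \<tau>'])
    show "halmos S (h, fst (\<tau> e)) = (fst (V (h, e)), fst (\<tau>' (snd (V (h, e)))))" if "e \<in> E" for h e
      by (simp add: halmos_def key[OF that]) (simp add: \<tau>_def)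
    show "snd (\<tau>' (snd (V (h, e)))) = snd (\<tau> e)" if "e \<in> E" for h e
      by (simp add: key[OF that]) (simp add: \<tau>_def)
  qed
qed

text \<open>The maps \<tau> and \<tau>' turn a trajectory of V into one of the Halmos colligation
  with the same states. Uniqueness of trajectories identifies the first components, and the second
  components are passed on unchanged, as by \<open>id\<close>.\<close>

lemma block_diag_char_op_traj:
  fixes V :: "'h::chilbert_space \<times> 'e::chilbert_space \<Rightarrow> ('h ^ 'n::finite) \<times> 'f::chilbert_space"
    and \<tau> :: "'e \<Rightarrow> ('h ^ 'n) \<times> 'k::chilbert_space"
  assumes S: "commuting_row_contraction S" and t: "traj V a x g" and a: "\<And>\<alpha>. a \<alpha> \<in> E"
    and int: "\<And>h e. e \<in> E \<Longrightarrow> halmos S (h, fst (\<tau> e)) = (fst (V (h, e)), fst (\<tau>' (snd (V (h, e)))))"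
    "\<And>h e. e \<in> E \<Longrightarrow> snd (\<tau>' (snd (V (h, e)))) = snd (\<tau> e)"
    and f: "\<And>\<alpha>. coeff f \<alpha> = \<tau> (a \<alpha>)"
  shows "coeff (block_diag (char_op S) id f) \<alpha> = \<tau>' (g \<alpha>)"
proof -
  interpret row_contraction S by unfold_locales (rule S)
  have amp: "coeff (ampliation fst f) = (\<lambda>\<alpha>. fst (\<tau> (a \<alpha>)))" "coeff (ampliation snd f) = (\<lambda>\<alpha>. snd (\<tau> (a \<alpha>)))"
    by (auto simp: coeff_ampliation_bop bop_fst bop_snd f)
  obtain x' where x': "traj (halmos S) (coeff (ampliation fst f)) x' (coeff (char_op S (ampliation fst f)))"
    using char_op_traj by blast
  have "traj (halmos S) (\<lambda>\<alpha>. fst (\<tau> (a \<alpha>))) x (\<lambda>\<alpha>. fst (\<tau>' (g \<alpha>)))"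
  proof (rule trajI)
    show "x \<alpha> = (\<Sum>j | \<alpha> j > 0. fst (halmos S (x (dn j \<alpha>), fst (\<tau> (a (dn j \<alpha>))))) $ j)" for \<alpha>
      unfolding int(1)[OF a] fst_conv by (rule trajD(1)[OF t])
    show "fst (\<tau>' (g \<alpha>)) = snd (halmos S (x \<alpha>, fst (\<tau> (a \<alpha>))))" for \<alpha>
      by (simp add: int(1)[OF a] trajD(2)[OF t])
  qed
  from traj_unique(2)[OF x'[unfolded amp(1)] this]
  have "coeff (char_op S (ampliation fst f)) \<alpha> = fst (\<tau>' (g \<alpha>))" by simp
  moreover have "snd (\<tau> (a \<alpha>)) = snd (\<tau>' (g \<alpha>))"
    using int(2)[OF a, of "x \<alpha>" \<alpha>] by (simp add: trajD(2)[OF t])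
  ultimately show ?thesis by (simp add: coeff_block_diag amp(2) prod_eq_iff)
qed


section \<open>Compressions and triangular tuples\<close>

text \<open>J is an isometry with adjoint \<pi>, so taking adjoints commutes with compressing, and
  the norm bound on the adjoint row is inherited. Commutation is an assumption because compressions
  of commuting operators need not commute; triangularity provides it later.\<close>

lemma compression_row_contraction:
  fixes J :: "'k::chilbert_space \<Rightarrow> 'h::chilbert_space" and \<pi> :: "'h \<Rightarrow> 'k" and T :: "'n::finite \<Rightarrow> 'h \<Rightarrow> 'h"
  assumes T: "commuting_row_contraction T" and J: "bop J" and \<pi>: "bop \<pi>"
    and adj: "\<And>x y. inner (J x) y = inner x (\<pi> y)" and \<pi>J: "\<And>x. \<pi> (J x) = x"
    and A: "\<And>i x. A i x = \<pi> (T i (J x))" and comm: "\<And>i j x. A i (A j x) = A j (A i x)"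
  shows "commuting_row_contraction A" and "adj (A i) x = \<pi> (adj (T i) (J x))"
proof -
  interpret row_contraction T by unfold_locales (rule T)
  have bA: "bop (A i)" for i
    unfolding A[abs_def] by (rule bop_compose[OF \<pi> bop_compose[OF bop_T J]])
  have adj': "inner (\<pi> y) x = inner y (J x)" for x y using adj[of x y] by (simp add: inner_commute)
  have adjA: "adj (A i) x = \<pi> (adj (T i) (J x))" for i x
  proof (rule adj_eqI)
    show "A i (c *\<^sub>C u) = c *\<^sub>C A i u" for c u by (rule bop_scaleC[OF bA])
    show "inner (A i u) x = inner u (\<pi> (adj (T i) (J x)))" for u
      by (simp add: A adj' inner_adj[OF bop_T] flip: adj)
  qed
  then show "adj (A i) x = \<pi> (adj (T i) (J x))" .
  have nJ: "norm (J x) = norm x" for x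
    by (simp add: norm_eq_sqrt_inner adj \<pi>J)
  have n\<pi>: "norm (\<pi> y) \<le> norm y" for y
  proof (cases "\<pi> y = 0")
    case False
    have "(norm (\<pi> y))\<^sup>2 = inner (J (\<pi> y)) y" by (simp add: power2_norm_eq_inner adj)
    also have "\<dots> \<le> norm (\<pi> y) * norm y" using norm_cauchy_schwarz[of "J (\<pi> y)" y] by (simp add: nJ)
    finally show ?thesis using False by (simp add: power2_eq_square)
  qed simp
  have "positive_op (\<lambda>h. h - (\<Sum>i\<in>UNIV. A i (adj (A i) h)))"
  proof (rule positive_opI)
    show "bop (\<lambda>h. h - (\<Sum>i\<in>UNIV. A i (adj (A i) h)))"
      by (intro bop_minus_op bop_sum bop_compose[OF bA bop_adj[OF bA]] bop_id)
    have i: "inner (A i (adj (A i) x)) y = inner (adj (A i) x) (adj (A i) y)" for i x y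
      by (rule inner_adj[OF bA])
    show "inner (x - (\<Sum>i\<in>UNIV. A i (adj (A i) x))) y = inner x (y - (\<Sum>i\<in>UNIV. A i (adj (A i) y)))" for x y
      by (simp add: inner_diff_left inner_diff_right inner_sum_left inner_sum_right i
          inner_commute[of x "A _ _"]) (simp add: inner_commute)
    show "inner (x - (\<Sum>i\<in>UNIV. A i (adj (A i) x))) x \<ge> 0" for x
    proof -
      have "(\<Sum>i\<in>UNIV. (norm (adj (A i) x))\<^sup>2) \<le> (\<Sum>i\<in>UNIV. (norm (adj (T i) (J x)))\<^sup>2)"
        by (intro sum_mono power_mono) (auto simp: adjA n\<pi>)
      also have "\<dots> = (norm (adj (row T) (J x)))\<^sup>2" by (simp add: adj_row[OF bop_T] norm_vec_sq)
      also have "\<dots> \<le> (norm x)\<^sup>2" using norm_adj_rowT[of "J x"] by (intro power_mono) (auto simp: nJ)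
      finally show ?thesis
        by (simp add: inner_diff_left inner_sum_left i power2_norm_eq_inner)
    qed
  qed
  then show "commuting_row_contraction A"
    using bA comm by (auto simp: commuting_row_contraction_def fun_eq_iff)
qed

lemma upper_triangular3D:
  assumes "upper_triangular3 T S N C"
  shows "bop S" "bop N" "bop C" "T (h\<^sub>1, 0, 0) = (S h\<^sub>1, 0, 0)"
    "snd (T (h\<^sub>1, h\<^sub>0, 0)) = (N h\<^sub>0, 0)" "snd (snd (T h)) = C (snd (snd h))"
proof -
  obtain X Y Z where b: "bop S" "bop N" "bop C" "bop X" "bop Y" "bop Z"
    and T: "\<And>h\<^sub>1 h\<^sub>0 h\<^sub>2. T (h\<^sub>1, h\<^sub>0, h\<^sub>2) = (S h\<^sub>1 + X h\<^sub>0 + Y h\<^sub>2, N h\<^sub>0 + Z h\<^sub>2, C h\<^sub>2)"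
    using assms unfolding upper_triangular3_def by blast
  show "bop S" "bop N" "bop C" by (fact b)+
  show "T (h\<^sub>1, 0, 0) = (S h\<^sub>1, 0, 0)" "snd (T (h\<^sub>1, h\<^sub>0, 0)) = (N h\<^sub>0, 0)"
    "snd (snd (T h)) = C (snd (snd h))"
    by (cases h; simp add: T bop_zero[OF b(2)] bop_zero[OF b(3)] bop_zero[OF b(4)] bop_zero[OF b(5)] bop_zero[OF b(6)])+
qed


section \<open>Peeling off an invariant block from the Halmos colligation\<close>

text \<open>For a subspace \<open>K\<close> invariant under all \<open>T\<^sub>i\<^sup>*\<close>, the map \<open>(h, g) \<mapsto> halmos T (h, 0) + g\<close> is a unitary
  colligation with state space \<open>K\<close> and input space \<open>mid_space T K\<close>; for \<open>K = UNIV\<close> it is the Halmos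
  colligation up to a change of the input space, and for \<open>K = {0}\<close> it is trivial.\<close>

definition mid_space ::
  "('n::finite \<Rightarrow> 'h::chilbert_space \<Rightarrow> 'h) \<Rightarrow> 'h set \<Rightarrow> (('h ^ 'n) \<times> 'h) set" where
  "mid_space T K = {g. (\<forall>i. fst g $ i \<in> K) \<and> snd g \<in> defect_star_space T \<and>
     (\<forall>h\<in>K. inner g (halmos T (h, 0)) = 0)}"

definition peel ::
  "('n::finite \<Rightarrow> 'h::chilbert_space \<Rightarrow> 'h) \<Rightarrow> ('k::chilbert_space \<Rightarrow> 'h) \<Rightarrow> ('h \<Rightarrow> 'k) \<Rightarrow>
   'k \<times> (('h ^ 'n) \<times> 'h) \<Rightarrow> ('k ^ 'n) \<times> (('h ^ 'n) \<times> 'h)" where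
  "peel T J \<pi> p = (let r = halmos T (J (fst p), 0) + snd p in
     (\<chi> i. \<pi> (fst r $ i), \<chi> i. fst r $ i - J (\<pi> (fst r $ i)), snd r))"

lemma (in row_contraction) inner_halmos: "inner (halmos T p) (halmos T p') = inner p p'"
proof (rule hilbert_iso_inner)
  have "p \<in> range (halmos T)" for p
    using halmos_inverse[of "fst p" "snd p"] by (metis prod.collapse rangeI)
  then show "hilbert_iso UNIV UNIV (halmos T)"
    unfolding hilbert_iso_def
    by (auto simp: closed_csubspace_UNIV norm_halmos bop_add[OF bop_halmos] bop_scaleC[OF bop_halmos])
qed auto

text \<open>One stage of the cascade. K is the part of the state space still present, the range of
  the isometry J is the block now removed, and K' is what remains for the later stages.\<close>

locale peeling = row_contraction T for T :: "'n::finite \<Rightarrow> 'h::chilbert_space \<Rightarrow> 'h" +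
  fixes J :: "'k::chilbert_space \<Rightarrow> 'h" and \<pi> :: "'h \<Rightarrow> 'k" and K K' :: "'h set"
  assumes bJ: "bop J" and b\<pi>: "bop \<pi>"
    and adjJ: "\<And>x y. inner (J x) y = inner x (\<pi> y)" and \<pi>J: "\<And>x. \<pi> (J x) = x"
    and K: "closed_csubspace K" and JK: "\<And>x. J x \<in> K" and K': "K' = {x\<in>K. \<pi> x = 0}"
    and invK: "\<And>i x. x \<in> K \<Longrightarrow> adj (T i) x \<in> K" and invK': "\<And>i x. x \<in> K' \<Longrightarrow> adj (T i) x \<in> K'"
begin

definition q :: "'h \<Rightarrow> 'h" where "q x = x - J (\<pi> x)"

lemmas KD = closed_csubspaceD[OF K]

lemma q_in: "x \<in> K \<Longrightarrow> q x \<in> K'"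
  by (simp add: q_def K' KD(5) JK bop_diff[OF b\<pi>] \<pi>J)

lemma q_K': "x \<in> K' \<Longrightarrow> q x = x"
  by (simp add: q_def K' bop_zero[OF bJ])

lemma bop_q: "bop q"
  unfolding q_def[abs_def] by (intro bop_minus_op bop_id bop_compose[OF bJ b\<pi>])

lemma norm_\<pi>_q: "(norm (\<pi> x))\<^sup>2 + (norm (q x))\<^sup>2 = (norm x)\<^sup>2"
proof -
  have "inner (J (\<pi> x)) x = inner (\<pi> x) (\<pi> x)" "inner (J (\<pi> x)) (J (\<pi> x)) = inner (\<pi> x) (\<pi> x)"
    by (simp_all add: adjJ \<pi>J)
  then show ?thesis
    by (simp add: power2_norm_eq_inner q_def inner_diff_left inner_diff_right inner_commute)
qed

lemma inner_q: "\<pi> y = 0 \<Longrightarrow> inner (q x) y = inner x y"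
  by (simp add: q_def inner_diff_left adjJ)

lemma fst_halmos: "fst (halmos T (h, 0)) $ i = adj (T i) h"
  by (simp add: halmos_def bop_zero[OF bop_defect] adj_row[OF bop_T])

lemma peel_eq:
  "peel T J \<pi> p = (let r = halmos T (J (fst p), 0) + snd p in (\<chi> i. \<pi> (fst r $ i), \<chi> i. q (fst r $ i), snd r))"
  by (simp add: peel_def q_def)

lemma norm_split: "norm (\<chi> i. \<pi> (fst r $ i), \<chi> i. q (fst r $ i), snd r) = norm (r :: ('h ^ 'n) \<times> 'h)"
proof (rule power2_eq_imp_eq)
  show "(norm (\<chi> i. \<pi> (fst r $ i), \<chi> i. q (fst r $ i), snd r))\<^sup>2 = (norm r)\<^sup>2"
    by (simp add: norm_prod_sq norm_vec_sq add.assoc[symmetric] sum.distrib[symmetric] norm_\<pi>_q)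
qed auto

lemma bop_peel: "bop (peel T J \<pi>)"
proof -
  have r: "bop (\<lambda>p :: 'k \<times> (('h ^ 'n) \<times> 'h). halmos T (J (fst p), 0) + snd p)"
    by (intro bop_plus bop_compose[OF bop_halmos] bop_intros bop_compose[OF bJ bop_fst])
  have f: "bop (\<lambda>p :: 'k \<times> (('h ^ 'n) \<times> 'h). fst (halmos T (J (fst p), 0) + snd p) $ i)" for i
    by (rule bop_compose[OF bop_nth bop_compose[OF bop_fst r]])
  show ?thesis
    unfolding peel_eq[abs_def] Let_def
    by (intro bop_Pair bop_vec bop_compose[OF b\<pi> f] bop_compose[OF bop_q f] bop_compose[OF bop_snd r])
qed

lemma norm_peel:
  assumes g: "g \<in> mid_space T K" shows "norm (peel T J \<pi> (h, g)) = norm (h, g)"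
proof (rule power2_eq_imp_eq)
  have "inner g (halmos T (J h, 0)) = 0" using g JK by (simp add: mid_space_def)
  then have "(norm (halmos T (J h, 0) + g))\<^sup>2 = (norm (halmos T (J h, 0)))\<^sup>2 + (norm g)\<^sup>2"
    by (simp add: power2_norm_eq_inner inner_add_left inner_add_right inner_commute)
  also have "\<dots> = (norm (h, g))\<^sup>2"
    by (simp add: norm_halmos norm_prod_sq) (simp add: norm_eq_sqrt_inner adjJ \<pi>J)
  finally show "(norm (peel T J \<pi> (h, g)))\<^sup>2 = (norm (h, g))\<^sup>2"
    by (simp only: peel_eq Let_def fst_conv snd_conv norm_split)
qed auto

lemma inner_split:
  assumes "\<And>i. \<pi> (fst s $ i) = 0"
  shows "inner (\<chi> i. q (fst r $ i), snd r) s = inner (r :: ('h ^ 'n) \<times> 'h) s"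
  by (simp add: inner_prod_def inner_vec_def inner_q[OF assms])

lemma \<pi>_halmos: "h \<in> K' \<Longrightarrow> \<pi> (fst (halmos T (h, 0)) $ i) = 0"
  using invK'[of h i] by (simp add: fst_halmos K')

lemma snd_halmos_in: "snd (halmos T (h, 0)) \<in> defect_star_space T"
  by (simp add: halmos_def defect_star_in bop_zero[OF bop_rowT])

lemma peel_image: "peel T J \<pi> ` (UNIV \<times> mid_space T K) = UNIV \<times> mid_space T K'"
proof (intro equalityI subsetI)
  note DD = closed_csubspaceD[OF closed_csubspace_defect_star_space]
  fix p assume "p \<in> peel T J \<pi> ` (UNIV \<times> mid_space T K)"
  then obtain h g where p: "p = peel T J \<pi> (h, g)" and g: "g \<in> mid_space T K" by auto
  define r where "r = halmos T (J h, 0) + g"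
  have "fst r $ i \<in> K" for i
    using g KD(3)[OF invK[OF JK]] by (simp add: r_def fst_halmos mid_space_def)
  then have "q (fst r $ i) \<in> K'" for i by (rule q_in)
  moreover have "snd r \<in> defect_star_space T"
    using g DD(3)[OF snd_halmos_in] by (simp add: r_def mid_space_def)
  moreover have "inner (\<chi> i. q (fst r $ i), snd r) (halmos T (h', 0)) = 0" if h': "h' \<in> K'" for h'
  proof -
    have "inner (\<chi> i. q (fst r $ i), snd r) (halmos T (h', 0)) = inner r (halmos T (h', 0))"
      by (rule inner_split) (rule \<pi>_halmos[OF h'])
    also have "\<dots> = inner (J h) h' + inner g (halmos T (h', 0))"
      by (simp add: r_def inner_add_left inner_halmos)
    also have "\<dots> = 0" using g h' by (simp add: adjJ K' mid_space_def)
    finally show ?thesis .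
  qed
  ultimately show "p \<in> UNIV \<times> mid_space T K'"
    by (simp add: p peel_eq Let_def mid_space_def flip: r_def)
next
  note DD = closed_csubspaceD[OF closed_csubspace_defect_star_space]
  fix p :: "('k ^ 'n) \<times> (('h ^ 'n) \<times> 'h)" assume "p \<in> UNIV \<times> mid_space T K'"
  then obtain k g' where p: "p = (k, g')" and g': "g' \<in> mid_space T K'" by auto
  \<comment> \<open>For surjectivity, reassemble the vector before it was split and pull it back
    through the Halmos unitary. The component of the resulting state in the removed block is h, and
    what is left of r after its contribution is g.\<close>
  define r where "r = ((\<chi> i. J (k $ i) + fst g' $ i), snd g')"
  have "r \<in> halmos T ` (UNIV \<times> defect_space T)"
    unfolding halmos_image using g' by (simp add: r_def mid_space_def)
  then obtain x e where xe: "r = halmos T (x, e)" by auto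
  define h where "h = \<pi> x"
  define g where "g = r - halmos T (J h, 0)"
  have g_eq: "g = halmos T (x - J h, e)"
    unfolding g_def xe by (simp flip: bop_diff[OF bop_halmos])
  have rK: "fst r $ i \<in> K" for i
    using g' KD(3)[OF JK] by (simp add: r_def mid_space_def K')
  have "fst g $ i \<in> K" for i
    using KD(5)[OF rK invK[OF JK]] by (simp add: g_def fst_halmos)
  moreover have "snd g \<in> defect_star_space T"
    using g' DD(5)[OF _ snd_halmos_in] by (simp add: g_def r_def mid_space_def)
  moreover have "inner g (halmos T (u, 0)) = 0" if u: "u \<in> K" for u
  proof -
    have "inner g (halmos T (u, 0)) = inner (q x) u"
      by (simp add: g_eq inner_halmos q_def h_def)
    also have "\<dots> = inner x (q u)"
      by (simp add: q_def inner_diff_left inner_diff_right adjJ inner_commute[of x "J _"] inner_commute[of "\<pi> u"])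
    also have "\<dots> = inner r (halmos T (q u, 0))" by (simp add: xe inner_halmos)
    also have "\<dots> = inner g' (halmos T (q u, 0))"
      using \<pi>_halmos[OF q_in[OF u]]
      by (simp add: r_def inner_prod_def inner_vec_def inner_add_left adjJ)
    also have "\<dots> = 0" using g' q_in[OF u] by (simp add: mid_space_def)
    finally show ?thesis .
  qed
  ultimately have "g \<in> mid_space T K" by (simp add: mid_space_def)
  moreover have "peel T J \<pi> (h, g) = p"
  proof -
    have "\<pi> (fst g' $ i) = 0" "q (fst g' $ i) = fst g' $ i" for i
      using g' q_K' by (auto simp: mid_space_def K')
    then show ?thesis
      by (simp add: peel_eq Let_def g_def p) (simp add: r_def prod_eq_iff vec_eq_iff bop_add[OF b\<pi>] \<pi>J bop_add[OF bop_q]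
          q_def[of "J _"])
  qed
  ultimately show "p \<in> peel T J \<pi> ` (UNIV \<times> mid_space T K)" by (intro image_eqI[of _ _ "(h, g)"]) auto
qed

lemma fst_peel: "(\<And>i x. adj (A i) x = \<pi> (adj (T i) (J x))) \<Longrightarrow> (\<And>i. bop (A i)) \<Longrightarrow> fst (peel T J \<pi> (h, 0)) = adj (row A) h"
  by (simp add: peel_eq Let_def fst_halmos adj_row)

text \<open>The state splits as J (\<pi> x) + q x. Invariance of K' under the adjoints prevents q x
  from feeding back into \<pi> x, so the first part runs on its own and its output drives the
  second: a cascade of two systems.\<close>

lemma peel_traj:
  assumes t: "traj (\<lambda>(h, g). halmos T (h, 0) + g) g x y" and x: "\<And>\<alpha>. x \<alpha> \<in> K"
  defines "g' \<equiv> \<lambda>\<alpha>. snd (peel T J \<pi> (\<pi> (x \<alpha>), g \<alpha>))"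
  shows "traj (peel T J \<pi>) g (\<lambda>\<alpha>. \<pi> (x \<alpha>)) g'"
    and "traj (\<lambda>(h, g). halmos T (h, 0) + g) g' (\<lambda>\<alpha>. q (x \<alpha>)) y"
proof -
  define r where "r \<alpha> = halmos T (J (\<pi> (x \<alpha>)), 0) + g \<alpha>" for \<alpha>
  have peel: "peel T J \<pi> (\<pi> (x \<alpha>), g \<alpha>) = (\<chi> i. \<pi> (fst (r \<alpha>) $ i), \<chi> i. q (fst (r \<alpha>) $ i), snd (r \<alpha>))" for \<alpha>
    by (simp add: peel_eq Let_def r_def)
  have xq: "q (x \<alpha>) \<in> K'" for \<alpha> by (rule q_in[OF x])
  have split: "halmos T (x \<alpha>, 0) + g \<alpha> = r \<alpha> + halmos T (q (x \<alpha>), 0)" for \<alpha>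
    using bop_add[OF bop_halmos, of "(J (\<pi> (x \<alpha>)), 0)" "(q (x \<alpha>), 0)"] by (simp add: r_def q_def)
  have \<pi>r: "\<pi> (fst (halmos T (x \<alpha>, 0) + g \<alpha>) $ j) = \<pi> (fst (r \<alpha>) $ j)" for \<alpha> j
    unfolding split by (simp add: bop_add[OF b\<pi>] \<pi>_halmos[OF xq])
  have qr: "q (fst (halmos T (x \<alpha>, 0) + g \<alpha>) $ j) = fst (halmos T (q (x \<alpha>), 0) + g' \<alpha>) $ j" for \<alpha> j
    unfolding split by (simp add: bop_add[OF bop_q] g'_def peel fst_halmos q_K'[OF invK'[OF xq]])
  have lin: "A (\<Sum>j | \<alpha> j > 0. f j) = (\<Sum>j | \<alpha> j > 0. A (f j))" if "bop A"
    for A :: "'h \<Rightarrow> 'z::chilbert_space" and \<alpha> :: "'n \<Rightarrow> nat" and f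
    by (rule linear_sum[OF bounded_linear.linear[OF bop_bounded_linear[OF that]]])
  note tx = trajD(1)[OF t, unfolded prod.case]
  show "traj (peel T J \<pi>) g (\<lambda>\<alpha>. \<pi> (x \<alpha>)) g'"
  proof (rule trajI)
    fix \<alpha>
    have "\<pi> (x \<alpha>) = (\<Sum>j | \<alpha> j > 0. \<pi> (fst (r (dn j \<alpha>)) $ j))"
      by (subst tx) (simp only: lin[OF b\<pi>] \<pi>r)
    then show "\<pi> (x \<alpha>) = (\<Sum>j | \<alpha> j > 0. fst (peel T J \<pi> (\<pi> (x (dn j \<alpha>)), g (dn j \<alpha>))) $ j)"
      by (simp add: peel)
  qed (simp add: g'_def)
  show "traj (\<lambda>(h, g). halmos T (h, 0) + g) g' (\<lambda>\<alpha>. q (x \<alpha>)) y"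
  proof (rule trajI, unfold prod.case)
    fix \<alpha>
    show "q (x \<alpha>) = (\<Sum>j | \<alpha> j > 0. fst (halmos T (q (x (dn j \<alpha>)), 0) + g' (dn j \<alpha>)) $ j)"
      by (subst tx) (simp only: lin[OF bop_q] qr)
    have "y \<alpha> = snd (halmos T (x \<alpha>, 0) + g \<alpha>)" using trajD(2)[OF t, of \<alpha>] by simp
    also have "\<dots> = snd (halmos T (q (x \<alpha>), 0) + g' \<alpha>)"
      unfolding split by (simp add: g'_def peel)
    finally show "y \<alpha> = snd (halmos T (q (x \<alpha>), 0) + g' \<alpha>)" .
  qed
qed

end

context row_contraction
begin

lemma closed_csubspace_mid_space:
  assumes K: "closed_csubspace K"
  shows "closed_csubspace (mid_space T K)"
proof -
  note KD = closed_csubspaceD[OF K] and DD = closed_csubspaceD[OF closed_csubspace_defect_star_space]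
  have c1: "closed {g. inner g y = 0}" for y :: "('h ^ 'n) \<times> 'h"
    by (intro closed_Collect_eq continuous_intros)
  have c2: "closed {g :: ('h ^ 'n) \<times> 'h. fst g $ i \<in> K}" for i
  proof -
    have "closed ((\<lambda>g :: ('h ^ 'n) \<times> 'h. fst g $ i) -` K)"
      by (rule continuous_closed_vimage[OF KD(1)]) (intro continuous_intros)
    then show ?thesis by (simp add: vimage_def)
  qed
  have c3: "closed {g :: ('h ^ 'n) \<times> 'h. snd g \<in> defect_star_space T}"
  proof -
    have "closed (snd -` defect_star_space T :: (('h ^ 'n) \<times> 'h) set)"
      by (rule continuous_closed_vimage[OF DD(1)]) (intro continuous_intros)
    then show ?thesis by (simp add: vimage_def)
  qed
  have "mid_space T K = (\<Inter>i. {g. fst g $ i \<in> K}) \<inter> {g. snd g \<in> defect_star_space T} \<inter>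
      (\<Inter>h\<in>K. {g. inner g (halmos T (h, 0)) = 0})"
    by (auto simp: mid_space_def)
  then have "closed (mid_space T K)" by (simp add: closed_INT closed_Int c1 c2 c3)
  \<comment> \<open>The orthogonality in \<open>mid_space\<close> is only real. Since K is closed
    under multiplication by \<i>, it is in fact complex orthogonality and so survives complex
    scaling.\<close>
  moreover have "inner (c *\<^sub>C g) (halmos T (h, 0)) = 0" if g: "g \<in> mid_space T K" and h: "h \<in> K" for c g h
  proof -
    have "cinner (halmos T (h, 0)) g = 0"
    proof (rule complex_eqI)
      show "Re (cinner (halmos T (h, 0)) g) = Re 0"
        using g h by (simp add: Re_cinner mid_space_def inner_commute)
      have "\<i> *\<^sub>C halmos T (h, 0) = halmos T (\<i> *\<^sub>C h, 0)"
        using bop_scaleC[OF bop_halmos, of \<i> "(h, 0)"] by (simp add: scaleC_prod_def)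
      then show "Im (cinner (halmos T (h, 0)) g) = Im 0"
        using g KD(4)[OF h, of \<i>] by (simp add: Im_cinner mid_space_def inner_commute)
    qed
    then have "Re (cinner (halmos T (h, 0)) (c *\<^sub>C g)) = 0" by (simp add: cinner_scaleC_right)
    then show ?thesis by (simp add: Re_cinner inner_commute)
  qed
  ultimately show ?thesis
    unfolding closed_csubspace_def
    using KD DD by (auto simp: mid_space_def inner_add_left scaleC_prod_def scaleC_vec_def)
qed

text \<open>The entrance of the cascade: by unitarity, what is orthogonal to the images of all pure
  states consists of the images of pure inputs.\<close>

lemma hilbert_iso_mid_UNIV: "hilbert_iso (defect_space T) (mid_space T UNIV) (\<lambda>e. halmos T (0, e))"
  unfolding hilbert_iso_def
proof (intro conjI ballI allI closed_csubspace_defect_space)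
  show "halmos T (0, x + y) = halmos T (0, x) + halmos T (0, y)" for x y
    using bop_add[OF bop_halmos, of "(0, x)" "(0, y)"] by simp
  show "halmos T (0, c *\<^sub>C x) = c *\<^sub>C halmos T (0, x)" for c x
    using bop_scaleC[OF bop_halmos, of c "(0, x)"] by (simp add: scaleC_prod_def)
  show "norm (halmos T (0, x)) = norm x" for x
    unfolding norm_halmos by (simp add: norm_Pair)
  have z: "0 \<in> defect_space T" by (rule closed_csubspaceD(2)[OF closed_csubspace_defect_space])
  show "(\<lambda>e. halmos T (0, e)) ` defect_space T = mid_space T UNIV"
  proof (intro equalityI subsetI)
    fix g assume "g \<in> (\<lambda>e. halmos T (0, e)) ` defect_space T"
    then obtain e where e: "e \<in> defect_space T" "g = halmos T (0, e)" by blast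
    have "g \<in> UNIV \<times> defect_star_space T" using e by (auto simp flip: halmos_image)
    then show "g \<in> mid_space T UNIV"
      using e z by (auto simp: mid_space_def inner_halmos)
  next
    fix g assume g: "g \<in> mid_space T UNIV"
    then have "g \<in> halmos T ` (UNIV \<times> defect_space T)"
      unfolding halmos_image by (simp add: mid_space_def mem_Times_iff)
    then obtain h e where he: "g = halmos T (h, e)" "e \<in> defect_space T" by auto
    have "inner h h = 0" using g he z by (auto simp: mid_space_def inner_halmos dest: spec[of _ h])
    then show "g \<in> (\<lambda>e. halmos T (0, e)) ` defect_space T" using he by auto
  qed
qed

lemma hilbert_iso_mid_0: "hilbert_iso (defect_star_space T) (mid_space T {0}) (\<lambda>d. (0, d))"
  unfolding hilbert_iso_def
proof (intro conjI ballI allI closed_csubspace_defect_star_space)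
  have h0: "halmos T (0, 0) = 0" using bop_zero[OF bop_halmos] by (simp add: zero_prod_def)
  show "(\<lambda>d. (0, d)) ` defect_star_space T = mid_space T {0}"
    by (auto simp: mid_space_def h0 image_iff vec_eq_iff prod_eq_iff)
qed (auto simp: scaleC_prod_def norm_prod_def)

lemma traj_mid_UNIV:
  assumes "traj (halmos T) a x y"
  shows "traj (\<lambda>(h, g). halmos T (h, 0) + g) (\<lambda>\<alpha>. halmos T (0, a \<alpha>)) x y"
proof -
  have eq: "halmos T (h, 0) + halmos T (0, e) = halmos T (h, e)" for h e
    using bop_add[OF bop_halmos, of "(h, 0)" "(0, e)"] by simp
  show ?thesis
    by (rule trajI, unfold prod.case eq) (rule trajD[OF assms])+
qed

end

lemma bounded_op_compose:
  assumes A: "bounded_op E F A" and B: "bounded_op F G B" shows "bounded_op E G (\<lambda>x. B (A x))"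
proof -
  note AD = bounded_opD[OF A] and BD = bounded_opD[OF B]
  obtain K where K: "K \<ge> 0" "\<And>x. x \<in> E \<Longrightarrow> norm (A x) \<le> K * norm x" using bounded_op_bound[OF A] by blast
  obtain L where L: "L \<ge> 0" "\<And>x. x \<in> F \<Longrightarrow> norm (B x) \<le> L * norm x" using bounded_op_bound[OF B] by blast
  have "norm (B (A x)) \<le> (L * K) * norm x" if "x \<in> E" for x
    using L(2)[OF AD(1)[OF that]] mult_left_mono[OF K(2)[OF that] L(1)] by (simp add: mult.assoc)
  then show ?thesis
    unfolding bounded_op_def using AD BD by auto
qed

lemma bounded_op_cong:
  assumes E: "closed_csubspace E" and eq: "\<And>x. x \<in> E \<Longrightarrow> A x = B x" and A: "bounded_op E F A"
  shows "bounded_op E F B"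
proof -
  note ED = closed_csubspaceD[OF E] and AD = bounded_opD[OF A]
  obtain K where K: "\<And>x. x \<in> E \<Longrightarrow> norm (A x) \<le> K * norm x" using bounded_op_bound[OF A] by blast
  show ?thesis
    unfolding bounded_op_def
  proof (intro conjI ballI allI)
    show "\<exists>K. \<forall>x\<in>E. norm (B x) \<le> K * norm x" using K eq by (intro exI[of _ K]) simp
    show "B x \<in> F" if "x \<in> E" for x using AD(1)[OF that] eq[OF that] by simp
    show "B (x + y) = B x + B y" if "x \<in> E" "y \<in> E" for x y
      using AD(2)[OF that] eq ED(3) that by simp
    show "B (c *\<^sub>C x) = c *\<^sub>C B x" if "x \<in> E" for c x
      using AD(3)[OF that] eq ED(4) that by simp
  qed
qed


section \<open>The characteristic function of a Drury-Arveson shift\<close>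

definition single :: "('n::finite \<Rightarrow> nat) \<Rightarrow> 'w::chilbert_space \<Rightarrow> ('n, 'w) h2" where
  "single \<alpha> w = Abs_h2 (\<lambda>\<beta>. if \<beta> = \<alpha> then w else 0)"

lemma coeff_single: "coeff (single \<alpha> w) \<beta> = (if \<beta> = \<alpha> then w else 0)"
proof -
  have "(\<lambda>\<beta>. (norm (if \<beta> = \<alpha> then w else 0))\<^sup>2 / multinom \<beta>) summable_on UNIV"
    by (rule finite_nonzero_values_imp_summable_on, rule finite_subset[of _ "{\<alpha>}"]) auto
  then show ?thesis by (simp add: single_def coeff_Abs_h2)
qed

lemma inner_single: "inner (single \<alpha> w) g = inner w (coeff g \<alpha>) / multinom \<alpha>"
proof -
  have "inner (single \<alpha> w) g = (\<Sum>\<^sub>\<infinity>\<beta>\<in>{\<alpha>}. inner w (coeff g \<beta>) / multinom \<beta>)"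
    unfolding inner_h2_def coeff_single by (rule infsum_cong_neutral) auto
  then show ?thesis by simp
qed

lemma coord_mult_single: "coord_mult i (single \<alpha> w) = single (up i \<alpha>) w"
  by (rule h2_eqI) (auto simp: coeff_coord_mult coeff_single split: if_splits)

text \<open>For the shift, \<open>I - S S\<^sup>*\<close> is the projection onto the constants, so \<open>row S\<close> is a partial isometry and
  vanishes on the defect space. The constant coefficient of the state \<open>x \<alpha>\<close> then vanishes because the
  sums of the coefficients of \<open>x (\<alpha> - \<beta>)\<close> at \<open>\<beta>\<close> over all \<open>\<beta> \<le> \<alpha>\<close> of degree \<open>k\<close> do not depend on \<open>k\<close>.\<close>

lemma char_op_shift:
  fixes S :: "'n::finite \<Rightarrow> 'h::chilbert_space \<Rightarrow> 'h" and \<W> :: "'w::chilbert_space set"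
  assumes S: "commuting_row_contraction S" and \<W>: "closed_csubspace \<W>"
    and shift: "drury_arveson_shift_on \<W> S" and f: "f \<in> h2_space (defect_space S)"
  shows "char_op S f = 0"
proof -
  interpret row_contraction S by unfold_locales (rule S)
  note WD = closed_csubspaceD[OF \<W>]
  obtain U :: "'h \<Rightarrow> ('n, 'w) h2" where U: "unitary_op UNIV (h2_space \<W>) U"
    and US: "\<And>i h. U (S i h) = coord_mult i (U h)"
    using shift unfolding drury_arveson_shift_on_def by blast
  have bU: "bop U" and UW: "U h \<in> h2_space \<W>" for h
    using U by (auto simp: unitary_op_def bounded_op_def)
  have innU: "inner (U u) (U v) = inner u v" for u v
    using U inner_adj[OF bU, of u "U v"] by (simp add: unitary_op_def adj_on_def)
  have surj: "\<exists>u. U u = g" if "g \<in> h2_space \<W>" for g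
    using U that unfolding unitary_op_def by blast
  define c where "c h \<beta> = coeff (U h) \<beta>" for h \<beta>
  have cW: "c h \<beta> \<in> \<W>" for h \<beta> unfolding c_def by (rule h2_spaceD[OF UW])
  have bc: "bop (\<lambda>h. c h \<beta>)" for \<beta>
    unfolding c_def by (rule bop_compose[OF bop_coeff bU])
  have c_sum: "c (\<Sum>i\<in>I. h i) \<beta> = (\<Sum>i\<in>I. c (h i) \<beta>)" for I \<beta> and h :: "'n \<Rightarrow> 'h"
    by (rule linear_sum[OF bounded_linear.linear[OF bop_bounded_linear[OF bc]]])
  have cS: "c (S i h) \<beta> = (if \<beta> i > 0 then c h (dn i \<beta>) else 0)" for i h \<beta>
    by (simp add: c_def US coeff_coord_mult)
  have c_row: "c (row S x) \<beta> = (\<Sum>i | \<beta> i > 0. c (x $ i) (dn i \<beta>))" for x \<beta>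
    by (simp add: row_def c_sum cS sum.If_cases)
  have c_adj: "c (adj (S i) h) \<beta> = (multinom \<beta> / multinom (up i \<beta>)) *\<^sub>R c h (up i \<beta>)" for i h \<beta>
  proof -
    \<comment> \<open>The difference to be shown zero is used as its own test vector. It lies in
      \<W>, so the monomial with coefficient d is in the range of U, and comparing inner products
      gives \<open>inner d d = 0\<close>.\<close>
    define d where "d = c (adj (S i) h) \<beta> - (multinom \<beta> / multinom (up i \<beta>)) *\<^sub>R c h (up i \<beta>)"
    have dW: "d \<in> \<W>" unfolding d_def by (intro WD(5) closed_csubspace_scaleR[OF \<W>] cW)
    then have "single \<beta> d \<in> h2_space \<W>" using WD(2) by (simp add: h2_space_def coeff_single)
    then obtain u where u: "U u = single \<beta> d" using surj by blast
    have "inner d (c h (up i \<beta>)) / multinom (up i \<beta>) = inner (U (S i u)) (U h)"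
      by (simp add: US u coord_mult_single inner_single c_def)
    also have "\<dots> = inner (U u) (U (adj (S i) h))" by (simp add: innU inner_adj[OF bop_T])
    also have "\<dots> = inner d (c (adj (S i) h) \<beta>) / multinom \<beta>" by (simp add: u inner_single c_def)
    finally have "inner d (c (adj (S i) h) \<beta>) = multinom \<beta> / multinom (up i \<beta>) * inner d (c h (up i \<beta>))"
      by (simp add: field_simps)
    then have "inner d d = 0"
      by (subst (2) d_def) (simp add: inner_diff_right)
    then show ?thesis by (simp add: d_def)
  qed
  have c_SS: "c (row S (adj (row S) h)) \<beta> = (if mdeg \<beta> > 0 then c h \<beta> else 0)" for h \<beta>
  proof (cases "mdeg \<beta>")
    case 0
    then have "\<beta> i = 0" for i by (simp add: mdeg_0_iff)
    then show ?thesis using 0 by (simp add: c_row)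
  next
    case (Suc m)
    have "c (row S (adj (row S) h)) \<beta> = (\<Sum>i | \<beta> i > 0. (multinom (dn i \<beta>) / multinom \<beta>) *\<^sub>R c h \<beta>)"
      by (simp add: c_row adj_row[OF bop_T] c_adj)
    also have "\<dots> = c h \<beta>"
      by (simp add: multinom_Suc[OF Suc, symmetric] flip: scaleR_sum_left sum_divide_distrib)
    finally show ?thesis using Suc by simp
  qed
  have D0: "defect_star S h = 0" if "c h (\<lambda>_. 0) = 0" for h
  proof -
    have "c (defect_star S (defect_star S h)) \<beta> = 0" for \<beta>
    proof (cases "mdeg \<beta>")
      case 0
      then have "\<beta> = (\<lambda>_. 0)" by (auto simp: mdeg_0_iff)
      then show ?thesis using that by (simp add: defect_star_defect_star bop_diff[OF bc] c_SS mdeg_def)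
    qed (simp add: defect_star_defect_star bop_diff[OF bc] c_SS)
    then have "U (defect_star S (defect_star S h)) = 0"
      by (intro h2_eqI) (simp add: c_def coeff_zero)
    then have "inner (defect_star S (defect_star S h)) h = 0"
      using innU[of "defect_star S (defect_star S h)" h] by simp
    then show ?thesis using inner_defect_star[of "defect_star S h" h] by simp
  qed
  have SD: "row S (defect S e) = 0" for e
    unfolding row_defect by (rule D0) (simp add: c_row)
  have S0: "row S e = 0" if "e \<in> defect_space S" for e
    using bop_eq_on_closure_range[OF bop_rowT bop_const_0 SD] that by (simp add: defect_space_def)
  obtain x where x: "traj (halmos S) (coeff f) x (coeff (char_op S f))" using char_op_traj by blast
  define b where "b \<delta> j \<beta> = c (defect S (coeff f \<delta>) $ j) \<beta>" for \<delta> j \<beta>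
  \<comment> \<open>The identity row S (defect S e) = 0, read coefficientwise for the input part of
    the state equation.\<close>
  have b0: "(\<Sum>j | \<beta> j > 0. b \<delta> j (dn j \<beta>)) = 0" for \<delta> \<beta>
    using c_row[of "defect S (coeff f \<delta>)" \<beta>] bop_zero[OF bc] by (simp add: b_def SD)
  have cx: "c (x \<alpha>) \<beta> = (\<Sum>j | \<alpha> j > 0. (multinom \<beta> / multinom (up j \<beta>)) *\<^sub>R c (x (dn j \<alpha>)) (up j \<beta>) + b (dn j \<alpha>) j \<beta>)"
    for \<alpha> \<beta>
    by (subst trajD(1)[OF x])
      (simp add: c_sum halmos_def adj_row[OF bop_T] bop_add[OF bc] c_adj b_def)
  \<comment> \<open>Truncated difference of multi-indices; it is read only under \<beta> \<le>
    \<alpha>, where it is the true difference.\<close>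
  define \<mu> where "\<mu> \<alpha> \<beta> = (\<lambda>i. \<alpha> i - \<beta> i)" for \<alpha> \<beta> :: "'n \<Rightarrow> nat"
  have "c (x \<alpha>) (\<lambda>_. 0) = 0" for \<alpha>
  proof -
    \<comment> \<open>Y 0 is the constant coefficient of x \<alpha>, and all terms of Y k vanish
      once k exceeds the degree of \<alpha>.\<close>
    define Y where "Y k = (\<Sum>\<beta>\<in>level k. if \<beta> \<le> \<alpha> then c (x (\<mu> \<alpha> \<beta>)) \<beta> else 0)" for k
    have "Y k = Y (Suc k)" for k
    proof -
      \<comment> \<open>F j \<beta> is the contribution that passes along the edge of direction j
        below \<beta>. Summed over the edges above an index it gives the state equation
        \<open>cx\<close>; summed over the edges below, the weights add up to 1 by Pascal's rule and
        the input terms cancel by \<open>b0\<close>.\<close>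
      define F where "F j \<beta> = (if \<beta> \<le> \<alpha> then
          (multinom (dn j \<beta>) / multinom \<beta>) *\<^sub>R c (x (\<mu> \<alpha> \<beta>)) \<beta> + b (\<mu> \<alpha> \<beta>) j (dn j \<beta>) else 0)" for j \<beta>
      have "(if \<beta> \<le> \<alpha> then c (x (\<mu> \<alpha> \<beta>)) \<beta> else 0) = (\<Sum>j\<in>UNIV. F j (up j \<beta>))" for \<beta>
      proof (cases "\<beta> \<le> \<alpha>")
        case True
        have le: "up j \<beta> \<le> \<alpha> \<longleftrightarrow> \<mu> \<alpha> \<beta> j > 0" for j
          using True by (auto simp: le_fun_def up_def \<mu>_def Suc_le_eq)
        have dn: "dn j (\<mu> \<alpha> \<beta>) = \<mu> \<alpha> (up j \<beta>)" for j
          by (auto simp: dn_def \<mu>_def up_def)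
        show ?thesis
          using True by (simp add: F_def le sum.If_cases cx[of "\<mu> \<alpha> \<beta>"] dn)
      next
        case False
        have "\<not> up j \<beta> \<le> \<alpha>" for j
        proof
          assume "up j \<beta> \<le> \<alpha>"
          moreover have "\<beta> \<le> up j \<beta>" by (auto simp: le_fun_def up_def)
          ultimately show False using False order_trans by blast
        qed
        then show ?thesis using False by (simp add: F_def)
      qed
      then have "Y k = (\<Sum>\<beta>\<in>level k. \<Sum>j\<in>UNIV. F j (up j \<beta>))" by (simp add: Y_def)
      also have "\<dots> = (\<Sum>\<beta>\<in>level (Suc k). \<Sum>j | \<beta> j > 0. F j \<beta>)" by (rule sum_level_Suc[symmetric])
      also have "\<dots> = Y (Suc k)"
        unfolding Y_def
      proof (rule sum.cong[OF refl])
        fix \<beta> :: "'n \<Rightarrow> nat" assume \<beta>: "\<beta> \<in> level (Suc k)"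
        show "(\<Sum>j | \<beta> j > 0. F j \<beta>) = (if \<beta> \<le> \<alpha> then c (x (\<mu> \<alpha> \<beta>)) \<beta> else 0)"
        proof (cases "\<beta> \<le> \<alpha>")
          case True
          have "mdeg \<beta> = Suc k" using \<beta> by (simp add: level_def)
          then have "(\<Sum>j | \<beta> j > 0. (multinom (dn j \<beta>) / multinom \<beta>) *\<^sub>R c (x (\<mu> \<alpha> \<beta>)) \<beta>) = c (x (\<mu> \<alpha> \<beta>)) \<beta>"
            by (simp add: multinom_Suc[symmetric] flip: scaleR_sum_left sum_divide_distrib)
          then show ?thesis using True by (simp add: F_def sum.distrib b0)
        qed (simp add: F_def)
      qed
      finally show ?thesis .
    qed
    then have "Y 0 = Y k" for k by (induction k) auto
    moreover have "Y (Suc (mdeg \<alpha>)) = 0"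
      unfolding Y_def
    proof (rule sum.neutral, rule ballI)
      fix \<beta> :: "'n \<Rightarrow> nat" assume "\<beta> \<in> level (Suc (mdeg \<alpha>))"
      then have "\<not> mdeg \<beta> \<le> mdeg \<alpha>" by (simp add: level_def)
      moreover have "\<beta> \<le> \<alpha> \<Longrightarrow> mdeg \<beta> \<le> mdeg \<alpha>" by (auto simp: mdeg_def le_fun_def intro: sum_mono)
      ultimately show "(if \<beta> \<le> \<alpha> then c (x (\<mu> \<alpha> \<beta>)) \<beta> else 0) = 0" by auto
    qed
    ultimately have "Y 0 = 0" by metis
    then show ?thesis by (simp add: Y_def level_0 le_fun_def \<mu>_def)
  qed
  then have "coeff (char_op S f) \<alpha> = 0" for \<alpha>
    by (simp add: trajD(2)[OF x] halmos_def D0 S0[OF h2_spaceD[OF f]])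
  then show ?thesis by (intro h2_eqI) (simp add: coeff_zero)
qed

lemma defect_star_space_spherical_coisometry:
  assumes C: "commuting_row_contraction C" and "spherical_coisometry C"
  shows "defect_star_space C = {0}"
proof -
  interpret row_contraction C by unfold_locales (rule C)
  have "defect_star C h = 0" for h
  proof -
    have "defect_star C (defect_star C h) = 0"
      using assms(2) by (simp add: defect_star_defect_star row_def adj_row[OF bop_T] spherical_coisometry_def)
    then show ?thesis using inner_defect_star[of "defect_star C h" h] by simp
  qed
  then show ?thesis by (simp add: defect_star_space_def)
qed


section \<open>The factorization\<close>

lemma closed_csubspace_kernel:
  assumes E: "closed_csubspace E" and X: "bop X" shows "closed_csubspace {e\<in>E. X e = 0}"
proof -
  have "closed {e. X e = 0}"
    by (intro closed_Collect_eq linear_continuous_on bop_bounded_linear X continuous_on_const)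
  then have "closed {e\<in>E. X e = 0}"
    using closed_Int[OF closed_csubspaceD(1)[OF E]] by (simp add: Collect_conj_eq)
  then show ?thesis
    using closed_csubspaceD[OF E]
    by (simp add: closed_csubspace_def bop_zero[OF X] bop_add[OF X] bop_scaleC[OF X])
qed

lemma hilbert_iso_axis:
  assumes M: "closed_csubspace M"
  shows "hilbert_iso M (axis i ` M) (axis i :: 'a::chilbert_space \<Rightarrow> 'a ^ 'n::finite)"
  unfolding hilbert_iso_def
  using M by (auto simp: axis_def vec_eq_iff scaleC_vec_def norm_vec_def L2_set_def
      if_distrib[where f = "\<lambda>v. (norm v)\<^sup>2"] cong: if_cong)

text \<open>The intertwining unitaries are kept explicit, since \<open>coincide\<close> would hide
  them and the supplement for shifts and spherical co-isometries needs the very W and W' of the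
  factorization.\<close>

lemma triangular_intertwiners:
  fixes T :: "'n::finite \<Rightarrow> 'a::chilbert_space \<times> 'b::chilbert_space \<times> 'c::chilbert_space \<Rightarrow> 'a \<times> 'b \<times> 'c"
  assumes T: "commuting_row_contraction T"
    and triangular: "\<And>i. upper_triangular3 (T i) (S i) (N i) (C i)"
  shows "commuting_row_contraction S" "commuting_row_contraction N" "commuting_row_contraction C"
    and "\<exists>(\<E>\<^sub>1 :: (('a \<times> 'b \<times> 'c) ^ 'n) set) (\<E>\<^sub>2 :: (('a \<times> 'b \<times> 'c) ^ 'n) set)
        (\<E> :: (('a \<times> 'b \<times> 'c) ^ 'n) set) U\<^sub>1 U\<^sub>2 W W'.
        closed_csubspace \<E>\<^sub>1 \<and> closed_csubspace \<E>\<^sub>2 \<and> closed_csubspace \<E> \<and>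
        hilbert_iso (defect_star_space N \<times> \<E>) (defect_space C \<times> \<E>\<^sub>1) U\<^sub>1 \<and>
        hilbert_iso (defect_star_space S \<times> \<E>\<^sub>2) (defect_space N \<times> \<E>) U\<^sub>2 \<and>
        hilbert_iso (defect_space T) (defect_space S \<times> \<E>\<^sub>2) W \<and>
        hilbert_iso (defect_star_space T) (defect_star_space C \<times> \<E>\<^sub>1) W' \<and>
        (\<forall>f\<in>h2_space (defect_space T). ampliation W' (char_op T f) =
          (block_diag (char_op C) id \<circ> ampliation U\<^sub>1 \<circ> block_diag (char_op N) id \<circ>
           ampliation U\<^sub>2 \<circ> block_diag (char_op S) id) (ampliation W f))" (is ?factorization)
proof -
  interpret T: row_contraction T by unfold_locales (rule T)
  note tri = upper_triangular3D[OF triangular]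
  have TT: "T i (T j x) = T j (T i x)" for i j x
    using T unfolding commuting_row_contraction_def by (metis comp_apply)
  define Ja :: "'a \<Rightarrow> 'a \<times> 'b \<times> 'c" where "Ja = (\<lambda>h. (h, 0, 0))"
  define Jb :: "'b \<Rightarrow> 'a \<times> 'b \<times> 'c" where "Jb = (\<lambda>h. (0, h, 0))"
  define Jc :: "'c \<Rightarrow> 'a \<times> 'b \<times> 'c" where "Jc = (\<lambda>h. (0, 0, h))"
  define pa :: "'a \<times> 'b \<times> 'c \<Rightarrow> 'a" where "pa = fst"
  define pb :: "'a \<times> 'b \<times> 'c \<Rightarrow> 'b" where "pb = (\<lambda>x. fst (snd x))"
  define pc :: "'a \<times> 'b \<times> 'c \<Rightarrow> 'c" where "pc = (\<lambda>x. snd (snd x))"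
  note defs = Ja_def Jb_def Jc_def pa_def pb_def pc_def
  have bJ: "bop Ja" "bop Jb" "bop Jc"
    unfolding Ja_def Jb_def Jc_def by (intro bop_Pair bop_id bop_const_0)+
  have bp: "bop pa" "bop pb" "bop pc"
    unfolding pa_def pb_def pc_def by (intro bop_fst bop_compose[OF bop_fst bop_snd] bop_compose[OF bop_snd bop_snd])+
  have adj: "inner (Ja x) v = inner x (pa v)" "inner (Jb y) v = inner y (pb v)" "inner (Jc z) v = inner z (pc v)"
    for x y z v by (simp_all add: defs inner_prod_def)
  have pJ: "pa (Ja x) = x" "pb (Jb y) = y" "pc (Jc z) = z" for x y z by (simp_all add: defs)
  have TN: "T i (x, y, 0) = (fst (T i (x, y, 0)), N i y, 0)" for i x y
    using tri(5)[of i x y] by (metis prod.collapse)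
  have A: "S i x = pa (T i (Ja x))" "N i y = pb (T i (Jb y))" "C i z = pc (T i (Jc z))" for i x y z
    by (simp_all add: defs tri(4-6))
  have comm: "S i (S j x) = S j (S i x)" "N i (N j y) = N j (N i y)" "C i (C j z) = C j (C i z)" for i j x y z
  proof -
    show "S i (S j x) = S j (S i x)"
      using TT[of i j "(x, 0, 0)"] by (simp add: tri(4))
    show "N i (N j y) = N j (N i y)"
      using arg_cong[OF TT[of i j "(0, y, 0)"], of snd] tri(5) TN by (metis prod.inject)
    show "C i (C j z) = C j (C i z)"
      using arg_cong[OF TT[of i j "(0, 0, z)"], of "\<lambda>x. snd (snd x)"] by (simp add: tri(6))
  qed
  note cS = compression_row_contraction[OF T bJ(1) bp(1) adj(1) pJ(1) A(1) comm(1)]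
  note cN = compression_row_contraction[OF T bJ(2) bp(2) adj(2) pJ(2) A(2) comm(2)]
  note cC = compression_row_contraction[OF T bJ(3) bp(3) adj(3) pJ(3) A(3) comm(3)]
  show S: "commuting_row_contraction S" and N: "commuting_row_contraction N" and C: "commuting_row_contraction C"
    by (rule cS(1) cN(1) cC(1))+
  \<comment> \<open>K1 and K2 are the complements of the first block and of the first two blocks.
    Upper triangularity makes them invariant under the adjoints, as tested by moving the adjoint
    onto vectors of the removed block.\<close>
  define K1 :: "('a \<times> 'b \<times> 'c) set" where "K1 = {x\<in>UNIV. pa x = 0}"
  define K2 :: "('a \<times> 'b \<times> 'c) set" where "K2 = {x\<in>K1. pb x = 0}"
  have K3: "{0} = {x\<in>K2. pc x = 0}" by (auto simp: K2_def K1_def defs prod_eq_iff)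
  have cK1: "closed_csubspace K1" unfolding K1_def by (rule closed_csubspace_kernel[OF closed_csubspace_UNIV bp(1)])
  have cK2: "closed_csubspace K2" unfolding K2_def by (rule closed_csubspace_kernel[OF cK1 bp(2)])
  have adjT: "inner u (adj (T i) x) = inner (T i u) x" for u i x by (simp add: inner_adj[OF T.bop_T])
  have inv1: "adj (T i) x \<in> K1" if "x \<in> K1" for i x
  proof -
    have "inner (pa (adj (T i) x)) (pa (adj (T i) x)) = 0"
      using that by (simp add: adjT K1_def flip: adj) (simp add: defs tri(4) inner_prod_def)
    then show ?thesis by (simp add: K1_def)
  qed
  have inv2: "adj (T i) x \<in> K2" if "x \<in> K2" for i x
  proof -
    have "inner (pb (adj (T i) x)) (pb (adj (T i) x)) = 0"
      using that by (simp add: adjT K1_def K2_def flip: adj) (simp add: defs, subst TN, simp add: inner_prod_def)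
    then show ?thesis using inv1 that by (simp add: K2_def)
  qed
  have inv3: "adj (T i) x \<in> {0}" if "x \<in> {0}" for i x
    using that bop_zero[OF bop_adj[OF T.bop_T]] by simp
  interpret P1: peeling T Ja pa UNIV K1
    by unfold_locales (auto simp: bJ bp adj pJ closed_csubspace_UNIV K1_def intro: inv1[unfolded K1_def, simplified])
  interpret P2: peeling T Jb pb K1 K2
    by unfold_locales (use cK1 inv1 inv2 in \<open>auto simp: bJ bp adj pJ K2_def\<close>, auto simp: K1_def defs)
  interpret P3: peeling T Jc pc K2 "{0}"
    by unfold_locales (use cK2 inv2 inv3 K3 in \<open>auto simp: bJ bp adj pJ\<close>, auto simp: K1_def K2_def defs)
  define G0 G1 G2 G3 where G_def: "G0 = mid_space T UNIV" "G1 = mid_space T K1"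
    "G2 = mid_space T K2" "G3 = mid_space T {0}"
  have c0: "closed_csubspace {0::'a \<times> 'b \<times> 'c}"
    by (simp add: closed_csubspace_def)
  have cG: "closed_csubspace G0" "closed_csubspace G1" "closed_csubspace G2" "closed_csubspace G3"
    unfolding G_def by (intro T.closed_csubspace_mid_space closed_csubspace_UNIV cK1 cK2 c0)+
  have bker: "bop (\<lambda>g. fst (peel T Ja pa (0, g)))" "bop (\<lambda>g. fst (peel T Jb pb (0, g)))"
    "bop (\<lambda>g. fst (peel T Jc pc (0, g)))"
    by (intro bop_compose[OF bop_fst] bop_compose[OF P1.bop_peel] bop_compose[OF P2.bop_peel]
        bop_compose[OF P3.bop_peel] bop_intros)+
  note cker = closed_csubspace_kernel[OF cG(1) bker(1)] closed_csubspace_kernel[OF cG(2) bker(2)]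
    closed_csubspace_kernel[OF cG(3) bker(3)]
  have h0: "halmos T (0, 0) = 0"
    using bop_zero[OF T.bop_halmos] by (simp add: zero_prod_def)
  have ker2: "(\<forall>i. pb (fst g $ i) = 0)" if "fst (peel T Jb pb (0, g)) = 0" for g
    using that by (simp add: P2.peel_eq Let_def bop_zero[OF bJ(2)] h0 vec_eq_iff)
  have ker3: "(\<forall>i. pc (fst g $ i) = 0)" if "fst (peel T Jc pc (0, g)) = 0" for g
    using that by (simp add: P3.peel_eq Let_def bop_zero[OF bJ(3)] h0 vec_eq_iff)
  \<comment> \<open>Any coordinate serves to receive a copy of H inside H^n.\<close>
  fix i0 :: 'n
  define v0 where "v0 = (\<lambda>e. halmos T (0, e))"
  have v0: "hilbert_iso (defect_space T) G0 v0"
    unfolding v0_def G_def by (rule T.hilbert_iso_mid_UNIV)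
  \<comment> \<open>This kernel lies in G0, which \<open>v0\<close> identifies with the defect space
    of T; the inverse of \<open>v0\<close> carries it into H^n.\<close>
  obtain \<kappa>1 and E2 :: "(('a \<times> 'b \<times> 'c) ^ 'n) set" where \<kappa>1: "hilbert_iso {g\<in>G0. fst (peel T Ja pa (0, g)) = 0} E2 \<kappa>1"
    using hilbert_iso_subset[OF hilbert_iso_inv[OF v0] cker(1)] by blast
  txt \<open>The kernel in the middle step lies in \<open>\<H>\<^sup>n \<oplus> \<H>\<close>. The contraction \<open>j\<close> is injective on it, so the
    isometric factor of its polar decomposition embeds the kernel into \<open>\<H>\<^sup>n\<close>.\<close>
  define j :: "(('a \<times> 'b \<times> 'c) ^ 'n) \<times> 'a \<times> 'b \<times> 'c \<Rightarrow> ('a \<times> 'b \<times> 'c) ^ 'n"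
    where "j g = (\<chi> i. (if i = i0 then pa (defect_star T (snd g)) else 0, 0, pc (fst g $ i)))" for g
  have bj: "bop j"
  proof -
    have "bop (\<lambda>g. if i = i0 then pa (defect_star T (snd g)) else 0)"
      for i and g :: "(('a \<times> 'b \<times> 'c) ^ 'n) \<times> 'a \<times> 'b \<times> 'c"
      by (cases "i = i0") (simp_all add: bop_const_0 bop_compose[OF bp(1) bop_compose[OF T.bop_defect_star bop_snd]])
    then show ?thesis
      unfolding j_def[abs_def]
      by (intro bop_vec bop_Pair bop_const_0 bop_compose[OF bp(3)] bop_compose[OF bop_nth bop_fst])
  qed
  have nj: "norm (j g) \<le> norm g" for g
  proof (rule power2_le_imp_le)
    have "(norm (j g))\<^sup>2 = (norm (pa (defect_star T (snd g))))\<^sup>2 + (\<Sum>i\<in>UNIV. (norm (pc (fst g $ i)))\<^sup>2)"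
      by (simp add: norm_vec_sq norm_prod_sq j_def sum.distrib if_distrib[where f = "\<lambda>v. (norm v)\<^sup>2"] cong: if_cong)
    also have "\<dots> \<le> (norm (snd g))\<^sup>2 + (\<Sum>i\<in>UNIV. (norm (fst g $ i))\<^sup>2)"
    proof (intro add_mono sum_mono)
      have "(norm (pa (defect_star T (snd g))))\<^sup>2 \<le> (norm (defect_star T (snd g)))\<^sup>2"
        by (simp add: norm_prod_sq pa_def)
      also have "\<dots> \<le> (norm (snd g))\<^sup>2" by (simp add: T.norm_defect_star)
      finally show "(norm (pa (defect_star T (snd g))))\<^sup>2 \<le> (norm (snd g))\<^sup>2" .
      show "(norm (pc (fst g $ i)))\<^sup>2 \<le> (norm (fst g $ i))\<^sup>2" for i
        by (simp add: norm_prod_sq pc_def)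
    qed
    also have "\<dots> = (norm g)\<^sup>2" by (simp add: norm_prod_sq norm_vec_sq)
    finally show "(norm (j g))\<^sup>2 \<le> (norm g)\<^sup>2" .
  qed simp
  \<comment> \<open>For g in the kernel the first two blocks of \<open>fst g\<close> vanish by
    membership in G1 and by \<open>ker2\<close>, and j records the third; so j g = 0 gives
    \<open>fst g = 0\<close>. Then the star defect of \<open>snd g\<close> is orthogonal to K1,
    while the i0 entry of j puts it into K1, so it is 0. As \<open>snd g\<close> lies in the closure
    of the range of that operator, it is 0 too.\<close>
  have j_inj: "g = 0" if g: "g \<in> {g\<in>G1. fst (peel T Jb pb (0, g)) = 0}" and jg: "j g = 0" for g
  proof -
    have comps: "pa (fst g $ i) = 0" "pb (fst g $ i) = 0" for i
      using g ker2 by (auto simp: G_def mid_space_def K1_def)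
    have "pc (fst g $ i) = snd (snd (j g $ i))" for i by (simp add: j_def)
    then have pcs: "pc (fst g $ i) = 0" for i by (simp add: jg)
    have "pa (defect_star T (snd g)) = fst (j g $ i0)" by (simp add: j_def)
    then have pas: "pa (defect_star T (snd g)) = 0" by (simp add: jg)
    have fg: "fst g = 0"
      using comps pcs by (simp add: vec_eq_iff defs prod_eq_iff)
    have D: "inner (defect_star T (snd g)) h = 0" if "h \<in> K1" for h
    proof -
      have "inner g (halmos T (h, 0)) = 0" using g that by (simp add: G_def mid_space_def)
      then show ?thesis
        by (simp add: inner_prod_def[of g] fg halmos_def bop_zero[OF T.bop_rowT] T.inner_defect_star)
    qed
    have "defect_star T (snd g) \<in> K1" using pas by (simp add: K1_def)
    from D[OF this] have "defect_star T (snd g) = 0" by simp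
    then have "inner (snd g) (defect_star T h) = 0" for h
      by (simp flip: T.inner_defect_star)
    then have "defect_star_space T \<subseteq> {x. inner (snd g) x = 0}"
      unfolding defect_star_space_def
      by (intro closure_minimal closed_Collect_eq continuous_intros) auto
    then have "inner (snd g) (snd g) = 0" using g by (auto simp: G_def mid_space_def)
    then show ?thesis using fg by (simp add: prod_eq_iff)
  qed
  obtain \<kappa>2 and E :: "(('a \<times> 'b \<times> 'c) ^ 'n) set" where \<kappa>2: "hilbert_iso {g\<in>G1. fst (peel T Jb pb (0, g)) = 0} E \<kappa>2"
    using polar_embedding[OF cker(2) bj nj j_inj] by blast
  \<comment> \<open>In the last stage all three blocks of \<open>fst g\<close> vanish on the kernel,
    which is therefore a copy of a subspace of H and fits into coordinate i0.\<close>
  have snd_iso: "hilbert_iso {g\<in>G2. fst (peel T Jc pc (0, g)) = 0} (snd ` {g\<in>G2. fst (peel T Jc pc (0, g)) = 0}) snd"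
    unfolding hilbert_iso_def
  proof (intro conjI ballI allI cker(3))
    fix g assume g: "g \<in> {g\<in>G2. fst (peel T Jc pc (0, g)) = 0}"
    have "pa (fst g $ i) = 0" "pb (fst g $ i) = 0" "pc (fst g $ i) = 0" for i
      using g ker3 by (auto simp: G_def mid_space_def K1_def K2_def)
    then have "fst g = 0" by (simp add: vec_eq_iff defs prod_eq_iff)
    then show "norm (snd g) = norm g" by (simp add: norm_prod_def)
  qed (simp_all add: scaleC_prod_def)
  obtain \<kappa>3 and E1 :: "(('a \<times> 'b \<times> 'c) ^ 'n) set" where \<kappa>3: "hilbert_iso {g\<in>G2. fst (peel T Jc pc (0, g)) = 0} E1 \<kappa>3"
    using hilbert_iso_compose[OF snd_iso hilbert_iso_axis[OF hilbert_iso_closed_image[OF snd_iso], of i0]] by blast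
  have bSNC: "bop (S i)" "bop (N i)" "bop (C i)" for i by (rule tri)+
  obtain \<tau>1 \<tau>1' where \<tau>1: "hilbert_iso G0 (defect_space S \<times> E2) \<tau>1" "hilbert_iso G1 (defect_star_space S \<times> E2) \<tau>1'"
    and int1: "\<And>h e. e \<in> G0 \<Longrightarrow> halmos S (h, fst (\<tau>1 e)) = (fst (peel T Ja pa (h, e)), fst (\<tau>1' (snd (peel T Ja pa (h, e)))))"
    "\<And>h e. e \<in> G0 \<Longrightarrow> snd (\<tau>1' (snd (peel T Ja pa (h, e)))) = snd (\<tau>1 e)"
    using unitary_colligation[OF S P1.bop_peel cG(1,2) P1.norm_peel[folded G_def] P1.peel_image[folded G_def]
        P1.fst_peel[of S, OF cS(2) bSNC(1)] \<kappa>1] by blast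
  obtain \<tau>2 \<tau>2' where \<tau>2: "hilbert_iso G1 (defect_space N \<times> E) \<tau>2" "hilbert_iso G2 (defect_star_space N \<times> E) \<tau>2'"
    and int2: "\<And>h e. e \<in> G1 \<Longrightarrow> halmos N (h, fst (\<tau>2 e)) = (fst (peel T Jb pb (h, e)), fst (\<tau>2' (snd (peel T Jb pb (h, e)))))"
    "\<And>h e. e \<in> G1 \<Longrightarrow> snd (\<tau>2' (snd (peel T Jb pb (h, e)))) = snd (\<tau>2 e)"
    using unitary_colligation[OF N P2.bop_peel cG(2,3) P2.norm_peel[folded G_def] P2.peel_image[folded G_def]
        P2.fst_peel[of N, OF cN(2) bSNC(2)] \<kappa>2] by blast
  obtain \<tau>3 \<tau>3' where \<tau>3: "hilbert_iso G2 (defect_space C \<times> E1) \<tau>3" "hilbert_iso G3 (defect_star_space C \<times> E1) \<tau>3'"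
    and int3: "\<And>h e. e \<in> G2 \<Longrightarrow> halmos C (h, fst (\<tau>3 e)) = (fst (peel T Jc pc (h, e)), fst (\<tau>3' (snd (peel T Jc pc (h, e)))))"
    "\<And>h e. e \<in> G2 \<Longrightarrow> snd (\<tau>3' (snd (peel T Jc pc (h, e)))) = snd (\<tau>3 e)"
    using unitary_colligation[OF C P3.bop_peel cG(3,4) P3.norm_peel[folded G_def] P3.peel_image[folded G_def]
        P3.fst_peel[of C, OF cC(2) bSNC(3)] \<kappa>3] by blast
  define U2 where "U2 = (\<lambda>u. \<tau>2 (inv_into G1 \<tau>1' u))"
  define U1 where "U1 = (\<lambda>u. \<tau>3 (inv_into G2 \<tau>2' u))"
  define W where "W = (\<lambda>e. \<tau>1 (v0 e))"
  define W' where "W' = (\<lambda>d. \<tau>3' (0, d))"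
  have U2: "hilbert_iso (defect_star_space S \<times> E2) (defect_space N \<times> E) U2"
    unfolding U2_def by (rule hilbert_iso_compose[OF hilbert_iso_inv[OF \<tau>1(2)] \<tau>2(1)])
  have U1: "hilbert_iso (defect_star_space N \<times> E) (defect_space C \<times> E1) U1"
    unfolding U1_def by (rule hilbert_iso_compose[OF hilbert_iso_inv[OF \<tau>2(2)] \<tau>3(1)])
  have W: "hilbert_iso (defect_space T) (defect_space S \<times> E2) W"
    unfolding W_def by (rule hilbert_iso_compose[OF v0 \<tau>1(1)])
  have W': "hilbert_iso (defect_star_space T) (defect_star_space C \<times> E1) W'"
    unfolding W'_def by (rule hilbert_iso_compose[OF T.hilbert_iso_mid_0[folded G_def] \<tau>3(2)])
  have cE: "closed_csubspace E1" "closed_csubspace E2" "closed_csubspace E"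
    using hilbert_iso_closed_image \<kappa>1 \<kappa>2 \<kappa>3 by blast+

  \<comment> \<open>The factorization along a trajectory\<close>
  have fact: "ampliation W' (char_op T f) =
      (block_diag (char_op C) id \<circ> ampliation U1 \<circ> block_diag (char_op N) id \<circ>
       ampliation U2 \<circ> block_diag (char_op S) id) (ampliation W f)"
    if f: "f \<in> h2_space (defect_space T)" for f
  proof -
    define y where "y = coeff (char_op T f)"
    obtain x where x: "traj (halmos T) (coeff f) x y"
      using T.char_op_traj[of f] unfolding y_def by blast
    define g0 where "g0 = (\<lambda>\<alpha>. v0 (coeff f \<alpha>))"
    define g1 where "g1 = (\<lambda>\<alpha>. snd (peel T Ja pa (pa (x \<alpha>), g0 \<alpha>)))"
    define x1 where "x1 = (\<lambda>\<alpha>. P1.q (x \<alpha>))"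
    define g2 where "g2 = (\<lambda>\<alpha>. snd (peel T Jb pb (pb (x1 \<alpha>), g1 \<alpha>)))"
    define x2 where "x2 = (\<lambda>\<alpha>. P2.q (x1 \<alpha>))"
    define g3 where "g3 = (\<lambda>\<alpha>. snd (peel T Jc pc (pc (x2 \<alpha>), g2 \<alpha>)))"
    define x3 where "x3 = (\<lambda>\<alpha>. P3.q (x2 \<alpha>))"
    have xK: "x1 \<alpha> \<in> K1" "x2 \<alpha> \<in> K2" "x3 \<alpha> \<in> {0}" for \<alpha>
    proof -
      show x1: "x1 \<alpha> \<in> K1" unfolding x1_def by (rule P1.q_in) simp
      show x2: "x2 \<alpha> \<in> K2" unfolding x2_def by (rule P2.q_in[OF x1])
      show "x3 \<alpha> \<in> {0}" unfolding x3_def by (rule P3.q_in[OF x2])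
    qed
    have t0: "traj (\<lambda>(h, g). halmos T (h, 0) + g) g0 x y"
      unfolding g0_def v0_def by (rule T.traj_mid_UNIV[OF x])
    note t1 = P1.peel_traj[OF t0, folded g1_def x1_def, OF UNIV_I]
    note t2 = P2.peel_traj[OF t1(2), folded g2_def x2_def, OF xK(1)]
    note t3 = P3.peel_traj[OF t2(2), folded g3_def x3_def, OF xK(2)]
    have g0: "g0 \<alpha> \<in> G0" for \<alpha>
      unfolding g0_def by (rule hilbert_isoD(6)[OF v0 h2_spaceD[OF f]])
    have peel_in: "snd (peel T Ja pa (h, g)) \<in> G1" if "g \<in> G0" for h g
    proof -
      have "peel T Ja pa (h, g) \<in> UNIV \<times> G1"
        unfolding P1.peel_image[folded G_def, symmetric] using that by blast
      then show ?thesis by (simp add: mem_Times_iff)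
    qed
    have peel_in2: "snd (peel T Jb pb (h, g)) \<in> G2" if "g \<in> G1" for h g
    proof -
      have "peel T Jb pb (h, g) \<in> UNIV \<times> G2"
        unfolding P2.peel_image[folded G_def, symmetric] using that by blast
      then show ?thesis by (simp add: mem_Times_iff)
    qed
    have g1: "g1 \<alpha> \<in> G1" for \<alpha> unfolding g1_def by (rule peel_in[OF g0])
    have g2: "g2 \<alpha> \<in> G2" for \<alpha> unfolding g2_def by (rule peel_in2[OF g1])
    \<comment> \<open>After the third stage no state is left, so the intermediate sequence has
      become the output of the whole system.\<close>
    have g3: "g3 \<alpha> = (0, y \<alpha>)" for \<alpha>
    proof -
      have "y \<alpha> = snd (g3 \<alpha>)"
        using trajD(2)[OF t3(2), of \<alpha>] xK(3)[of \<alpha>] by (simp add: h0)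
      moreover have "peel T Jc pc (pc (x2 \<alpha>), g2 \<alpha>) \<in> UNIV \<times> G3"
        unfolding P3.peel_image[folded G_def, symmetric] using g2[of \<alpha>] by blast
      then have "g3 \<alpha> \<in> G3" by (simp add: g3_def mem_Times_iff)
      then have "fst (g3 \<alpha>) = 0" by (simp add: G_def mid_space_def vec_eq_iff)
      ultimately show ?thesis by (simp add: prod_eq_iff)
    qed
    note bd = hilbert_iso_bounded_op
    define u0 where "u0 = ampliation W f"
    have u0: "coeff u0 \<alpha> = \<tau>1 (g0 \<alpha>)" for \<alpha>
      unfolding u0_def by (simp add: coeff_ampliation[OF bd[OF W] f], simp add: W_def g0_def)
    define u1 where "u1 = block_diag (char_op S) id u0"
    have u1: "coeff u1 \<alpha> = \<tau>1' (g1 \<alpha>)" for \<alpha>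
      unfolding u1_def by (rule block_diag_char_op_traj[OF S t1(1) g0 int1 u0])
    have "u1 \<in> h2_space (defect_star_space S \<times> E2)"
      using hilbert_isoD(6)[OF \<tau>1(2) g1] by (simp add: h2_space_def u1)
    then have v1: "coeff (ampliation U2 u1) \<alpha> = \<tau>2 (g1 \<alpha>)" for \<alpha>
      by (simp add: coeff_ampliation[OF bd[OF U2]] u1,
          simp add: U2_def hilbert_iso_inv_into(1)[OF \<tau>1(2) g1])
    define u2 where "u2 = block_diag (char_op N) id (ampliation U2 u1)"
    have u2: "coeff u2 \<alpha> = \<tau>2' (g2 \<alpha>)" for \<alpha>
      unfolding u2_def by (rule block_diag_char_op_traj[OF N t2(1) g1 int2 v1])
    have "u2 \<in> h2_space (defect_star_space N \<times> E)"
      using hilbert_isoD(6)[OF \<tau>2(2) g2] by (simp add: h2_space_def u2)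
    then have v2: "coeff (ampliation U1 u2) \<alpha> = \<tau>3 (g2 \<alpha>)" for \<alpha>
      by (simp add: coeff_ampliation[OF bd[OF U1]] u2,
          simp add: U1_def hilbert_iso_inv_into(1)[OF \<tau>2(2) g2])
    have "coeff (block_diag (char_op C) id (ampliation U1 u2)) \<alpha> = \<tau>3' (g3 \<alpha>)" for \<alpha>
      by (rule block_diag_char_op_traj[OF C t3(1) g2 int3 v2])
    moreover have "coeff (ampliation W' (char_op T f)) \<alpha> = \<tau>3' (g3 \<alpha>)" for \<alpha>
      by (simp add: coeff_ampliation[OF bd[OF W'] T.char_op_in[OF f]], simp add: g3 W'_def y_def)
    ultimately have "ampliation W' (char_op T f) = block_diag (char_op C) id (ampliation U1 u2)"
      by (intro h2_eqI) simp
    then show ?thesis by (simp add: u2_def u1_def u0_def)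
  qed
  show ?factorization
    using cE U1 U2 W W' fact
    by (intro exI[of _ E1] exI[of _ E2] exI[of _ E] exI[of _ U1] exI[of _ U2] exI[of _ W] exI[of _ W'] conjI ballI)
qed

lemma bounded_op_zero_snd: "0 \<in> A' \<Longrightarrow> bounded_op (A \<times> B) (A' \<times> B) (\<lambda>p. (0, snd p))"
  unfolding bounded_op_def
  by (auto simp: scaleC_prod_def norm_Pair intro!: exI[of _ 1])

lemma bounded_op_fst_zero: "0 \<in> B' \<Longrightarrow> bounded_op (A \<times> B) (A \<times> B') (\<lambda>p. (fst p, 0))"
  unfolding bounded_op_def
  by (auto simp: scaleC_prod_def norm_Pair intro!: exI[of _ 1])

lemma coisometry_op_ampliation:
  assumes E: "closed_csubspace E" and F: "closed_csubspace F"
    and A: "bounded_op E F A" and B: "bounded_op F E B"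
    and adj: "\<And>x y. x \<in> E \<Longrightarrow> y \<in> F \<Longrightarrow> cinner (A x) y = cinner x (B y)"
    and AB: "\<And>y. y \<in> F \<Longrightarrow> A (B y) = y"
  shows "coisometry_op (h2_space E) (h2_space F) (ampliation A)"
  unfolding coisometry_op_def
proof (intro conjI ballI bounded_op_ampliation[OF E A])
  fix y assume y: "y \<in> h2_space F"
  have By: "ampliation B y \<in> h2_space E"
    by (rule bounded_opD(1)[OF bounded_op_ampliation[OF F B] y])
  have "adj_on (h2_space E) (h2_space F) (ampliation A) y = ampliation B y"
    by (rule adj_on_eqI[OF closed_csubspace_h2_space[OF E] By]) (rule cinner_h2_ampliation[OF A B _ y adj])
  moreover have "ampliation A (ampliation B y) = y"
    by (rule h2_eqI) (simp add: coeff_ampliation[OF A By] coeff_ampliation[OF B y] AB h2_spaceD[OF y])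
  ultimately show "ampliation A (adj_on (h2_space E) (h2_space F) (ampliation A) y) = y" by simp
qed

text \<open>P is meant as the projection onto the kernel of A. A vector orthogonal to the kernel of
  the ampliation is orthogonal to its own image under the ampliation of P; that image then has norm
  0, so P kills every coefficient and A preserves its norm.\<close>

lemma partial_isometry_op_ampliation:
  assumes E: "closed_csubspace E" and A: "bounded_op E F A" and P: "bounded_op E E P"
    and AP: "\<And>x. x \<in> E \<Longrightarrow> A (P x) = 0" and inn: "\<And>x. x \<in> E \<Longrightarrow> inner x (P x) = (norm (P x))\<^sup>2"
    and nA: "\<And>x. x \<in> E \<Longrightarrow> P x = 0 \<Longrightarrow> norm (A x) = norm x"
  shows "partial_isometry_op (h2_space E) (h2_space F) (ampliation A)"
  unfolding partial_isometry_op_def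
proof (intro conjI ballI impI bounded_op_ampliation[OF E A])
  fix x assume x: "x \<in> h2_space E" and ker: "\<forall>k\<in>h2_space E. ampliation A k = 0 \<longrightarrow> cinner x k = 0"
  have Px: "ampliation P x \<in> h2_space E"
    by (rule bounded_opD(1)[OF bounded_op_ampliation[OF E P] x])
  have "ampliation A (ampliation P x) = 0"
    by (rule h2_eqI) (simp add: coeff_ampliation[OF A Px] coeff_ampliation[OF P x] AP h2_spaceD[OF x] coeff_zero)
  then have "inner x (ampliation P x) = 0"
    using ker Px by (simp flip: Re_cinner)
  moreover have "inner x (ampliation P x) = (norm (ampliation P x))\<^sup>2"
    unfolding inner_h2_def norm_h2_sq
    by (intro infsum_cong) (simp add: coeff_ampliation[OF P x] inn h2_spaceD[OF x])
  ultimately have "ampliation P x = 0" by simp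
  then have "P (coeff x \<alpha>) = 0" for \<alpha>
    using coeff_ampliation[OF P x, of \<alpha>] by (simp add: coeff_zero)
  then show "norm (ampliation A x) = norm x"
    unfolding norm_h2_def by (simp add: coeff_ampliation[OF A x] nA h2_spaceD[OF x])
qed

theorem theorem5p3:
  fixes T :: "'n::finite \<Rightarrow> 'a::chilbert_space \<times> 'b::chilbert_space \<times> 'c::chilbert_space \<Rightarrow> 'a \<times> 'b \<times> 'c"
    and S :: "'n \<Rightarrow> 'a \<Rightarrow> 'a"
    and N :: "'n \<Rightarrow> 'b \<Rightarrow> 'b"
    and C :: "'n \<Rightarrow> 'c \<Rightarrow> 'c"
  assumes T: "commuting_row_contraction T"
    and triangular: "\<And>i. upper_triangular3 (T i) (S i) (N i) (C i)"
  shows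
    "commuting_row_contraction S \<and> commuting_row_contraction N \<and> commuting_row_contraction C \<and>
     (\<exists>(\<E>\<^sub>1 :: (('a \<times> 'b \<times> 'c) ^ 'n) set) (\<E>\<^sub>2 :: (('a \<times> 'b \<times> 'c) ^ 'n) set)
        (\<E> :: (('a \<times> 'b \<times> 'c) ^ 'n) set) U\<^sub>1 U\<^sub>2.
        closed_csubspace \<E>\<^sub>1 \<and> closed_csubspace \<E>\<^sub>2 \<and> closed_csubspace \<E> \<and>
        unitary_op (defect_star_space N \<times> \<E>) (defect_space C \<times> \<E>\<^sub>1) U\<^sub>1 \<and>
        unitary_op (defect_star_space S \<times> \<E>\<^sub>2) (defect_space N \<times> \<E>) U\<^sub>2 \<and>
        coincide (defect_space T) (defect_star_space T) (char_op T)
          (defect_space S \<times> \<E>\<^sub>2) (defect_star_space C \<times> \<E>\<^sub>1)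
          (block_diag (char_op C) id \<circ> ampliation U\<^sub>1 \<circ> block_diag (char_op N) id \<circ>
           ampliation U\<^sub>2 \<circ> block_diag (char_op S) id)) \<and>
     ((\<exists>\<W> :: 'w::chilbert_space set. closed_csubspace \<W> \<and> drury_arveson_shift_on \<W> S) \<and>
      spherical_coisometry C \<longrightarrow>
      (\<exists>(\<E> :: (('a \<times> 'b \<times> 'c) ^ 'n) set) G\<^sub>1 G\<^sub>2.
         closed_csubspace \<E> \<and>
         coisometry_op (h2_space (defect_star_space N \<times> \<E>)) (h2_space (defect_star_space T)) G\<^sub>1 \<and>
         partial_isometry_op (h2_space (defect_space T)) (h2_space (defect_space N \<times> \<E>)) G\<^sub>2 \<and>
         (\<forall>f\<in>h2_space (defect_space T).
            char_op T f = (G\<^sub>1 \<circ> block_diag (char_op N) id \<circ> G\<^sub>2) f)))"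
proof -
  note tri = triangular_intertwiners[OF T triangular]
  interpret T: row_contraction T by unfold_locales (rule T)
  interpret S: row_contraction S by unfold_locales (rule tri(1))
  interpret N: row_contraction N by unfold_locales (rule tri(2))
  interpret C: row_contraction C by unfold_locales (rule tri(3))
  obtain \<E>\<^sub>1 \<E>\<^sub>2 \<E> :: "(('a \<times> 'b \<times> 'c) ^ 'n) set" and U\<^sub>1 U\<^sub>2 W W' where
    cE: "closed_csubspace \<E>\<^sub>1" "closed_csubspace \<E>\<^sub>2" "closed_csubspace \<E>"
    and U\<^sub>1: "hilbert_iso (defect_star_space N \<times> \<E>) (defect_space C \<times> \<E>\<^sub>1) U\<^sub>1"
    and U\<^sub>2: "hilbert_iso (defect_star_space S \<times> \<E>\<^sub>2) (defect_space N \<times> \<E>) U\<^sub>2"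
    and W: "hilbert_iso (defect_space T) (defect_space S \<times> \<E>\<^sub>2) W"
    and W': "hilbert_iso (defect_star_space T) (defect_star_space C \<times> \<E>\<^sub>1) W'"
    and fact: "\<And>f. f \<in> h2_space (defect_space T) \<Longrightarrow> ampliation W' (char_op T f) =
          (block_diag (char_op C) id \<circ> ampliation U\<^sub>1 \<circ> block_diag (char_op N) id \<circ>
           ampliation U\<^sub>2 \<circ> block_diag (char_op S) id) (ampliation W f)"
    using tri(4) by blast
  define M where "M = (block_diag (char_op C) id \<circ> ampliation U\<^sub>1 \<circ> block_diag (char_op N) id \<circ>
           ampliation U\<^sub>2 \<circ> block_diag (char_op S) id)"
  note iW = hilbert_iso_inv[OF W] and iW' = hilbert_iso_inv[OF W'] and iU = hilbert_iso_inv[OF U\<^sub>1]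
  note bd = hilbert_iso_bounded_op
  note cT = T.closed_csubspace_defect_space T.closed_csubspace_defect_star_space
  have cF: "closed_csubspace (defect_space S \<times> \<E>\<^sub>2)" by (rule hilbert_iso_closed_image[OF W])
  \<comment> \<open>No estimate of the five factors is made: on this space M agrees with the
    characteristic operator of T conjugated by the ampliations of W and W'.\<close>
  have "bounded_op (h2_space (defect_space S \<times> \<E>\<^sub>2)) (h2_space (defect_star_space C \<times> \<E>\<^sub>1)) M"
  proof (rule bounded_op_cong[OF closed_csubspace_h2_space[OF cF]])
    show "bounded_op (h2_space (defect_space S \<times> \<E>\<^sub>2)) (h2_space (defect_star_space C \<times> \<E>\<^sub>1))
        (\<lambda>g. ampliation W' (char_op T (ampliation (inv_into (defect_space T) W) g)))"
      by (intro bounded_op_compose[OF bounded_op_compose[OF bounded_op_ampliation[OF cF bd[OF iW]] T.bounded_op_char_op]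
            bounded_op_ampliation[OF cT(2) bd[OF W']]])
    fix g :: "('n, ('a ^ 'n) \<times> (('a \<times> 'b \<times> 'c) ^ 'n)) h2"
    assume g: "g \<in> h2_space (defect_space S \<times> \<E>\<^sub>2)"
    let ?f = "ampliation (inv_into (defect_space T) W) g"
    have f: "?f \<in> h2_space (defect_space T)"
      by (rule bounded_opD(1)[OF bounded_op_ampliation[OF cF bd[OF iW]] g])
    have "ampliation W ?f = g"
      by (rule h2_eqI) (simp add: coeff_ampliation[OF bd[OF W] f] coeff_ampliation[OF bd[OF iW] g]
          hilbert_iso_inv_into(2)[OF W] h2_spaceD[OF g])
    then show "ampliation W' (char_op T ?f) = M g" using fact[OF f] by (simp add: M_def)
  qed
  then have coinc: "coincide (defect_space T) (defect_star_space T) (char_op T)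
          (defect_space S \<times> \<E>\<^sub>2) (defect_star_space C \<times> \<E>\<^sub>1) M"
    unfolding coincide_def
    using T.bounded_op_char_op hilbert_iso_unitary_op[OF W] hilbert_iso_unitary_op[OF W'] fact
    unfolding M_def by blast

  \<comment> \<open>The case of a shift and a spherical co-isometry\<close>
  have special: "\<exists>(\<E> :: (('a \<times> 'b \<times> 'c) ^ 'n) set) G\<^sub>1 G\<^sub>2.
         closed_csubspace \<E> \<and>
         coisometry_op (h2_space (defect_star_space N \<times> \<E>)) (h2_space (defect_star_space T)) G\<^sub>1 \<and>
         partial_isometry_op (h2_space (defect_space T)) (h2_space (defect_space N \<times> \<E>)) G\<^sub>2 \<and>
         (\<forall>f\<in>h2_space (defect_space T).
            char_op T f = (G\<^sub>1 \<circ> block_diag (char_op N) id \<circ> G\<^sub>2) f)"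
    if \<W>: "closed_csubspace \<W>" "drury_arveson_shift_on \<W> S" and spherical: "spherical_coisometry C"
    for \<W> :: "'w set"
  proof -
    have DC: "defect_star_space C = {0}"
      by (rule defect_star_space_spherical_coisometry[OF tri(3) spherical])
    \<comment> \<open>With one outer factor acting from a defect component into {0} and the other
      equal to 0 there, only the identity summands survive: each outer map is a unitary, a
      coordinate projection and another unitary. \<Delta> is the adjoint of
      \<open>\<Gamma>\<^sub>1\<close>, and P is the projection onto the kernel of
      \<open>\<Gamma>\<^sub>2\<close>.\<close>
    define \<Gamma>\<^sub>1 where "\<Gamma>\<^sub>1 = (\<lambda>u. inv_into (defect_star_space T) W' (0, snd (U\<^sub>1 u)))"
    define \<Gamma>\<^sub>2 where "\<Gamma>\<^sub>2 = (\<lambda>e. U\<^sub>2 (0, snd (W e)))"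
    define \<Delta> where "\<Delta> = (\<lambda>y. inv_into (defect_star_space N \<times> \<E>) U\<^sub>1 (0, snd (W' y)))"
    define P where "P = (\<lambda>e. inv_into (defect_space T) W (fst (W e), 0))"
    have zero: "0 \<in> defect_space C" "0 \<in> defect_star_space S" "0 \<in> \<E>\<^sub>2"
      using closed_csubspaceD(2) C.closed_csubspace_defect_space S.closed_csubspace_defect_star_space cE(2) by blast+
    note WD = hilbert_isoD[OF W] and WD' = hilbert_isoD[OF W'] and UD1 = hilbert_isoD[OF U\<^sub>1]
      and UD2 = hilbert_isoD[OF U\<^sub>2]
    note Wi = hilbert_iso_inv_into[OF W] and Wi' = hilbert_iso_inv_into[OF W']
      and Ui = hilbert_iso_inv_into[OF U\<^sub>1]
    have cNE: "closed_csubspace (defect_star_space N \<times> \<E>)"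
      by (intro closed_csubspace_Times N.closed_csubspace_defect_star_space cE)
    have b\<Gamma>\<^sub>1: "bounded_op (defect_star_space N \<times> \<E>) (defect_star_space T) \<Gamma>\<^sub>1"
      unfolding \<Gamma>\<^sub>1_def
      by (rule bounded_op_compose[OF bounded_op_compose[OF bd[OF U\<^sub>1] bounded_op_zero_snd] bd[OF iW']]) (simp add: DC)
    have b\<Gamma>\<^sub>2: "bounded_op (defect_space T) (defect_space N \<times> \<E>) \<Gamma>\<^sub>2"
      unfolding \<Gamma>\<^sub>2_def
      by (rule bounded_op_compose[OF bounded_op_compose[OF bd[OF W] bounded_op_zero_snd[OF zero(2)]] bd[OF U\<^sub>2]])
    have b\<Delta>: "bounded_op (defect_star_space T) (defect_star_space N \<times> \<E>) \<Delta>"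
      unfolding \<Delta>_def
      by (rule bounded_op_compose[OF bounded_op_compose[OF bd[OF W'] bounded_op_zero_snd[OF zero(1)]] bd[OF iU]])
    have bP: "bounded_op (defect_space T) (defect_space T) P"
      unfolding P_def
      by (rule bounded_op_compose[OF bounded_op_compose[OF bd[OF W] bounded_op_fst_zero[OF zero(3)]] bd[OF iW]])
    have W'0: "W' y = (0, snd (W' y))" "snd (W' y) \<in> \<E>\<^sub>1" if "y \<in> defect_star_space T" for y
      using WD'(6)[OF that] by (auto simp: DC)
    have in1: "(0, snd (W' y)) \<in> defect_space C \<times> \<E>\<^sub>1" if "y \<in> defect_star_space T" for y
      using W'0(2)[OF that] zero by simp
    have in2: "(0, snd (U\<^sub>1 u)) \<in> defect_star_space C \<times> \<E>\<^sub>1" if "u \<in> defect_star_space N \<times> \<E>" for u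
      using UD1(6)[OF that] by (auto simp: DC)
    have in3: "(0, snd (W e)) \<in> defect_star_space S \<times> \<E>\<^sub>2" "(fst (W e), 0) \<in> defect_space S \<times> \<E>\<^sub>2"
      if "e \<in> defect_space T" for e
      using WD(6)[OF that] zero by (auto simp: mem_Times_iff)
    have co: "coisometry_op (h2_space (defect_star_space N \<times> \<E>)) (h2_space (defect_star_space T)) (ampliation \<Gamma>\<^sub>1)"
    proof (rule coisometry_op_ampliation[OF cNE cT(2) b\<Gamma>\<^sub>1 b\<Delta>])
      fix x y assume x: "x \<in> defect_star_space N \<times> \<E>" and y: "y \<in> defect_star_space T"
      have "cinner (\<Gamma>\<^sub>1 x) y = cinner (W' (\<Gamma>\<^sub>1 x)) (W' y)"
        by (rule hilbert_iso_cinner[OF W' bounded_opD(1)[OF b\<Gamma>\<^sub>1 x] y, symmetric])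
      also have "\<dots> = cinner (snd (U\<^sub>1 x)) (snd (W' y))"
        unfolding \<Gamma>\<^sub>1_def Wi'(2)[OF in2[OF x]] by (simp add: cinner_prod_def)
      also have "\<dots> = cinner (U\<^sub>1 x) (U\<^sub>1 (\<Delta> y))"
        unfolding \<Delta>_def Ui(2)[OF in1[OF y]] by (simp add: cinner_prod_def)
      also have "\<dots> = cinner x (\<Delta> y)"
        by (rule hilbert_iso_cinner[OF U\<^sub>1 x bounded_opD(1)[OF b\<Delta> y]])
      finally show "cinner (\<Gamma>\<^sub>1 x) y = cinner x (\<Delta> y)" .
    next
      fix y assume y: "y \<in> defect_star_space T"
      have "\<Gamma>\<^sub>1 (\<Delta> y) = inv_into (defect_star_space T) W' (0, snd (W' y))"
        unfolding \<Gamma>\<^sub>1_def \<Delta>_def Ui(2)[OF in1[OF y]] by simp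
      then show "\<Gamma>\<^sub>1 (\<Delta> y) = y" using W'0(1)[OF y] Wi'(1)[OF y] by simp
    qed
    have pi: "partial_isometry_op (h2_space (defect_space T)) (h2_space (defect_space N \<times> \<E>)) (ampliation \<Gamma>\<^sub>2)"
    proof (rule partial_isometry_op_ampliation[OF cT(1) b\<Gamma>\<^sub>2 bP])
      fix x assume x: "x \<in> defect_space T"
      have WP: "W (P x) = (fst (W x), 0)" unfolding P_def by (rule Wi(2)[OF in3(2)[OF x]])
      have "\<Gamma>\<^sub>2 (P x) = U\<^sub>2 0" unfolding \<Gamma>\<^sub>2_def WP by (simp add: zero_prod_def)
      also have "\<dots> = 0" using UD2(5)[of 0] zero by (simp add: zero_prod_def)
      finally show "\<Gamma>\<^sub>2 (P x) = 0" .
      have Px: "P x \<in> defect_space T" by (rule bounded_opD(1)[OF bP x])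
      have "inner x (P x) = inner (W x) (W (P x))" by (rule hilbert_iso_inner[OF W x Px, symmetric])
      also have "\<dots> = inner (W (P x)) (W (P x))" unfolding WP by (simp add: inner_prod_def)
      also have "\<dots> = (norm (P x))\<^sup>2" unfolding power2_norm_eq_inner by (rule hilbert_iso_inner[OF W Px Px])
      finally show "inner x (P x) = (norm (P x))\<^sup>2" .
      show "norm (\<Gamma>\<^sub>2 x) = norm x" if "P x = 0"
      proof -
        have "norm (W (P x)) = 0" using WD(5)[OF Px] that by simp
        then have "fst (W x) = 0" unfolding WP by (simp add: zero_prod_def)
        then have "norm (W x) = norm (snd (W x))" by (simp add: norm_prod_def)
        then show ?thesis
          unfolding \<Gamma>\<^sub>2_def using UD2(5)[OF in3(1)[OF x]] WD(5)[OF x] by simp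
      qed
    qed
    have "char_op T f = (ampliation \<Gamma>\<^sub>1 \<circ> block_diag (char_op N) id \<circ> ampliation \<Gamma>\<^sub>2) f"
      if f: "f \<in> h2_space (defect_space T)" for f
    proof -
      have cW: "coeff (ampliation W f) \<alpha> = W (coeff f \<alpha>)" for \<alpha>
        by (rule coeff_ampliation[OF bd[OF W] f])
      have Wf: "W (coeff f \<alpha>) \<in> defect_space S \<times> \<E>\<^sub>2" for \<alpha> by (rule WD(6)[OF h2_spaceD[OF f]])
      define u\<^sub>1 where "u\<^sub>1 = block_diag (char_op S) id (ampliation W f)"
      have "ampliation fst (ampliation W f) \<in> h2_space (defect_space S)"
        using Wf by (simp add: h2_space_def coeff_ampliation_bop bop_fst cW mem_Times_iff)
      from char_op_shift[OF tri(1) \<W> this]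
      have cu1: "coeff u\<^sub>1 \<alpha> = (0, snd (W (coeff f \<alpha>)))" for \<alpha>
        by (simp add: u\<^sub>1_def coeff_block_diag coeff_zero coeff_ampliation_bop bop_snd cW)
      have u1: "u\<^sub>1 \<in> h2_space (defect_star_space S \<times> \<E>\<^sub>2)"
        using in3(1)[OF h2_spaceD[OF f]] by (simp add: h2_space_def cu1)
      have amp: "ampliation U\<^sub>2 u\<^sub>1 = ampliation \<Gamma>\<^sub>2 f"
        by (rule h2_eqI) (simp add: coeff_ampliation[OF bd[OF U\<^sub>2] u1] coeff_ampliation[OF b\<Gamma>\<^sub>2 f] cu1,
            simp add: \<Gamma>\<^sub>2_def)
      define u\<^sub>2 where "u\<^sub>2 = block_diag (char_op N) id (ampliation \<Gamma>\<^sub>2 f)"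
      have G2: "\<Gamma>\<^sub>2 (coeff f \<alpha>) \<in> defect_space N \<times> \<E>" for \<alpha> by (rule bounded_opD(1)[OF b\<Gamma>\<^sub>2 h2_spaceD[OF f]])
      then have "ampliation fst (ampliation \<Gamma>\<^sub>2 f) \<in> h2_space (defect_space N)"
        by (simp add: h2_space_def coeff_ampliation_bop bop_fst coeff_ampliation[OF b\<Gamma>\<^sub>2 f] mem_Times_iff)
      from N.char_op_in[OF this] have u2: "u\<^sub>2 \<in> h2_space (defect_star_space N \<times> \<E>)"
        using G2 by (simp add: h2_space_def u\<^sub>2_def coeff_block_diag coeff_ampliation_bop bop_snd
            coeff_ampliation[OF b\<Gamma>\<^sub>2 f] mem_Times_iff)
      have "ampliation fst (ampliation U\<^sub>1 u\<^sub>2) \<in> h2_space (defect_space C)"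
        using UD1(6)[OF h2_spaceD[OF u2]]
        by (simp add: h2_space_def coeff_ampliation_bop bop_fst coeff_ampliation[OF bd[OF U\<^sub>1] u2] mem_Times_iff)
      from C.char_op_in[OF this]
      have cu3: "coeff (block_diag (char_op C) id (ampliation U\<^sub>1 u\<^sub>2)) \<alpha> = (0, snd (U\<^sub>1 (coeff u\<^sub>2 \<alpha>)))" for \<alpha>
        by (simp add: h2_space_def DC coeff_block_diag coeff_ampliation_bop bop_snd coeff_ampliation[OF bd[OF U\<^sub>1] u2])
      have "W' (coeff (char_op T f) \<alpha>) = (0, snd (U\<^sub>1 (coeff u\<^sub>2 \<alpha>)))" for \<alpha>
        using arg_cong[OF fact[OF f], of "\<lambda>g. coeff g \<alpha>"]
        by (simp add: coeff_ampliation[OF bd[OF W'] T.char_op_in[OF f]] amp cu3 flip: u\<^sub>1_def u\<^sub>2_def)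
      then have "coeff (char_op T f) \<alpha> = \<Gamma>\<^sub>1 (coeff u\<^sub>2 \<alpha>)" for \<alpha>
        using Wi'(1)[OF h2_spaceD[OF T.char_op_in[OF f]], of \<alpha>] by (simp add: \<Gamma>\<^sub>1_def)
      then have "char_op T f = ampliation \<Gamma>\<^sub>1 u\<^sub>2"
        by (intro h2_eqI) (simp add: coeff_ampliation[OF b\<Gamma>\<^sub>1 u2])
      then show ?thesis by (simp add: u\<^sub>2_def)
    qed
    then show ?thesis using cE(3) co pi by blast
  qed
  show ?thesis
    using tri(1-3) cE hilbert_iso_unitary_op[OF U\<^sub>1] hilbert_iso_unitary_op[OF U\<^sub>2] coinc[unfolded M_def] special
    by blast
qed

end
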